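(* Let $\theta\in(\underline\theta,\bar\theta)$ and $t>0$. Then $$\widehat{\mathbf E}_\theta(Q(t))=t\cdot V^{\varrho_\theta},$$ where $\widehat{\mathbf E}_\theta$ is the expectation for the process started from $\underline{\widehat\mu}_\theta$ together with a second class particle started at the origin, with position $Q(t)$ at time $t$, and $V^{\varrho}=\frac{\mathrm d\mathcal H(\varrho)}{\mathrm d\varrho}$ is the characteristic speed, evaluated at the density $\varrho_\theta=\mathbf E_\theta(\omega_0)$.
   Context: **Model.** Let $-\infty\le\omega^{\min}\le 0$ and $1\le\omega^{\max}\le\infty$ be (possibly infinite valued) integers, $I=\{z\in\mathbb Z:\omega^{\min}-1<z<\omega^{\max}+1\}$, $\Omega=I^{\mathbb Z}$, with elements $\underline\omega=(\omega_i)_{i\in\mathbb Z}$. Integer heights $h_i$ ($i\in\mathbb Z$) satisfy $\omega_i=h_{i-1}-h_i$. The dynamics: for each $i\in\mathbb Z$, at rate $p(\omega_i,\omega_{i+1})$ a brick is added, $(\omega_i,\omega_{i+1})\to(\omega_i-1,\omega_{i+1}+1)$, $h_i\to h_i+1$; at rate $q(\omega_i,\omega_{i+1})$ a brick is removed, $(\omega_i,\omega_{i+1})\to(\omega_i+1,\omega_{i+1}-1)$, $h_i\to h_i-1$. Conditionally on $\underline\omega(t)$ these moves are independent. The process is Markov with formal generator, on cylinder functions $\varphi$ (functions of finitely many coordinates), $$(L\varphi)(\underline\omega)=\sum_{i}p(\omega_i,\omega_{i+1})[\varphi(\dots,\omega_i-1,\omega_{i+1}+1,\dots)-\varphi(\underline\omega)]+\sum_i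 q(\omega_i,\omega_{i+1})[\varphi(\dots,\omega_i+1,\omega_{i+1}-1,\dots)-\varphi(\underline\omega)].$$ **Standing assumptions on $p,q:I\times I\to[0,\infty)$.** (1) $p(\omega^{\min},\cdot)\equiv p(\cdot,\omega^{\max})\equiv q(\omega^{\max},\cdot)\equiv q(\cdot,\omega^{\min})\equiv0$ whenever the corresponding $\omega^{\min}$ or $\omega^{\max}$ is finite. Either $p$ and $q$ are both non-zero in all other cases, or one of them is identically zero (and the other is non-zero in all other cases). (2) (Attractivity) $p(z+1,y)\ge p(z,y)$, $p(y,z+1)\le p(y,z)$, $q(z+1,y)\le q(z,y)$, $q(y,z+1)\ge q(y,z)$ for $y,z,z+1\in I$. (3) For all $x,y,z\in I$: $p(x,y)+p(y,z)+p(z,x)+q(x,y)+q(y,z)+q(z,x)=p(x,z)+p(z,y)+p(y,x)+q(x,z)+q(z,y)+q(y,x)$. (4) There are symmetric functions $s_p,s_q$ and a function $f$, with $f(\omega^{\min})=0$ if $\omega^{\min}$ is finite, such that $p(y,z)=s_p(y,z+1)f(y)$ and $q(y,z)=s_q(y+1,z)f(z)$ for $y,z\in I$. ($f$ is then non-decreasing on $I$.) (5) All moments of the rates $p(\omega_0,\omega_1),q(\omega_0,\omega_1)$ are finite under the distributions $\underline\mu_\theta$ below. (6) The dynamics exists on a set $\widetilde\Omega\subset\Omega$ of tempered configurations (configurations obeying some growth restrictions) of full $\underline\mu_\theta$-measure, with the usual properties of the semigroup and the generator acting on nice functions. **Stationary measures.** For $z\in I$: $f(z)!=\prod_{y=1}^zf(y)$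 if $z>0$, $f(0)!=1$, $f(z)!=1/\prod_{y=z+1}^0f(y)$ if $z<0$. Let $\bar\theta=\lim_{z\to\infty}\log f(z)$ if $\omega^{\max}=\infty$, $\bar\theta=\infty$ otherwise; $\underline\theta=\lim_{z\to\infty}\log f(-z)$ if $\omega^{\min}=-\infty$, $\underline\theta=-\infty$ otherwise. Assume $\underline\theta<\bar\theta$. For $\theta\in(\underline\theta,\bar\theta)$ let $Z(\theta)=\sum_{z\in I}e^{\theta z}/f(z)!<\infty$, $\mu_\theta(z)=\frac1{Z(\theta)}\frac{e^{\theta z}}{f(z)!}$ for $z\in I$ and $\mu_\theta(z)=0$ for $z\notin I$. $\underline\mu_\theta$ is the product distribution on $\Omega$ with all marginals $\mu_\theta$; it is stationary for the process. $\mathbf E_\theta$ is the expectation under $\underline\mu_\theta$. **Basic coupling and second class particle.** Two copies $\underline\eta(\cdot)\le\underline\zeta(\cdot)$ (coordinatewise) of the process are coupled as follows. For each $i$ write "up" for the move $(\cdot_i,\cdot_{i+1})\to(\cdot_i-1,\cdot_{i+1}+1)$ and "down" for $(\cdot_i,\cdot_{i+1})\to(\cdot_i+1,\cdot_{i+1}-1)$. The rates are: only $\underline\zeta$ up: $p(\zeta_i,\zeta_{i+1})-p(\eta_i,\zeta_{i+1})$; only $\underline\eta$ up: $p(\eta_i,\eta_{i+1})-p(\eta_i,\zeta_{i+1})$; both up: $p(\eta_i,\zeta_{i+1})$; only $\underline\zeta$ down: $q(\zeta_i,\zeta_{i+1})-q(\zeta_i,\eta_{i+1})$; only $\underline\eta$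 down: $q(\eta_i,\eta_{i+1})-q(\zeta_i,\eta_{i+1})$; both down: $q(\zeta_i,\eta_{i+1})$. This preserves $\underline\eta\le\underline\zeta$ and the total discrepancy. Let $\underline\delta_i$ be the configuration that is $1$ at site $i$ and $0$ elsewhere. If $\omega_0(0)<\omega^{\max}$, start the coupled pair $(\underline\omega,\underline\omega^+)$ (as $(\underline\eta,\underline\zeta)$) with $\underline\omega^+(0)=\underline\omega(0)+\underline\delta_0$; then $\underline\omega^+(t)=\underline\omega(t)+\underline\delta_{Q(t)}$ for all $t\ge0$, which defines $Q(t)$, the position of the second class particle. **Modified initial distribution.** Let $g(z)=z-\sum_{y\in I}y\,\mu_\theta(y)$. $\underline{\widehat\mu}_\theta$ is the product measure with marginal $\mu_\theta$ at every site except the origin, where $$\underline{\widehat\mu}_\theta\{\underline\omega:\omega_0=y\}=\frac1{\mathbf{Var}(\omega_0)}\sum_{z=y+1}^{\omega^{\max}}g(z)\mu_\theta(z)\qquad(y\in I),$$ with $\mathbf{Var}(\omega_0)$ the variance under $\mu_\theta$ and empty sums equal to zero (so $\omega_0<\omega^{\max}$ almost surely under $\underline{\widehat\mu}_\theta$). $\widehat{\mathbf E}_\theta$ is the expectation for the process with $\underline\omega(0)\sim\underline{\widehat\mu}_\theta$. **Hydrodynamic quantities.** $\varrho_\theta=\mathbf E_\theta(\omega_0)$; since $\mathrm d\varrho_\theta/\mathrm d\theta=\mathbf{Var}(\omega_0)>0$, $\theta\mapsto\varrho_\theta$ is one-to-one. The hydrodynamic flux is $\mathcal H(\varrho)=\mathbf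 E_\theta[p(\omega_0,\omega_1)-q(\omega_0,\omega_1)]$ with the value of $\theta$ for which $\varrho=\varrho_\theta$. *)

theory Defs
  imports "HOL-Probability.Probability" "HOL-Library.Extended"
begin

section \<open>Single-site weights and product measures\<close>

text \<open>The bounds \<open>wmin\<close>, \<open>wmax\<close> are elements of \<open>int extended\<close>, i.e. integers or \<open>Minf\<close>, \<open>Pinf\<close>.\<close>

definition site_set :: "int extended \<Rightarrow> int extended \<Rightarrow> int set" where
  "site_set wmin wmax = {z. wmin \<le> Fin z \<and> Fin z \<le> wmax}"

definition ffact :: "(int \<Rightarrow> real) \<Rightarrow> int \<Rightarrow> real" where
  "ffact f z = (if 0 \<le> z then \<Prod>y\<in>{1..z}. f y else 1 / (\<Prod>y\<in>{z+1..0}. f y))"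

definition theta_upper :: "int extended \<Rightarrow> (int \<Rightarrow> real) \<Rightarrow> ereal" where
  "theta_upper wmax f =
     (if wmax = Pinf then lim (\<lambda>n. ereal (ln (f (int n)))) else (\<infinity>::ereal))"

definition theta_lower :: "int extended \<Rightarrow> (int \<Rightarrow> real) \<Rightarrow> ereal" where
  "theta_lower wmin f =
     (if wmin = Minf then lim (\<lambda>n. ereal (ln (f (- int n)))) else - (\<infinity>::ereal))"

definition theta_range :: "int extended \<Rightarrow> int extended \<Rightarrow> (int \<Rightarrow> real) \<Rightarrow> real set" where
  "theta_range wmin wmax f =
     {\<theta>. theta_lower wmin f < ereal \<theta> \<and> ereal \<theta> < theta_upper wmax f}"

definition partition_fn :: "int extended \<Rightarrow> int extended \<Rightarrow> (int \<Rightarrow> real) \<Rightarrow> real \<Rightarrow> real" where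
  "partition_fn wmin wmax f \<theta> =
     (\<Sum>\<^sub>\<infinity>z\<in>site_set wmin wmax. exp (\<theta> * of_int z) / ffact f z)"

definition site_weight ::
    "int extended \<Rightarrow> int extended \<Rightarrow> (int \<Rightarrow> real) \<Rightarrow> real \<Rightarrow> int \<Rightarrow> real" where
  "site_weight wmin wmax f \<theta> z =
     (if z \<in> site_set wmin wmax
      then (1 / partition_fn wmin wmax f \<theta>) * (exp (\<theta> * of_int z) / ffact f z) else 0)"

text \<open>The measurable space \<open>int_seq_space\<close> carries both the increment configurations
  \<open>\<omega>\<close> and the height configurations \<open>h\<close>.\<close>

type_synonym int_seq = "int \<Rightarrow> int"

definition int_seq_space :: "int_seq measure" where
  "int_seq_space = Pi\<^sub>M UNIV (\<lambda>_. count_space UNIV)"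

definition stat_measure ::
    "int extended \<Rightarrow> int extended \<Rightarrow> (int \<Rightarrow> real) \<Rightarrow> real \<Rightarrow> int_seq measure" where
  "stat_measure wmin wmax f \<theta> =
     Pi\<^sub>M UNIV (\<lambda>_. point_measure UNIV (\<lambda>z. ennreal (site_weight wmin wmax f \<theta> z)))"

definition density_at :: "int extended \<Rightarrow> int extended \<Rightarrow> (int \<Rightarrow> real) \<Rightarrow> real \<Rightarrow> real" where
  "density_at wmin wmax f \<theta> = (\<integral>\<omega>. of_int (\<omega> 0) \<partial>stat_measure wmin wmax f \<theta>)"

definition site_variance :: "int extended \<Rightarrow> int extended \<Rightarrow> (int \<Rightarrow> real) \<Rightarrow> real \<Rightarrow> real" where
  "site_variance wmin wmax f \<theta> =
     (\<integral>\<omega>. (of_int (\<omega> 0) - density_at wmin wmax f \<theta>)\<^sup>2 \<partial>stat_measure wmin wmax f \<theta>)"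

definition centred :: "int extended \<Rightarrow> int extended \<Rightarrow> (int \<Rightarrow> real) \<Rightarrow> real \<Rightarrow> int \<Rightarrow> real" where
  "centred wmin wmax f \<theta> z =
     of_int z - (\<Sum>\<^sub>\<infinity>y\<in>site_set wmin wmax. of_int y * site_weight wmin wmax f \<theta> y)"

definition hat_weight ::
    "int extended \<Rightarrow> int extended \<Rightarrow> (int \<Rightarrow> real) \<Rightarrow> real \<Rightarrow> int \<Rightarrow> real" where
  "hat_weight wmin wmax f \<theta> y =
     (if y \<in> site_set wmin wmax
      then (1 / site_variance wmin wmax f \<theta>) *
           (\<Sum>\<^sub>\<infinity>z\<in>{z\<in>site_set wmin wmax. y + 1 \<le> z}.
              centred wmin wmax f \<theta> z * site_weight wmin wmax f \<theta> z)
      else 0)"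

definition hat_measure ::
    "int extended \<Rightarrow> int extended \<Rightarrow> (int \<Rightarrow> real) \<Rightarrow> real \<Rightarrow> int_seq measure" where
  "hat_measure wmin wmax f \<theta> =
     Pi\<^sub>M UNIV (\<lambda>i. point_measure UNIV (\<lambda>z. ennreal
        (if i = 0 then hat_weight wmin wmax f \<theta> z else site_weight wmin wmax f \<theta> z)))"

text \<open>The hydrodynamic flux as a function of the density \<open>r\<close>; \<open>density_at\<close> is injective on \<open>theta_range\<close>.\<close>

definition flux ::
    "int extended \<Rightarrow> int extended \<Rightarrow> (int \<Rightarrow> int \<Rightarrow> real) \<Rightarrow> (int \<Rightarrow> int \<Rightarrow> real) \<Rightarrow>
     (int \<Rightarrow> real) \<Rightarrow> real \<Rightarrow> real" where
  "flux wmin wmax p q f r =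
     (let \<theta> = (THE \<theta>. \<theta> \<in> theta_range wmin wmax f \<and> density_at wmin wmax f \<theta> = r)
      in \<integral>\<omega>. p (\<omega> 0) (\<omega> 1) - q (\<omega> 0) (\<omega> 1) \<partial>stat_measure wmin wmax f \<theta>)"

section \<open>Assumptions on the rates\<close>

locale deposition_rates =
  fixes wmin wmax :: "int extended"
    and p q :: "int \<Rightarrow> int \<Rightarrow> real"
    and sp sq :: "int \<Rightarrow> int \<Rightarrow> real"
    and f :: "int \<Rightarrow> real"
  assumes wmin_le: "wmin \<le> Fin 0" and wmax_ge: "Fin 1 \<le> wmax"
    and rates_nonneg:
      "\<And>y z. y \<in> site_set wmin wmax \<Longrightarrow> z \<in> site_set wmin wmax \<Longrightarrow> 0 \<le> p y z \<and> 0 \<le> q y z"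
    and rates_wmin:
      "\<And>y z. Fin z = wmin \<Longrightarrow> y \<in> site_set wmin wmax \<Longrightarrow> p z y = 0 \<and> q y z = 0"
    and rates_wmax:
      "\<And>y z. Fin z = wmax \<Longrightarrow> y \<in> site_set wmin wmax \<Longrightarrow> p y z = 0 \<and> q z y = 0"
    and rates_nonzero:
      "let I = site_set wmin wmax;
           p_nonzero = (\<forall>y\<in>I. \<forall>z\<in>I. Fin y \<noteq> wmin \<longrightarrow> Fin z \<noteq> wmax \<longrightarrow> p y z \<noteq> 0);
           q_nonzero = (\<forall>y\<in>I. \<forall>z\<in>I. Fin y \<noteq> wmax \<longrightarrow> Fin z \<noteq> wmin \<longrightarrow> q y z \<noteq> 0);
           p_zero = (\<forall>y\<in>I. \<forall>z\<in>I. p y z = 0);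
           q_zero = (\<forall>y\<in>I. \<forall>z\<in>I. q y z = 0)
       in (p_nonzero \<and> q_nonzero) \<or> (p_zero \<and> q_nonzero) \<or> (p_nonzero \<and> q_zero)"
    and attractive:
      "\<And>y z. y \<in> site_set wmin wmax \<Longrightarrow> z \<in> site_set wmin wmax \<Longrightarrow> z + 1 \<in> site_set wmin wmax \<Longrightarrow>
         p (z + 1) y \<ge> p z y \<and> p y (z + 1) \<le> p y z \<and> q (z + 1) y \<le> q z y \<and> q y (z + 1) \<ge> q y z"
    and cyclic:
      "\<And>x y z. x \<in> site_set wmin wmax \<Longrightarrow> y \<in> site_set wmin wmax \<Longrightarrow> z \<in> site_set wmin wmax \<Longrightarrow>
         p x y + p y z + p z x + q x y + q y z + q z x
         = p x z + p z y + p y x + q x z + q z y + q y x"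
    and sp_sym: "\<And>y z. sp y z = sp z y" and sq_sym: "\<And>y z. sq y z = sq z y"
    and f_wmin: "\<And>z. Fin z = wmin \<Longrightarrow> f z = 0"
    \<comment> \<open>The factorisation below determines \<open>f\<close> only up to a common sign change of \<open>sp\<close>, \<open>sq\<close>, \<open>f\<close>;
        taking logarithms of \<open>f\<close> presupposes the nonnegative choice.\<close>
    and f_nonneg: "\<And>z. z \<in> site_set wmin wmax \<Longrightarrow> 0 \<le> f z"
    and p_factor:
      "\<And>y z. y \<in> site_set wmin wmax \<Longrightarrow> z \<in> site_set wmin wmax \<Longrightarrow> p y z = sp y (z + 1) * f y"
    and q_factor:
      "\<And>y z. y \<in> site_set wmin wmax \<Longrightarrow> z \<in> site_set wmin wmax \<Longrightarrow> q y z = sq (y + 1) z * f z"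
    and theta_nonempty: "theta_lower wmin f < theta_upper wmax f"
    and rate_moments:
      "\<And>\<theta> k::nat. \<theta> \<in> theta_range wmin wmax f \<Longrightarrow>
         integrable (stat_measure wmin wmax f \<theta>) (\<lambda>\<omega>. p (\<omega> 0) (\<omega> 1) ^ k) \<and>
         integrable (stat_measure wmin wmax f \<theta>) (\<lambda>\<omega>. q (\<omega> 0) (\<omega> 1) ^ k)"

section \<open>Heights and generators\<close>

definition incr :: "int_seq \<Rightarrow> int_seq" where
  "incr h i = h (i - 1) - h i"

text \<open>The height configuration with increments \<open>\<omega>\<close> and height 0 at the origin.\<close>

definition height_of :: "int_seq \<Rightarrow> int_seq" where
  "height_of \<omega> i = (if 0 \<le> i then - (\<Sum>j\<in>{1..i}. \<omega> j) else (\<Sum>j\<in>{i+1..0}. \<omega> j))"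

lemma incr_height_of: "incr (height_of \<omega>) = \<omega>"
proof
  fix i :: int
  show "incr (height_of \<omega>) i = \<omega> i"
  proof (cases "0 < i")
    case True
    then have "{1..i} = insert i {1..i - 1}" by auto
    with True show ?thesis by (simp add: incr_def height_of_def)
  next
    case False
    then have "{i..0} = insert i {i + 1..0}" by auto
    with False show ?thesis by (cases "i = 0") (simp_all add: incr_def height_of_def)
  qed
qed

definition add_brick :: "int \<Rightarrow> int_seq \<Rightarrow> int_seq" where
  "add_brick i h = h(i := h i + 1)"

definition remove_brick :: "int \<Rightarrow> int_seq \<Rightarrow> int_seq" where
  "remove_brick i h = h(i := h i - 1)"

lemma incr_add_brick:
  "incr (add_brick i h) = (incr h)(i := incr h i - 1, i + 1 := incr h (i + 1) + 1)"
  by (auto simp: incr_def add_brick_def fun_eq_iff)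

lemma incr_remove_brick:
  "incr (remove_brick i h) = (incr h)(i := incr h i + 1, i + 1 := incr h (i + 1) - 1)"
  by (auto simp: incr_def remove_brick_def fun_eq_iff)

text \<open>The process is described through its heights, the rates being functions of the
  increments. On functions \<open>\<phi> \<circ> incr\<close> the operator \<open>gen\<close> is the generator of the increment
  process. For cylinder functions all but finitely many terms of the infinite sums vanish.\<close>

definition cylinder :: "(int_seq \<Rightarrow> real) \<Rightarrow> bool" where
  "cylinder \<phi> \<longleftrightarrow> (\<exists>A. finite A \<and> (\<forall>h h'. (\<forall>i\<in>A. h i = h' i) \<longrightarrow> \<phi> h = \<phi> h'))"

definition gen ::
    "(int \<Rightarrow> int \<Rightarrow> real) \<Rightarrow> (int \<Rightarrow> int \<Rightarrow> real) \<Rightarrow> (int_seq \<Rightarrow> real) \<Rightarrow> int_seq \<Rightarrow> real" where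
  "gen p q \<phi> h =
     (\<Sum>\<^sub>\<infinity>i. p (incr h i) (incr h (i + 1)) * (\<phi> (add_brick i h) - \<phi> h)) +
     (\<Sum>\<^sub>\<infinity>i. q (incr h i) (incr h (i + 1)) * (\<phi> (remove_brick i h) - \<phi> h))"

definition pair_cylinder :: "(int_seq \<times> int_seq \<Rightarrow> real) \<Rightarrow> bool" where
  "pair_cylinder \<phi> \<longleftrightarrow>
     (\<exists>A. finite A \<and>
       (\<forall>g h g' h'. (\<forall>i\<in>A. g i = g' i \<and> h i = h' i) \<longrightarrow> \<phi> (g, h) = \<phi> (g', h')))"

text \<open>The coefficients are nonnegative only for pairs with \<open>incr g \<le> incr h\<close>; the operator is
  used on such pairs alone.\<close>

definition coupled_gen ::
    "(int \<Rightarrow> int \<Rightarrow> real) \<Rightarrow> (int \<Rightarrow> int \<Rightarrow> real) \<Rightarrow>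
     (int_seq \<times> int_seq \<Rightarrow> real) \<Rightarrow> int_seq \<times> int_seq \<Rightarrow> real" where
  "coupled_gen p q \<phi> = (\<lambda>(g, h). let \<eta> = incr g; \<zeta> = incr h in
     (\<Sum>\<^sub>\<infinity>i. (p (\<zeta> i) (\<zeta> (i+1)) - p (\<eta> i) (\<zeta> (i+1))) * (\<phi> (g, add_brick i h) - \<phi> (g, h))) +
     (\<Sum>\<^sub>\<infinity>i. (p (\<eta> i) (\<eta> (i+1)) - p (\<eta> i) (\<zeta> (i+1))) * (\<phi> (add_brick i g, h) - \<phi> (g, h))) +
     (\<Sum>\<^sub>\<infinity>i. p (\<eta> i) (\<zeta> (i+1)) * (\<phi> (add_brick i g, add_brick i h) - \<phi> (g, h))) +
     (\<Sum>\<^sub>\<infinity>i. (q (\<zeta> i) (\<zeta> (i+1)) - q (\<zeta> i) (\<eta> (i+1))) * (\<phi> (g, remove_brick i h) - \<phi> (g, h))) +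
     (\<Sum>\<^sub>\<infinity>i. (q (\<eta> i) (\<eta> (i+1)) - q (\<zeta> i) (\<eta> (i+1))) * (\<phi> (remove_brick i g, h) - \<phi> (g, h))) +
     (\<Sum>\<^sub>\<infinity>i. q (\<zeta> i) (\<eta> (i+1)) * (\<phi> (remove_brick i g, remove_brick i h) - \<phi> (g, h))))"

section \<open>Markov semigroups and processes\<close>

text \<open>A measurable Markov semigroup on the set \<open>D\<close> of regular states of \<open>S\<close>. The measures
  \<open>P t x\<close> with \<open>x\<close> outside \<open>D\<close> carry no information.\<close>

definition markov_semigroup :: "'s measure \<Rightarrow> 's set \<Rightarrow> (real \<Rightarrow> 's \<Rightarrow> 's measure) \<Rightarrow> bool" where
  "markov_semigroup S D P \<longleftrightarrow>
     (\<lambda>(t, x). P t x) \<in> restrict_space borel {0..} \<Otimes>\<^sub>M S \<rightarrow>\<^sub>M prob_algebra S \<and>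
     (\<forall>x\<in>D. P 0 x = return S x) \<and>
     (\<forall>x\<in>D. \<forall>t\<ge>0. AE y in P t x. y \<in> D) \<and>
     (\<forall>x\<in>D. \<forall>s\<ge>0. \<forall>t\<ge>0. P (s + t) x = P s x \<bind> P t)"

text \<open>\<open>P\<^sub>t \<phi> = \<phi> + \<integral>\<^sub>0\<^sup>t P\<^sub>s (L \<phi>) ds\<close> on \<open>D\<close>.\<close>

definition forward_equation ::
    "'s set \<Rightarrow> (real \<Rightarrow> 's \<Rightarrow> 's measure) \<Rightarrow> (('s \<Rightarrow> real) \<Rightarrow> 's \<Rightarrow> real) \<Rightarrow> ('s \<Rightarrow> real) \<Rightarrow> bool" where
  "forward_equation D P L \<phi> \<longleftrightarrow>
     (\<forall>x\<in>D. \<forall>t\<ge>0.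
        (\<forall>s\<in>{0..t}. integrable (P s x) (L \<phi>)) \<and>
        set_integrable lborel {0..t} (\<lambda>s. \<integral>y. L \<phi> y \<partial>P s x) \<and>
        (\<integral>y. \<phi> y \<partial>P t x) = \<phi> x + (LINT s:{0..t}|lborel. (\<integral>y. L \<phi> y \<partial>P s x)))"

definition past_events :: "'w measure \<Rightarrow> 's measure \<Rightarrow> (real \<Rightarrow> 'w \<Rightarrow> 's) \<Rightarrow> real \<Rightarrow> 'w set set" where
  "past_events M S X s =
     sigma_sets (space M) {X r -` C \<inter> space M | r C. 0 \<le> r \<and> r \<le> s \<and> C \<in> sets S}"

definition markov_process ::
    "'w measure \<Rightarrow> 's measure \<Rightarrow> (real \<Rightarrow> 's \<Rightarrow> 's measure) \<Rightarrow> (real \<Rightarrow> 'w \<Rightarrow> 's) \<Rightarrow> bool" where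
  "markov_process M S P X \<longleftrightarrow>
     prob_space M \<and>
     (\<forall>t\<ge>0. X t \<in> M \<rightarrow>\<^sub>M S) \<and>
     (\<forall>s\<ge>0. \<forall>t\<ge>0. \<forall>A\<in>past_events M S X s. \<forall>B\<in>sets S.
        measure M (A \<inter> (X (s + t) -` B \<inter> space M))
        = (LINT x:A|M. measure (P t (X s x)) B))"

section \<open>Existence of the dynamics\<close>

abbreviation pair_space :: "(int_seq \<times> int_seq) measure" where
  "pair_space \<equiv> int_seq_space \<Otimes>\<^sub>M int_seq_space"

definition regular_heights :: "int_seq set \<Rightarrow> int_seq set" where
  "regular_heights T = {h. incr h \<in> T}"

definition regular_pairs :: "int_seq set \<Rightarrow> (int_seq \<times> int_seq) set" where
  "regular_pairs T = {(g, h). incr g \<in> T \<and> incr h \<in> T \<and> incr g \<le> incr h}"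

definition shift :: "int \<Rightarrow> int \<Rightarrow> int_seq \<Rightarrow> int_seq" where
  "shift a c h i = h (i + a) + c"

definition finite_discrepancy :: "int_seq \<times> int_seq \<Rightarrow> bool" where
  "finite_discrepancy = (\<lambda>(g, h). finite {i. incr g i \<noteq> incr h i})"

definition total_discrepancy :: "int_seq \<times> int_seq \<Rightarrow> int" where
  "total_discrepancy = (\<lambda>(g, h). \<Sum>i\<in>{i. incr g i \<noteq> incr h i}. incr h i - incr g i)"

text \<open>\<open>T\<close> is the set of tempered increment configurations, \<open>P\<close> the semigroup of the heights
  and \<open>K\<close> the semigroup of the basic coupling. Order preservation is contained in
  \<open>coupled_semigroup\<close>, since \<open>regular_pairs T\<close> consists of ordered pairs.\<close>

locale deposition_dynamics = deposition_rates +
  fixes T :: "int_seq set"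
    and P :: "real \<Rightarrow> int_seq \<Rightarrow> int_seq measure"
    and K :: "real \<Rightarrow> int_seq \<times> int_seq \<Rightarrow> (int_seq \<times> int_seq) measure"
  assumes T_sets: "T \<in> sets int_seq_space"
    and T_subset: "T \<subseteq> {\<omega>. \<forall>i. \<omega> i \<in> site_set wmin wmax}"
    and T_full: "\<And>\<theta>. \<theta> \<in> theta_range wmin wmax f \<Longrightarrow> AE \<omega> in stat_measure wmin wmax f \<theta>. \<omega> \<in> T"
    and semigroup: "markov_semigroup int_seq_space (regular_heights T) P"
    and generator:
      "\<And>\<phi>. cylinder \<phi> \<Longrightarrow> bounded (range \<phi>) \<Longrightarrow>
         forward_equation (regular_heights T) P (gen p q) \<phi>"
    \<comment> \<open>The rates do not depend on the site, and depend on \<open>h\<close> through \<open>incr h\<close> only.\<close>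
    and homogeneous:
      "\<And>t h a c. 0 \<le> t \<Longrightarrow> h \<in> regular_heights T \<Longrightarrow> shift a c h \<in> regular_heights T \<Longrightarrow>
         P t (shift a c h) = distr (P t h) int_seq_space (shift a c)"
    and stationary:
      "\<And>t \<theta>. 0 \<le> t \<Longrightarrow> \<theta> \<in> theta_range wmin wmax f \<Longrightarrow>
         distr (stat_measure wmin wmax f \<theta> \<bind> (\<lambda>\<omega>. P t (height_of \<omega>))) int_seq_space incr
         = stat_measure wmin wmax f \<theta>"
    and coupled_semigroup: "markov_semigroup pair_space (regular_pairs T) K"
    and coupled_generator:
      "\<And>\<phi>. pair_cylinder \<phi> \<Longrightarrow> bounded (range \<phi>) \<Longrightarrow>
         forward_equation (regular_pairs T) K (coupled_gen p q) \<phi>"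
    and coupled_marginals:
      "\<And>t g h. 0 \<le> t \<Longrightarrow> (g, h) \<in> regular_pairs T \<Longrightarrow>
         distr (K t (g, h)) int_seq_space fst = P t g \<and>
         distr (K t (g, h)) int_seq_space snd = P t h"
    and coupled_discrepancy:
      "\<And>t x. 0 \<le> t \<Longrightarrow> x \<in> regular_pairs T \<Longrightarrow> finite_discrepancy x \<Longrightarrow>
         AE y in K t x. finite_discrepancy y \<and> total_discrepancy y = total_discrepancy x"

section \<open>The second class particle\<close>

definition delta_conf :: "int \<Rightarrow> int_seq" where
  "delta_conf n i = (if i = n then 1 else 0)"

definition second_class_position :: "int_seq \<times> int_seq \<Rightarrow> int" where
  "second_class_position = (\<lambda>(g, h). THE n. \<forall>i. incr h i = incr g i + delta_conf n i)"

text \<open>Under this initial law, the first increment configuration is distributed according to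
  \<open>hat_measure\<close> and the second one has an extra particle at the origin.\<close>

definition second_class_start ::
    "int extended \<Rightarrow> int extended \<Rightarrow> (int \<Rightarrow> real) \<Rightarrow> real \<Rightarrow> (int_seq \<times> int_seq) measure" where
  "second_class_start wmin wmax f \<theta> =
     distr (hat_measure wmin wmax f \<theta>) pair_space
       (\<lambda>\<omega>. (height_of \<omega>, height_of (\<lambda>i. \<omega> i + delta_conf 0 i)))"

end

theory Submission
  imports Defs
begin

text \<open>Write \<open>J\<^sub>i(t) = h\<^sub>i(t) - h\<^sub>i(0)\<close> and \<open>a\<^sub>i = Cov (\<omega>\<^sub>0(0), J\<^sub>i(t))\<close> in the stationary process. Summation by parts
  in the law of \<open>\<omega>\<^sub>0(0)\<close>, which is where the modified initial law comes from, combined with the coupling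
  gives \<open>Var (\<omega>\<^sub>0) P (Q(t) = n) = Cov (\<omega>\<^sub>0(0), \<omega>\<^sub>n(t))\<close>, and this equals \<open>a\<^sub>n\<^sub>-\<^sub>1 - a\<^sub>n\<close>, plus \<open>Var (\<omega>\<^sub>0)\<close> if \<open>n = 0\<close>.
  By translation invariance \<open>a\<^sub>i = Cov (\<omega>\<^sub>-\<^sub>i(0), J\<^sub>0(t))\<close>, so Bessel's inequality for the orthogonal
  family \<open>\<omega>\<^sub>j(0) - \<rho>\<close> yields \<open>a\<^sub>i \<rightarrow> 0\<close>. Hence \<open>a\<^sub>i / Var (\<omega>\<^sub>0)\<close> is \<open>P (Q(t) > i)\<close> for \<open>i \<ge> 0\<close> and
  \<open>- P (Q(t) \<le> i)\<close> for \<open>i < 0\<close>, and the mean of \<open>Q(t)\<close> is \<open>(\<Sum>i. a\<^sub>i) / Var (\<omega>\<^sub>0)\<close>. Stationarity bounds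
  \<open>\<Sum>i. \<bar>a\<^sub>i\<bar>\<close> by twice the second moment of \<open>J\<^sub>0(t)\<close>.

  The sum of \<open>a\<^sub>i\<close> over \<open>-m \<le> i < m\<close> is the integral over \<open>s \<le> t\<close> of the covariance of the mass of a block of
  \<open>2 m\<close> sites at time \<open>0\<close> with the net rate \<open>p - q\<close> at the origin at time \<open>s\<close>. Moving the mass from time
  \<open>0\<close> to time \<open>s\<close> costs only the boundary currents \<open>J\<^sub>m(s)\<close> and \<open>J\<^sub>-\<^sub>m(s)\<close>, whose covariances with that
  rate vanish as \<open>m \<rightarrow> \<infinity>\<close>, again by translation invariance and Bessel's inequality. What remains is the
  static covariance \<open>d/d\<theta> E\<^sub>\<theta> (p - q)\<close>, the derivative of the flux times \<open>d\<rho>/d\<theta> = Var (\<omega>\<^sub>0)\<close>.\<close>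

text \<open>Two obstacles shape the proof. The forward equation is given only for bounded cylinder
  functions of the heights, while currents and rates are unbounded. So every identity is first
  derived for the height clamped to \<open>[-N, N]\<close>, and the limit in \<open>N\<close> rests
  on stationarity, which turns each moment of the rates at a later time into a moment under the
  product measure. The hypotheses also contain no bound on how fast information spreads, so distant
  covariances cannot be made small by locality. Only the qualitative decay of the coefficients of
  one fixed square integrable current is available; it yields limits without rates, and dominated
  convergence in time completes them. The law at the origin is a discrete Stein kernel: it is the
  tail sum of \<open>z - \<rho>\<close> against the site law, divided by the variance, and is
  characterised by E (F (x + 1) - F x) under it being Cov (x, F x) / Var under the site law. Placing
  the initial height \<open>0\<close> at the origin makes the height there at time \<open>t\<close>
  equal to the current. One coordinate then carries all the dynamics, and the other currents are its
  translates.\<close>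

definition square_integrable :: "'a measure \<Rightarrow> ('a \<Rightarrow> real) \<Rightarrow> bool" where
  "square_integrable M f \<longleftrightarrow> f \<in> borel_measurable M \<and> integrable M (\<lambda>x. (f x)\<^sup>2)"

lemma square_integrable_integrable_mult:
  assumes "square_integrable M f" "square_integrable M g"
  shows "integrable M (\<lambda>x. f x * g x)"
proof (rule Bochner_Integration.integrable_bound)
  show "integrable M (\<lambda>x. (f x)\<^sup>2 + (g x)\<^sup>2)"
    using assms by (auto simp: square_integrable_def)
  show "(\<lambda>x. f x * g x) \<in> borel_measurable M"
    using assms by (auto simp: square_integrable_def)
  have "\<bar>a * b\<bar> \<le> a\<^sup>2 + b\<^sup>2" for a b :: real
  proof -
    have "2 * (\<bar>a\<bar> * \<bar>b\<bar>) \<le> a\<^sup>2 + b\<^sup>2"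
      using sum_squares_bound[of "\<bar>a\<bar>" "\<bar>b\<bar>"] by (simp add: mult.assoc)
    moreover have "0 \<le> \<bar>a\<bar> * \<bar>b\<bar>" by simp
    ultimately show ?thesis unfolding abs_mult by linarith
  qed
  then show "AE x in M. norm (f x * g x) \<le> norm ((f x)\<^sup>2 + (g x)\<^sup>2)"
    by simp
qed

lemma square_integrable_add:
  assumes "square_integrable M f" "square_integrable M g"
  shows "square_integrable M (\<lambda>x. f x + g x)"
  using assms square_integrable_integrable_mult[OF assms]
  by (auto simp: square_integrable_def power2_sum mult.assoc)

lemma square_integrable_cmult:
  "square_integrable M f \<Longrightarrow> square_integrable M (\<lambda>x. c * f x)"
  by (auto simp: square_integrable_def power_mult_distrib)

lemma square_integrable_diff:
  assumes "square_integrable M f" "square_integrable M g"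
  shows "square_integrable M (\<lambda>x. f x - g x)"
  using square_integrable_add[OF assms(1) square_integrable_cmult[OF assms(2), of "-1"]] by simp

lemma square_integrable_sum:
  "(\<And>i. i \<in> I \<Longrightarrow> square_integrable M (f i)) \<Longrightarrow> square_integrable M (\<lambda>x. \<Sum>i\<in>I. f i x)"
proof (induction I rule: infinite_finite_induct)
  case (insert i I)
  then show ?case by (simp add: square_integrable_add)
qed (auto simp: square_integrable_def)

lemma square_integrable_abs:
  "square_integrable M f \<Longrightarrow> square_integrable M (\<lambda>x. \<bar>f x\<bar>)"
  by (auto simp: square_integrable_def)

lemma (in finite_measure) square_integrable_const: "square_integrable M (\<lambda>x. c)"
  by (auto simp: square_integrable_def)

lemma (in finite_measure) square_integrable_imp_integrable:
  "square_integrable M f \<Longrightarrow> integrable M f"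
  using square_integrable_integrable_mult[OF _ square_integrable_const[of 1], of f] by simp

lemma (in finite_measure) square_integrable_bounded:
  "f \<in> borel_measurable M \<Longrightarrow> (\<And>x. \<bar>f x\<bar> \<le> B) \<Longrightarrow> square_integrable M f"
  unfolding square_integrable_def
  by (intro conjI integrable_const_bound[where B = "B\<^sup>2"] AE_I2)
     (simp_all, metis abs_ge_zero power2_abs power_mono)

text \<open>The arithmetic-geometric mean form of the Cauchy-Schwarz inequality. Its additive right
  side becomes a constant independent of time once both second moments are bounded, and such
  constants dominate the integrals over time.\<close>

lemma square_integrable_mult_bound:
  assumes "square_integrable M f" "square_integrable M g"
  shows "\<bar>\<integral>x. f x * g x \<partial>M\<bar> \<le> ((\<integral>x. (f x)\<^sup>2 \<partial>M) + (\<integral>x. (g x)\<^sup>2 \<partial>M)) / 2"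
proof -
  have "\<bar>\<integral>x. f x * g x \<partial>M\<bar> \<le> (\<integral>x. \<bar>f x * g x\<bar> \<partial>M)"
    by (rule integral_abs_bound)
  also have "\<dots> \<le> (\<integral>x. ((f x)\<^sup>2 + (g x)\<^sup>2) / 2 \<partial>M)"
  proof (rule integral_mono)
    show "integrable M (\<lambda>x. \<bar>f x * g x\<bar>)"
      using square_integrable_integrable_mult[OF assms] by simp
    show "integrable M (\<lambda>x. ((f x)\<^sup>2 + (g x)\<^sup>2) / 2)"
      using assms by (auto simp: square_integrable_def)
    show "\<bar>f x * g x\<bar> \<le> ((f x)\<^sup>2 + (g x)\<^sup>2) / 2" for x
      using sum_squares_bound[of "\<bar>f x\<bar>" "\<bar>g x\<bar>"] by (simp add: abs_mult mult.assoc)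
  qed
  also have "\<dots> = ((\<integral>x. (f x)\<^sup>2 \<partial>M) + (\<integral>x. (g x)\<^sup>2 \<partial>M)) / 2"
    using assms by (simp add: square_integrable_def)
  finally show ?thesis .
qed

text \<open>Bessel's inequality for the orthogonal family \<open>e\<close> makes the coefficients square summable.\<close>

lemma orthogonal_coefficients_tendsto_zero:
  fixes e :: "nat \<Rightarrow> 'a \<Rightarrow> real"
  assumes J: "square_integrable M J" and e: "\<And>n. square_integrable M (e n)"
    and orth: "\<And>m n. m \<noteq> n \<Longrightarrow> (\<integral>x. e m x * e n x \<partial>M) = 0"
    and norm: "\<And>n. (\<integral>x. (e n x)\<^sup>2 \<partial>M) = D"
  shows "(\<lambda>n. \<integral>x. J x * e n x \<partial>M) \<longlonglongrightarrow> 0"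
proof -
  define c where "c n = (\<integral>x. J x * e n x \<partial>M)" for n
  have "0 \<le> (\<integral>x. (e 0 x)\<^sup>2 \<partial>M)" by simp
  then have D: "0 \<le> D" by (simp only: norm)
  \<comment> \<open>\<open>J\<close> is compared with \<open>l * s\<close>, where \<open>s\<close>
    is the partial sum of its expansion. The best factor would be \<open>1 / D\<close>; adding one
    avoids division by zero when \<open>D = 0\<close> and still gives \<open>l * D \<le> 1\<close>,
    which is all the estimate uses.\<close>
  define l where "l = 1 / (D + 1)"
  have l: "0 < l" and lD: "l * D \<le> 1" using D by (auto simp: l_def field_simps)
  have bound: "(\<Sum>n<N. (c n)\<^sup>2) \<le> (\<integral>x. (J x)\<^sup>2 \<partial>M) / l" for N
  proof -
    define s where "s x = (\<Sum>n<N. c n * e n x)" for x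
    define S where "S = (\<Sum>n<N. (c n)\<^sup>2)"
    have s: "square_integrable M s"
      unfolding s_def by (intro square_integrable_sum square_integrable_cmult e)
    have Js: "(\<integral>x. J x * s x \<partial>M) = S"
    proof -
      have "(\<integral>x. J x * s x \<partial>M) = (\<integral>x. (\<Sum>n<N. c n * (J x * e n x)) \<partial>M)"
        by (simp only: s_def sum_distrib_left mult.left_commute)
      also have "\<dots> = (\<Sum>n<N. (\<integral>x. c n * (J x * e n x) \<partial>M))"
        by (intro Bochner_Integration.integral_sum integrable_mult_right square_integrable_integrable_mult[OF J e])
      also have "\<dots> = (\<Sum>n<N. c n * c n)"
        by (simp add: c_def)
      finally show ?thesis by (simp add: S_def power2_eq_square)
    qed
    have ss: "(\<integral>x. (s x)\<^sup>2 \<partial>M) = D * S"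
    proof -
      have "(\<integral>x. (s x)\<^sup>2 \<partial>M) = (\<integral>x. (\<Sum>m<N. \<Sum>n<N. (c m * c n) * (e m x * e n x)) \<partial>M)"
      proof (rule Bochner_Integration.integral_cong[OF refl])
        fix x
        have "(s x)\<^sup>2 = (\<Sum>m<N. \<Sum>n<N. (c m * e m x) * (c n * e n x))"
          unfolding s_def power2_eq_square by (rule sum_product)
        also have "\<dots> = (\<Sum>m<N. \<Sum>n<N. (c m * c n) * (e m x * e n x))"
          by (intro sum.cong refl) (simp only: mult_ac)
        finally show "(s x)\<^sup>2 = (\<Sum>m<N. \<Sum>n<N. (c m * c n) * (e m x * e n x))" .
      qed
      also have "\<dots> = (\<Sum>m<N. (\<integral>x. (\<Sum>n<N. (c m * c n) * (e m x * e n x)) \<partial>M))"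
        by (intro Bochner_Integration.integral_sum Bochner_Integration.integrable_sum
            integrable_mult_right square_integrable_integrable_mult[OF e e])
      also have "\<dots> = (\<Sum>m<N. \<Sum>n<N. (\<integral>x. (c m * c n) * (e m x * e n x) \<partial>M))"
        by (intro sum.cong refl Bochner_Integration.integral_sum
            integrable_mult_right square_integrable_integrable_mult[OF e e])
      also have "\<dots> = (\<Sum>m<N. \<Sum>n<N. if m = n then (c m)\<^sup>2 * D else 0)"
        using norm by (intro sum.cong refl) (auto simp: power2_eq_square orth)
      also have "\<dots> = (\<Sum>m<N. (c m)\<^sup>2 * D)" by simp
      also have "\<dots> = D * S" by (simp only: S_def sum_distrib_left mult.commute)
      finally show ?thesis .
    qed
    \<comment> \<open>The residual of \<open>J\<close> has nonnegative norm; expanding the square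
      bounds the sum of squared coefficients by a multiple of the norm of \<open>J\<close>,
      uniformly in \<open>N\<close>.\<close>
    have "0 \<le> (\<integral>x. (J x - l * s x)\<^sup>2 \<partial>M)" by simp
    also have "\<dots> = (\<integral>x. (J x)\<^sup>2 + l\<^sup>2 * (s x)\<^sup>2 - 2 * l * (J x * s x) \<partial>M)"
      by (intro Bochner_Integration.integral_cong refl) (simp add: power2_eq_square algebra_simps)
    also have "\<dots> = (\<integral>x. (J x)\<^sup>2 \<partial>M) + l\<^sup>2 * (D * S) - 2 * l * S"
    proof -
      have "integrable M (\<lambda>x. (J x)\<^sup>2)" "integrable M (\<lambda>x. (s x)\<^sup>2)"
        using J s by (simp_all add: square_integrable_def)
      then show ?thesis
        using square_integrable_integrable_mult[OF J s] by (simp add: ss Js)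
    qed
    finally have "2 * l * S \<le> (\<integral>x. (J x)\<^sup>2 \<partial>M) + l\<^sup>2 * (D * S)" by simp
    moreover have "l\<^sup>2 * (D * S) \<le> l * S"
    proof -
      have "(l * D) * (l * S) \<le> 1 * (l * S)"
        using lD l by (intro mult_right_mono) (auto simp: S_def intro!: mult_nonneg_nonneg sum_nonneg)
      then show ?thesis by (simp add: power2_eq_square algebra_simps)
    qed
    ultimately have "l * S \<le> (\<integral>x. (J x)\<^sup>2 \<partial>M)" by simp
    then show ?thesis using l by (simp add: S_def field_simps)
  qed
  have "summable (\<lambda>n. (c n)\<^sup>2)"
    by (rule summableI_nonneg_bounded[OF _ bound]) simp
  then have "(\<lambda>n. (c n)\<^sup>2) \<longlonglongrightarrow> 0" by (rule summable_LIMSEQ_zero)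
  then have "(\<lambda>n. sqrt ((c n)\<^sup>2)) \<longlonglongrightarrow> sqrt 0" by (rule tendsto_real_sqrt)
  then have "(\<lambda>n. \<bar>c n\<bar>) \<longlonglongrightarrow> 0" by simp
  then show ?thesis unfolding c_def by (rule tendsto_rabs_zero_cancel)
qed

text \<open>Fubini for a mixture of measures: \<open>nn_integral_bind\<close> covers nonnegative
  functions, and a real \<open>F\<close> is split into its positive and negative parts.\<close>

lemma
  fixes F :: "'b \<Rightarrow> real"
  assumes K: "K \<in> M \<rightarrow>\<^sub>M prob_algebra N" and F: "integrable (M \<bind> K) F" and FN: "F \<in> borel_measurable N"
    and ne: "space M \<noteq> {}"
  shows integral_bind_kernel: "(\<integral>y. F y \<partial>(M \<bind> K)) = (\<integral>x. (\<integral>y. F y \<partial>K x) \<partial>M)"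
    and integrable_bind_kernel: "integrable M (\<lambda>x. \<integral>y. F y \<partial>K x)"
proof -
  have KS[measurable]: "K \<in> M \<rightarrow>\<^sub>M subprob_algebra N"
    using K by (rule measurable_prob_algebraD)
  note FN[measurable]
  have sK: "x \<in> space M \<Longrightarrow> sets (K x) = sets N" for x
    using KS by (rule sets_kernel)
  have FK: "x \<in> space M \<Longrightarrow> F \<in> borel_measurable (K x)" for x
    using FN sK measurable_cong_sets by blast
  have nn: "(\<integral>\<^sup>+y. ennreal (g y) \<partial>(M \<bind> K)) = (\<integral>\<^sup>+x. \<integral>\<^sup>+y. ennreal (g y) \<partial>K x \<partial>M)"
    if "g \<in> borel_measurable N" for g :: "'b \<Rightarrow> real"
    using that by (intro nn_integral_bind[where B = N]) auto
  have fin: "(\<integral>\<^sup>+x. \<integral>\<^sup>+y. ennreal \<bar>F y\<bar> \<partial>K x \<partial>M) < \<infinity>"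
    using F nn[of "\<lambda>y. \<bar>F y\<bar>"] by (auto simp: integrable_iff_bounded)
  \<comment> \<open>Integrability against the mixture gives integrability only against almost every
    \<open>K x\<close>. At the exceptional points the Bochner integral takes its default value, so
    the identities below hold almost everywhere.\<close>
  have "AE x in M. (\<integral>\<^sup>+y. ennreal \<bar>F y\<bar> \<partial>K x) \<noteq> \<infinity>"
    using fin by (intro nn_integral_PInf_AE) auto
  then have ae: "AE x in M. integrable (K x) F"
    by (rule AE_mp) (auto simp: integrable_iff_bounded FK less_top intro!: AE_I2)
  have meas[measurable]: "(\<lambda>x. \<integral>y. F y \<partial>K x) \<in> borel_measurable M"
    by measurable
  show int: "integrable M (\<lambda>x. \<integral>y. F y \<partial>K x)"
    unfolding integrable_iff_bounded
  proof
    have "(\<integral>\<^sup>+x. ennreal (norm (\<integral>y. F y \<partial>K x)) \<partial>M) \<le> (\<integral>\<^sup>+x. \<integral>\<^sup>+y. ennreal \<bar>F y\<bar> \<partial>K x \<partial>M)"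
      using ae by (intro nn_integral_mono_AE) (auto elim!: eventually_mono dest: integral_norm_bound_ennreal)
    then show "(\<integral>\<^sup>+x. ennreal (norm (\<integral>y. F y \<partial>K x)) \<partial>M) < \<infinity>"
      using fin by (rule le_less_trans)
  qed fact
  \<comment> \<open>The claim for a nonnegative function below \<open>\<bar>F\<bar>\<close>, used
    later for both parts of \<open>F\<close>.\<close>
  have part: "integrable M (\<lambda>x. \<integral>y. g y \<partial>K x) \<and>
      (\<integral>y. g y \<partial>(M \<bind> K)) = (\<integral>x. (\<integral>y. g y \<partial>K x) \<partial>M)"
    if g[measurable]: "g \<in> borel_measurable N" and g0: "\<And>y. 0 \<le> g y" and gF: "\<And>y. g y \<le> \<bar>F y\<bar>" for g
  proof -
    have gi: "AE x in M. integrable (K x) g"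
    proof (rule AE_mp[OF ae], rule AE_I2, rule impI)
      fix x assume x: "x \<in> space M" and "integrable (K x) F"
      moreover have "g \<in> borel_measurable (K x)"
        by (subst measurable_cong_sets[OF sK[OF x] refl]) (rule g)
      ultimately show "integrable (K x) g"
        using g0 gF by (intro Bochner_Integration.integrable_bound[of "K x" F g] AE_I2) auto
    qed
    have "g \<in> borel_measurable (M \<bind> K)"
      by (subst measurable_cong_sets[OF sets_bind_measurable[OF KS ne] refl]) (rule g)
    then have gM: "integrable (M \<bind> K) g"
      using g0 gF by (intro Bochner_Integration.integrable_bound[OF F] AE_I2) auto
    have eq: "(\<integral>\<^sup>+x. ennreal (\<integral>y. g y \<partial>K x) \<partial>M) = (\<integral>\<^sup>+y. ennreal (g y) \<partial>(M \<bind> K))"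
      unfolding nn[OF g]
      using gi g0 by (intro nn_integral_cong_AE) (auto simp: nn_integral_eq_integral)
    have gn: "0 \<le> (\<integral>y. g y \<partial>L)" for L using g0 by simp
    have eq': "(\<integral>\<^sup>+x. ennreal (\<integral>y. g y \<partial>K x) \<partial>M) = ennreal (\<integral>y. g y \<partial>(M \<bind> K))"
      unfolding eq by (rule nn_integral_eq_integral[OF gM]) (simp add: g0)
    have gme: "(\<lambda>x. \<integral>y. g y \<partial>K x) \<in> borel_measurable M"
      by measurable
    have i: "integrable M (\<lambda>x. \<integral>y. g y \<partial>K x)"
      by (rule integrableI_nn_integral_finite[OF gme _ eq']) (simp_all add: gn)
    have "(\<integral>x. (\<integral>y. g y \<partial>K x) \<partial>M) = (\<integral>y. g y \<partial>(M \<bind> K))"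
      by (rule integral_eq_nn_integral[OF gme, THEN trans]) (simp_all add: gn eq')
    then show ?thesis
      using i by simp
  qed
  define Fp Fm where "Fp y = max 0 (F y)" and "Fm y = max 0 (- F y)" for y
  have Fd: "F y = Fp y - Fm y" for y by (auto simp: Fp_def Fm_def)
  have p: "integrable M (\<lambda>x. \<integral>y. Fp y \<partial>K x) \<and> (\<integral>y. Fp y \<partial>(M \<bind> K)) = (\<integral>x. (\<integral>y. Fp y \<partial>K x) \<partial>M)"
    unfolding Fp_def by (rule part) auto
  have m: "integrable M (\<lambda>x. \<integral>y. Fm y \<partial>K x) \<and> (\<integral>y. Fm y \<partial>(M \<bind> K)) = (\<integral>x. (\<integral>y. Fm y \<partial>K x) \<partial>M)"
    unfolding Fm_def by (rule part) auto
  have ip: "integrable L Fp" "integrable L Fm" if "integrable L F" for L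
    using that unfolding Fp_def Fm_def by auto
  have split: "(\<integral>y. F y \<partial>L) = (\<integral>y. Fp y \<partial>L) - (\<integral>y. Fm y \<partial>L)" if "integrable L F" for L
  proof -
    have "(\<integral>y. F y \<partial>L) = (\<integral>y. Fp y - Fm y \<partial>L)"
      by (rule Bochner_Integration.integral_cong[OF refl Fd])
    then show ?thesis using ip[OF that] by simp
  qed
  have "(\<integral>y. F y \<partial>(M \<bind> K)) = (\<integral>y. Fp y \<partial>(M \<bind> K)) - (\<integral>y. Fm y \<partial>(M \<bind> K))"
    by (rule split[OF F])
  also have "\<dots> = (\<integral>x. (\<integral>y. Fp y \<partial>K x) - (\<integral>y. Fm y \<partial>K x) \<partial>M)"
    using p m by simp
  also have "\<dots> = (\<integral>x. (\<integral>y. F y \<partial>K x) \<partial>M)"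
  proof (rule integral_cong_AE)
    show "(\<lambda>x. (\<integral>y. Fp y \<partial>K x) - (\<integral>y. Fm y \<partial>K x)) \<in> borel_measurable M"
      using p m by (intro borel_measurable_diff borel_measurable_integrable) auto
    show "AE x in M. (\<integral>y. Fp y \<partial>K x) - (\<integral>y. Fm y \<partial>K x) = (\<integral>y. F y \<partial>K x)"
      using ae by eventually_elim (simp add: split)
  qed (rule meas)
  finally show "(\<integral>y. F y \<partial>(M \<bind> K)) = (\<integral>x. (\<integral>y. F y \<partial>K x) \<partial>M)" .
qed

section \<open>Products of identically distributed integer variables\<close>

lemma sets_int_seq: "sets (Pi\<^sub>M UNIV (\<lambda>i. measure_pmf (s i))) = sets int_seq_space"
  unfolding int_seq_space_def by (rule sets_PiM_cong) auto

lemma space_int_seq [simp]: "space int_seq_space = UNIV"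
  by (simp add: int_seq_space_def space_PiM)

lemma measurable_coordinate [measurable]:
  "(\<lambda>\<omega>. \<omega> i) \<in> int_seq_space \<rightarrow>\<^sub>M count_space UNIV"
  unfolding int_seq_space_def by (rule measurable_component_singleton) simp

lemma measurable_int_seqI:
  "(\<And>i. (\<lambda>x. g x i) \<in> M \<rightarrow>\<^sub>M count_space UNIV) \<Longrightarrow> g \<in> M \<rightarrow>\<^sub>M int_seq_space"
  unfolding int_seq_space_def by (rule measurable_PiM_single') (auto simp: space_PiM)

text \<open>The integers are countable, so the value of \<open>u\<close> can be frozen and only
  \<open>v\<close> varies. Arbitrary functions of two coordinates thus become measurable, in
  particular the rates.\<close>

lemma measurable_int2:
  fixes u v :: "'a \<Rightarrow> int"
  assumes u: "u \<in> M \<rightarrow>\<^sub>M count_space UNIV" and v: "v \<in> M \<rightarrow>\<^sub>M count_space UNIV"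
    and N: "space N = UNIV"
  shows "(\<lambda>x. F (u x) (v x)) \<in> M \<rightarrow>\<^sub>M N"
proof -
  have "(\<lambda>x. F a (v x)) \<in> M \<rightarrow>\<^sub>M N" for a
    by (rule measurable_compose[OF v]) (simp add: N)
  then show ?thesis
    by (rule measurable_compose_countable[OF _ u])
qed

lemma measurable_int_sum:
  fixes u :: "'b \<Rightarrow> 'a \<Rightarrow> int"
  assumes "\<And>j. u j \<in> M \<rightarrow>\<^sub>M count_space UNIV"
  shows "(\<lambda>x. \<Sum>j\<in>A. u j x) \<in> M \<rightarrow>\<^sub>M count_space UNIV"
proof (induction A rule: infinite_finite_induct)
  case (insert a A)
  then show ?case
    using measurable_int2[OF assms[of a] insert.IH, of "count_space UNIV" "(+)"] by simp
qed auto

lemma measurable_shift_seq [measurable]: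
  "(\<lambda>\<omega> i. \<omega> (i + a)) \<in> int_seq_space \<rightarrow>\<^sub>M int_seq_space"
  by (rule measurable_int_seqI) measurable

lemma measurable_incr [measurable]: "incr \<in> int_seq_space \<rightarrow>\<^sub>M int_seq_space"
  unfolding incr_def[abs_def]
  by (rule measurable_int_seqI, rule measurable_int2[OF measurable_coordinate measurable_coordinate]) simp

lemma measurable_height_of [measurable]: "height_of \<in> int_seq_space \<rightarrow>\<^sub>M int_seq_space"
proof (rule measurable_int_seqI)
  fix i :: int
  have m: "(\<lambda>\<omega>. \<Sum>j\<in>A. \<omega> j) \<in> int_seq_space \<rightarrow>\<^sub>M count_space UNIV" for A
    by (rule measurable_int_sum) (rule measurable_coordinate)
  have "uminus \<in> count_space UNIV \<rightarrow>\<^sub>M (count_space UNIV :: int measure)"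
    by simp
  note m' = measurable_compose[OF m this]
  show "(\<lambda>\<omega>. height_of \<omega> i) \<in> int_seq_space \<rightarrow>\<^sub>M count_space UNIV"
  proof (cases "0 \<le> i")
    case True
    then have "(\<lambda>\<omega>. height_of \<omega> i) = (\<lambda>\<omega>. - (\<Sum>j\<in>{1..i}. \<omega> j))"
      by (simp add: height_of_def)
    then show ?thesis using m'[of "{1..i}"] by (simp only:)
  next
    case False
    then have "(\<lambda>\<omega>. height_of \<omega> i) = (\<lambda>\<omega>. \<Sum>j\<in>{i + 1..0}. \<omega> j)"
      by (simp add: height_of_def)
    then show ?thesis using m[of "{i + 1..0}"] by (simp only:)
  qed
qed

lemma measurable_shift [measurable]: "shift a c \<in> int_seq_space \<rightarrow>\<^sub>M int_seq_space"
  unfolding shift_def[abs_def]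
  by (rule measurable_int_seqI,
      rule measurable_int2[OF measurable_coordinate measurable_const, where F = "(+)"]) simp_all

definition iid :: "int pmf \<Rightarrow> int_seq measure" where
  "iid s = Pi\<^sub>M UNIV (\<lambda>_. measure_pmf s)"

definition iid_except :: "int pmf \<Rightarrow> int pmf \<Rightarrow> int_seq measure" where
  "iid_except d s = Pi\<^sub>M UNIV (\<lambda>i. measure_pmf (if i = 0 then d else s))"

lemma iid_except_same: "iid_except s s = iid s"
  by (simp add: iid_except_def iid_def)

lemma sets_iid [measurable_cong, simp]: "sets (iid s) = sets int_seq_space"
  unfolding iid_def by (rule sets_int_seq)

lemma sets_iid_except [measurable_cong, simp]: "sets (iid_except d s) = sets int_seq_space"
  unfolding iid_except_def by (rule sets_int_seq)

lemma space_iid [simp]: "space (iid s) = UNIV"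
  using sets_eq_imp_space_eq[OF sets_iid] by simp

lemma prob_space_iid: "prob_space (iid s)"
  unfolding iid_def by (intro prob_space_PiM prob_space_measure_pmf)

lemma prob_space_iid_except: "prob_space (iid_except d s)"
  unfolding iid_except_def by (intro prob_space_PiM prob_space_measure_pmf)

lemma distr_iid_coordinate: "distr (iid s) (count_space UNIV) (\<lambda>\<omega>. \<omega> i) = measure_pmf s"
proof -
  have "distr (iid s) (count_space UNIV) (\<lambda>\<omega>. \<omega> i) = distr (iid s) (measure_pmf s) (\<lambda>\<omega>. \<omega> i)"
    by (rule distr_cong) auto
  also have "\<dots> = measure_pmf s"
    unfolding iid_def using distr_PiM_component[of UNIV "\<lambda>_. measure_pmf s" i]
    by (simp add: prob_space_measure_pmf)
  finally show ?thesis .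
qed

lemma integral_iid_coordinate:
  fixes F :: "int \<Rightarrow> real"
  shows "(\<integral>\<omega>. F (\<omega> i) \<partial>iid s) = (\<integral>x. F x \<partial>measure_pmf s)"
  by (subst distr_iid_coordinate[symmetric, of s i]) (simp add: integral_distr)

lemma integrable_iid_coordinate:
  fixes F :: "int \<Rightarrow> real"
  shows "integrable (iid s) (\<lambda>\<omega>. F (\<omega> i)) \<longleftrightarrow> integrable (measure_pmf s) F"
  by (subst distr_iid_coordinate[symmetric, of s i]) (simp add: integrable_distr_eq)

lemma distr_iid_shift: "distr (iid s) int_seq_space (\<lambda>\<omega> i. \<omega> (i + a)) = iid s"
proof -
  have "distr (iid s) int_seq_space (\<lambda>\<omega> i. \<omega> (i + a)) = distr (iid s) (iid s) (\<lambda>\<omega> i. \<omega> (i + a))"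
    by (rule distr_cong) auto
  also have "\<dots> = iid s"
    using distr_PiM_reindex[of UNIV "\<lambda>_. measure_pmf s" "\<lambda>i. i + a" UNIV]
    by (simp add: iid_def prob_space_measure_pmf inj_on_def restrict_def)
  finally show ?thesis .
qed

lemma integral_iid_shift:
  fixes F :: "int_seq \<Rightarrow> real"
  assumes "F \<in> borel_measurable int_seq_space"
  shows "(\<integral>\<omega>. F (\<lambda>i. \<omega> (i + a)) \<partial>iid s) = (\<integral>\<omega>. F \<omega> \<partial>iid s)"
    and "integrable (iid s) (\<lambda>\<omega>. F (\<lambda>i. \<omega> (i + a))) \<longleftrightarrow> integrable (iid s) F"
proof -
  have "(\<integral>\<omega>. F \<omega> \<partial>distr (iid s) int_seq_space (\<lambda>\<omega> i. \<omega> (i + a))) = (\<integral>\<omega>. F (\<lambda>i. \<omega> (i + a)) \<partial>iid s)"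
    by (rule integral_distr) (use assms in simp_all)
  then show "(\<integral>\<omega>. F (\<lambda>i. \<omega> (i + a)) \<partial>iid s) = (\<integral>\<omega>. F \<omega> \<partial>iid s)"
    by (simp only: distr_iid_shift)
  have "integrable (distr (iid s) int_seq_space (\<lambda>\<omega> i. \<omega> (i + a))) F \<longleftrightarrow> integrable (iid s) (\<lambda>\<omega>. F (\<lambda>i. \<omega> (i + a)))"
    by (rule integrable_distr_eq) (use assms in simp_all)
  then show "integrable (iid s) (\<lambda>\<omega>. F (\<lambda>i. \<omega> (i + a))) \<longleftrightarrow> integrable (iid s) F"
    by (simp only: distr_iid_shift)
qed

lemma indep_vars_iid:
  "prob_space.indep_vars (iid s) (\<lambda>_. count_space UNIV) (\<lambda>i \<omega>. \<omega> i) UNIV"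
proof -
  interpret prob_space "iid s" by (rule prob_space_iid)
  have "distr (iid s) (Pi\<^sub>M UNIV (\<lambda>i. count_space UNIV)) (\<lambda>x. \<lambda>i\<in>UNIV. x i) = distr (iid s) (iid s) (\<lambda>x. x)"
    by (rule distr_cong) (auto simp: int_seq_space_def[symmetric])
  also have "\<dots> = iid s" by (rule distr_id2) simp
  also have "\<dots> = (\<Pi>\<^sub>M i\<in>UNIV. distr (iid s) (count_space UNIV) (\<lambda>\<omega>. \<omega> i))"
    by (simp only: distr_iid_coordinate) (simp add: iid_def)
  finally show ?thesis
    by (subst indep_vars_iff_distr_eq_PiM) auto
qed

lemma count_space_int_pair:
  "count_space UNIV \<Otimes>\<^sub>M count_space UNIV = (count_space UNIV :: (int \<times> int) measure)"
  using pair_measure_countable[of "UNIV :: int set" "UNIV :: int set"] by simp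

lemma pair_measure_pmf: "measure_pmf a \<Otimes>\<^sub>M measure_pmf b = measure_pmf (pair_pmf (a :: int pmf) (b :: int pmf))"
proof (rule measure_eqI_countable[where A = UNIV])
  have "sets (measure_pmf a \<Otimes>\<^sub>M measure_pmf b) = sets (count_space UNIV \<Otimes>\<^sub>M count_space UNIV)"
    by (rule sets_pair_measure_cong) auto
  then show "sets (measure_pmf a \<Otimes>\<^sub>M measure_pmf b) = Pow UNIV"
    unfolding count_space_int_pair by simp
  fix x :: "int \<times> int"
  obtain u v where x: "x = (u, v)" by (cases x)
  have "emeasure (measure_pmf a \<Otimes>\<^sub>M measure_pmf b) ({u} \<times> {v}) = ennreal (pmf a u) * ennreal (pmf b v)"
    by (subst measure_pmf.emeasure_pair_measure_Times) (auto simp: emeasure_pmf_single)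
  then show "emeasure (measure_pmf a \<Otimes>\<^sub>M measure_pmf b) {x} = emeasure (measure_pmf (pair_pmf a b)) {x}"
    by (simp add: x emeasure_pmf_single pmf_pair ennreal_mult)
qed auto

lemma distr_iid_pair:
  assumes "i \<noteq> j"
  shows "distr (iid s) (count_space UNIV) (\<lambda>\<omega>. (\<omega> i, \<omega> j)) = measure_pmf (pair_pmf s s)"
proof -
  interpret prob_space "iid s" by (rule prob_space_iid)
  have "indep_var (count_space UNIV) (\<lambda>\<omega>. \<omega> i) (count_space UNIV) (\<lambda>\<omega>. \<omega> j)"
  proof -
    have "indep_var (PiM {i} (\<lambda>_. count_space UNIV)) (\<lambda>\<omega>. restrict (\<lambda>i. \<omega> i) {i})
        (PiM {j} (\<lambda>_. count_space UNIV)) (\<lambda>\<omega>. restrict (\<lambda>i. \<omega> i) {j})"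
      using assms by (intro indep_var_restrict[OF indep_vars_iid]) auto
    note ind = this
    have meas: "(\<lambda>x. x k) \<in> Pi\<^sub>M {k} (\<lambda>_. count_space UNIV) \<rightarrow>\<^sub>M (count_space UNIV :: int measure)" for k :: int
      by (rule measurable_component_singleton) simp
    have "indep_var (count_space UNIV) ((\<lambda>x. x i) \<circ> (\<lambda>\<omega>. restrict (\<lambda>i. \<omega> i) {i}))
        (count_space UNIV) ((\<lambda>x. x j) \<circ> (\<lambda>\<omega>. restrict (\<lambda>i. \<omega> i) {j}))"
      by (rule indep_var_compose[OF ind meas meas])
    then show ?thesis by (simp add: comp_def)
  qed
  then have "measure_pmf s \<Otimes>\<^sub>M measure_pmf s
      = distr (iid s) (count_space UNIV \<Otimes>\<^sub>M count_space UNIV) (\<lambda>\<omega>. (\<omega> i, \<omega> j))"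
    by (simp add: indep_var_distribution_eq distr_iid_coordinate)
  then show ?thesis by (simp add: pair_measure_pmf count_space_int_pair)
qed

lemma iid_integral_mult:
  fixes F G :: "int_seq \<Rightarrow> real"
  assumes F: "F \<in> borel_measurable int_seq_space" and G: "G \<in> borel_measurable int_seq_space"
    and FA: "\<And>\<omega> \<omega>'. (\<And>i. i \<in> A \<Longrightarrow> \<omega> i = \<omega>' i) \<Longrightarrow> F \<omega> = F \<omega>'"
    and GB: "\<And>\<omega> \<omega>'. (\<And>i. i \<in> B \<Longrightarrow> \<omega> i = \<omega>' i) \<Longrightarrow> G \<omega> = G \<omega>'"
    and AB: "A \<inter> B = {}" and Fi: "integrable (iid s) F" and Gi: "integrable (iid s) G"
  shows "(\<integral>\<omega>. F \<omega> * G \<omega> \<partial>iid s) = (\<integral>\<omega>. F \<omega> \<partial>iid s) * (\<integral>\<omega>. G \<omega> \<partial>iid s)"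
proof -
  interpret prob_space "iid s" by (rule prob_space_iid)
  \<comment> \<open>Extending a partial configuration by zero off \<open>C\<close> recovers from the
    restriction a full configuration on which \<open>F\<close> has the same value. So
    \<open>F\<close> factors through the coordinates in \<open>A\<close>, and \<open>G\<close>
    through those in \<open>B\<close>.\<close>
  define ext :: "int set \<Rightarrow> int_seq \<Rightarrow> int_seq" where "ext C x i = (if i \<in> C then x i else 0)" for C x i
  have ext: "ext C \<in> PiM C (\<lambda>_. count_space UNIV) \<rightarrow>\<^sub>M int_seq_space" for C
  proof (rule measurable_int_seqI)
    show "(\<lambda>x. ext C x i) \<in> PiM C (\<lambda>_. count_space UNIV) \<rightarrow>\<^sub>M count_space UNIV" for i
      using measurable_component_singleton[of i C "\<lambda>_. count_space UNIV"]
      by (cases "i \<in> C") (simp_all add: ext_def)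
  qed
  have "indep_var (PiM A (\<lambda>_. count_space UNIV)) (\<lambda>\<omega>. restrict (\<lambda>i. \<omega> i) A)
      (PiM B (\<lambda>_. count_space UNIV)) (\<lambda>\<omega>. restrict (\<lambda>i. \<omega> i) B)"
    using AB by (intro indep_var_restrict[OF indep_vars_iid]) auto
  from indep_var_compose[OF this measurable_compose[OF ext F] measurable_compose[OF ext G]]
  have "indep_var borel (\<lambda>\<omega>. F (ext A (restrict \<omega> A))) borel (\<lambda>\<omega>. G (ext B (restrict \<omega> B)))"
    by (simp add: comp_def)
  moreover have "F (ext A (restrict \<omega> A)) = F \<omega>" "G (ext B (restrict \<omega> B)) = G \<omega>" for \<omega>
    by (auto intro!: FA GB simp: ext_def)
  ultimately have ind: "indep_var borel F borel G" by simp
  show "(\<integral>\<omega>. F \<omega> * G \<omega> \<partial>iid s) = (\<integral>\<omega>. F \<omega> \<partial>iid s) * (\<integral>\<omega>. G \<omega> \<partial>iid s)"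
    by (rule indep_var_lebesgue_integral[OF ind Fi Gi])
qed

text \<open>The configuration off the origin is frozen while one-site identities are applied at the
  origin; the law with a modified origin and the stationary law share this factor.\<close>

definition iid_rest :: "int pmf \<Rightarrow> int_seq measure" where
  "iid_rest s = Pi\<^sub>M (UNIV - {0}) (\<lambda>_. measure_pmf s)"

lemma prob_space_iid_rest: "prob_space (iid_rest s)"
  unfolding iid_rest_def by (intro prob_space_PiM prob_space_measure_pmf)

lemma measurable_update0:
  "(\<lambda>(x, X). X(0 := x)) \<in> measure_pmf d \<Otimes>\<^sub>M iid_rest s \<rightarrow>\<^sub>M int_seq_space"
proof (rule measurable_int_seqI)
  fix i :: int
  have "(\<lambda>z. snd z i) \<in> measure_pmf d \<Otimes>\<^sub>M iid_rest s \<rightarrow>\<^sub>M count_space UNIV" if "i \<noteq> 0"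
  proof -
    have "i \<in> UNIV - {0}" using that by simp
    then have "(\<lambda>X. X i) \<in> iid_rest s \<rightarrow>\<^sub>M measure_pmf s"
      unfolding iid_rest_def by (rule measurable_component_singleton)
    note Xi = this
    have "snd \<in> measure_pmf d \<Otimes>\<^sub>M iid_rest s \<rightarrow>\<^sub>M iid_rest s"
      by (rule measurable_snd)
    then have "(\<lambda>z. snd z i) \<in> measure_pmf d \<Otimes>\<^sub>M iid_rest s \<rightarrow>\<^sub>M measure_pmf s"
      by (rule measurable_compose) (rule Xi)
    then show ?thesis
      by (simp only: measurable_pmf_measure2)
  qed
  moreover have "fst \<in> measure_pmf d \<Otimes>\<^sub>M iid_rest s \<rightarrow>\<^sub>M count_space UNIV"
    using measurable_fst[of "measure_pmf d" "iid_rest s"] by simp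
  moreover have eq: "(\<lambda>z. (case z of (x, X) \<Rightarrow> X(0 := x)) i) = (if i = 0 then fst else (\<lambda>z. snd z i))"
    by (simp add: fun_eq_iff split: prod.split)
  ultimately show "(\<lambda>z. (case z of (x, X) \<Rightarrow> X(0 := x)) i) \<in> measure_pmf d \<Otimes>\<^sub>M iid_rest s \<rightarrow>\<^sub>M count_space UNIV"
    unfolding eq by (simp only: split: if_split) blast
qed

lemma distr_iid_except:
  "distr (measure_pmf d \<Otimes>\<^sub>M iid_rest s) int_seq_space (\<lambda>(x, X). X(0 := x)) = iid_except d s"
proof -
  let ?M = "\<lambda>i. measure_pmf (if i = (0 :: int) then d else s)"
  have r: "Pi\<^sub>M (UNIV - {0}) ?M = iid_rest s"
    unfolding iid_rest_def by (rule PiM_cong) auto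
  have "distr (?M 0 \<Otimes>\<^sub>M Pi\<^sub>M (UNIV - {0}) ?M) (Pi\<^sub>M (insert 0 (UNIV - {0})) ?M) (\<lambda>(x, X). X(0 := x))
      = Pi\<^sub>M (insert 0 (UNIV - {0})) ?M"
    by (rule distr_pair_PiM_eq_PiM) (auto intro: prob_space_measure_pmf)
  then have "distr (measure_pmf d \<Otimes>\<^sub>M iid_rest s) (iid_except d s) (\<lambda>(x, X). X(0 := x)) = iid_except d s"
    by (simp add: r insert_absorb iid_except_def)
  moreover have "distr (measure_pmf d \<Otimes>\<^sub>M iid_rest s) (iid_except d s) (\<lambda>(x, X). X(0 := x))
    = distr (measure_pmf d \<Otimes>\<^sub>M iid_rest s) int_seq_space (\<lambda>(x, X). X(0 := x))"
    by (rule distr_cong) auto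
  ultimately show ?thesis by simp
qed

lemma integral_iid_except:
  fixes F :: "int_seq \<Rightarrow> real"
  assumes F: "F \<in> borel_measurable int_seq_space" and Fi: "integrable (iid_except d s) F"
  shows "(\<integral>\<omega>. F \<omega> \<partial>iid_except d s) = (\<integral>X. (\<integral>x. F (X(0 := x)) \<partial>measure_pmf d) \<partial>iid_rest s)"
proof -
  interpret R: prob_space "iid_rest s" by (rule prob_space_iid_rest)
  interpret D: pair_prob_space "measure_pmf d" "iid_rest s" ..
  have *: "integrable (measure_pmf d \<Otimes>\<^sub>M iid_rest s) (\<lambda>z. F (case z of (x, X) \<Rightarrow> X(0 := x)))"
    using Fi unfolding distr_iid_except[symmetric]
    by (simp add: integrable_distr_eq[OF measurable_update0 F])
  then have **: "integrable (measure_pmf d \<Otimes>\<^sub>M iid_rest s) (\<lambda>(x, X). F (X(0 := x)))"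
    by (simp add: case_prod_beta')
  show "(\<integral>\<omega>. F \<omega> \<partial>iid_except d s) = (\<integral>X. (\<integral>x. F (X(0 := x)) \<partial>measure_pmf d) \<partial>iid_rest s)"
    unfolding distr_iid_except[symmetric] integral_distr[OF measurable_update0 F]
    using D.integral_snd[OF **] by (simp add: case_prod_beta')
qed

text \<open>The support of \<open>d\<close> is countable, so the exceptional sets of its points can
  be joined into one. In this form the law at the origin enters only through its support, which lets
  almost sure statements pass from one such law to another with smaller support.\<close>

lemma AE_iid_except:
  assumes "{\<omega>. Q \<omega>} \<in> sets int_seq_space"
  shows "(AE \<omega> in iid_except d s. Q \<omega>) \<longleftrightarrow> (AE X in iid_rest s. \<forall>x\<in>set_pmf d. Q (X(0 := x)))"
proof -
  interpret R: prob_space "iid_rest s" by (rule prob_space_iid_rest)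
  interpret D: pair_prob_space "measure_pmf d" "iid_rest s" ..
  have Q: "{z \<in> space (measure_pmf d \<Otimes>\<^sub>M iid_rest s). Q (case z of (x, X) \<Rightarrow> X(0 := x))}
      \<in> sets (measure_pmf d \<Otimes>\<^sub>M iid_rest s)"
    using measurable_sets[OF measurable_update0[of d s] assms] by (simp add: vimage_def Collect_conj_eq Int_commute)
  have "(AE \<omega> in iid_except d s. Q \<omega>) \<longleftrightarrow>
      (AE z in measure_pmf d \<Otimes>\<^sub>M iid_rest s. Q (case z of (x, X) \<Rightarrow> X(0 := x)))"
    unfolding distr_iid_except[symmetric]
    by (rule AE_distr_iff[OF measurable_update0]) (use assms in simp)
  also have "\<dots> \<longleftrightarrow> (AE x in measure_pmf d. AE X in iid_rest s. Q (X(0 := x)))"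
    using D.AE_pair_iff[of "\<lambda>x X. Q (X(0 := x))"] Q by (simp add: case_prod_beta')
  also have "\<dots> \<longleftrightarrow> (\<forall>x\<in>set_pmf d. AE X in iid_rest s. Q (X(0 := x)))"
    by (simp add: AE_measure_pmf_iff)
  also have "\<dots> \<longleftrightarrow> (AE X in iid_rest s. \<forall>x\<in>set_pmf d. Q (X(0 := x)))"
    by (simp add: AE_ball_countable)
  finally show ?thesis .
qed

section \<open>Exponential families and single-site weights\<close>

lemma abs_exp_minus_one_le: "\<bar>exp a - 1\<bar> \<le> \<bar>a\<bar> * exp \<bar>a\<bar>" for a :: real
proof (cases "0 \<le> a")
  case True
  have "(1 - a) * exp a \<le> exp (- a) * exp a"
    using exp_ge_add_one_self[of "- a"] by (intro mult_right_mono) auto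
  then show ?thesis using True by (simp add: algebra_simps flip: exp_add)
next
  case False
  have "1 - exp a \<le> - a" using exp_ge_add_one_self[of a] by linarith
  also have "\<dots> \<le> - a * exp (- a)" using False mult_left_mono[of 1 "exp (- a)" "- a"] by simp
  finally show ?thesis using False by simp
qed

text \<open>Differentiation under the integral for an exponential family. Finiteness at parameters
  on both sides of \<open>\<theta>\<close> pays for the extra factor \<open>X\<close>, because
  \<open>\<bar>X\<bar> * exp (e / 2 * \<bar>X\<bar>)\<close> is at most a multiple of
  \<open>exp (e * X) + exp (- e * X)\<close>. It is applied to one site and to a pair of
  sites.\<close>

lemma
  fixes X G :: "'a \<Rightarrow> real"
  assumes X[measurable]: "X \<in> borel_measurable \<nu>" and G[measurable]: "G \<in> borel_measurable \<nu>"
    and U: "open U" "\<theta> \<in> U"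
    and int: "\<And>\<theta>. \<theta> \<in> U \<Longrightarrow> integrable \<nu> (\<lambda>x. G x * exp (\<theta> * X x))"
  shows integrable_exp_derivative: "integrable \<nu> (\<lambda>x. X x * G x * exp (\<theta> * X x))"
    and has_derivative_exp_integral:
      "((\<lambda>\<theta>. \<integral>x. G x * exp (\<theta> * X x) \<partial>\<nu>) has_real_derivative (\<integral>x. X x * G x * exp (\<theta> * X x) \<partial>\<nu>)) (at \<theta>)"
proof -
  obtain e0 where e0: "e0 > 0" "ball \<theta> e0 \<subseteq> U"
    using U open_contains_ball by blast
  \<comment> \<open>Halving keeps the end points \<open>\<theta> + e\<close> and
    \<open>\<theta> - e\<close> inside \<open>U\<close>. The increments \<open>h\<close> below are
    at most \<open>e / 2\<close>; the other half of \<open>e\<close> absorbs the factor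
    \<open>\<bar>X\<bar>\<close>.\<close>
  define e where "e = e0 / 2"
  have e: "e > 0" and eU: "\<And>h. \<bar>h\<bar> \<le> e \<Longrightarrow> \<theta> + h \<in> U"
    using e0 by (auto simp: e_def dist_real_def subset_iff)
  define D where "D x = (2 / e) * (\<bar>G x * exp ((\<theta> + e) * X x)\<bar> + \<bar>G x * exp ((\<theta> - e) * X x)\<bar>)" for x
  have D: "integrable \<nu> D"
    using int[OF eU[of e]] int[OF eU[of "- e"]] e unfolding D_def by simp
  have key: "\<bar>G x * exp (\<theta> * X x) * Y\<bar> \<le> D x"
    if Y: "\<bar>Y\<bar> \<le> \<bar>X x\<bar> * exp (e / 2 * \<bar>X x\<bar>)" for x Y
  proof -
    have "\<bar>X x\<bar> \<le> (2 / e) * exp (e / 2 * \<bar>X x\<bar>)"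
      using exp_ge_add_one_self[of "e / 2 * \<bar>X x\<bar>"] e by (simp add: field_simps)
    then have "\<bar>X x\<bar> * exp (e / 2 * \<bar>X x\<bar>) \<le> (2 / e) * exp (e / 2 * \<bar>X x\<bar>) * exp (e / 2 * \<bar>X x\<bar>)"
      by (intro mult_right_mono) auto
    also have "\<dots> = (2 / e) * exp (e * \<bar>X x\<bar>)"
      by (simp add: mult.assoc flip: exp_add)
    also have "\<dots> \<le> (2 / e) * (exp (e * X x) + exp (- e * X x))"
      using e by (intro mult_left_mono) (auto simp: abs_if)
    finally have "\<bar>Y\<bar> \<le> (2 / e) * (exp (e * X x) + exp (- e * X x))"
      using Y by simp
    then have "\<bar>G x * exp (\<theta> * X x)\<bar> * \<bar>Y\<bar>
        \<le> \<bar>G x * exp (\<theta> * X x)\<bar> * ((2 / e) * (exp (e * X x) + exp (- e * X x)))"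
      by (rule mult_left_mono) simp
    also have "\<dots> = D x"
      by (simp add: D_def abs_mult distrib_right left_diff_distrib exp_add exp_diff exp_minus
          divide_inverse algebra_simps)
    finally show ?thesis by (simp add: abs_mult)
  qed
  show int': "integrable \<nu> (\<lambda>x. X x * G x * exp (\<theta> * X x))"
  proof (rule Bochner_Integration.integrable_bound[OF D])
    have "\<bar>G x * exp (\<theta> * X x) * X x\<bar> \<le> D x" for x
    proof (rule key)
      have "1 \<le> exp (e / 2 * \<bar>X x\<bar>)" using e by simp
      then show "\<bar>X x\<bar> \<le> \<bar>X x\<bar> * exp (e / 2 * \<bar>X x\<bar>)"
        using mult_left_mono[of 1 "exp (e / 2 * \<bar>X x\<bar>)" "\<bar>X x\<bar>"] by simp
    qed
    then show "AE x in \<nu>. norm (X x * G x * exp (\<theta> * X x)) \<le> norm (D x)"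
      by (intro AE_I2) (metis abs_ge_self mult.assoc mult.commute order_trans real_norm_def)
  qed measurable
  let ?F = "\<lambda>\<theta>. \<integral>x. G x * exp (\<theta> * X x) \<partial>\<nu>"
  have "((\<lambda>h. (?F (\<theta> + h) - ?F \<theta>) / h) \<longlongrightarrow> (\<integral>x. X x * G x * exp (\<theta> * X x) \<partial>\<nu>)) (at 0 within cball 0 (e / 2))"
    unfolding tendsto_at_iff_sequentially
  proof (intro allI impI)
    fix h :: "nat \<Rightarrow> real"
    assume h: "\<forall>n. h n \<in> cball 0 (e / 2) - {0}" and h0: "h \<longlonglongrightarrow> 0"
    have h1: "h n \<noteq> 0" "\<bar>h n\<bar> \<le> e / 2" for n using h by (auto simp: dist_real_def)
    have "(\<lambda>n. \<integral>x. G x * exp (\<theta> * X x) * ((exp (h n * X x) - 1) / h n) \<partial>\<nu>)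
        \<longlonglongrightarrow> (\<integral>x. X x * G x * exp (\<theta> * X x) \<partial>\<nu>)"
    proof (rule integral_dominated_convergence[where w = D])
      show "AE x in \<nu>. (\<lambda>n. G x * exp (\<theta> * X x) * ((exp (h n * X x) - 1) / h n)) \<longlonglongrightarrow> X x * G x * exp (\<theta> * X x)"
      proof (rule AE_I2)
        fix x
        have "((\<lambda>u. exp (u * X x)) has_real_derivative X x) (at 0)"
          by (auto intro!: derivative_eq_intros)
        then have "((\<lambda>u. (exp (u * X x) - 1) / u) \<longlongrightarrow> X x) (at 0)"
          by (simp add: DERIV_def)
        then have "(\<lambda>n. (exp (h n * X x) - 1) / h n) \<longlonglongrightarrow> X x"
          by (rule tendsto_compose_eventually[of _ _ _ h, OF _ h0]) (simp add: h1)
        then have "(\<lambda>n. G x * exp (\<theta> * X x) * ((exp (h n * X x) - 1) / h n)) \<longlonglongrightarrow> G x * exp (\<theta> * X x) * X x"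
          by (rule tendsto_mult_left)
        then show "(\<lambda>n. G x * exp (\<theta> * X x) * ((exp (h n * X x) - 1) / h n)) \<longlonglongrightarrow> X x * G x * exp (\<theta> * X x)"
          by (simp only: mult_ac)
      qed
      show "AE x in \<nu>. norm (G x * exp (\<theta> * X x) * ((exp (h n * X x) - 1) / h n)) \<le> D x" for n
      proof (rule AE_I2)
        fix x
        have "\<bar>exp (h n * X x) - 1\<bar> \<le> \<bar>h n * X x\<bar> * exp \<bar>h n * X x\<bar>"
          by (rule abs_exp_minus_one_le)
        also have "\<dots> \<le> \<bar>h n * X x\<bar> * exp (e / 2 * \<bar>X x\<bar>)"
          using mult_right_mono[OF h1(2)[of n], of "\<bar>X x\<bar>"] by (intro mult_left_mono) (auto simp: abs_mult)
        finally have "\<bar>(exp (h n * X x) - 1) / h n\<bar> \<le> \<bar>X x\<bar> * exp (e / 2 * \<bar>X x\<bar>)"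
          using h1(1)[of n] by (simp add: abs_mult field_simps)
        then show "norm (G x * exp (\<theta> * X x) * ((exp (h n * X x) - 1) / h n)) \<le> D x"
          unfolding real_norm_def by (rule key)
      qed
    qed (use D in measurable)
    moreover have "(\<integral>x. G x * exp (\<theta> * X x) * ((exp (h n * X x) - 1) / h n) \<partial>\<nu>)
        = (?F (\<theta> + h n) - ?F \<theta>) / h n" for n
    proof -
      have i1: "integrable \<nu> (\<lambda>x. G x * exp ((\<theta> + h n) * X x))"
        by (rule int, rule eU) (use h1(2)[of n] e in linarith)
      have i2: "integrable \<nu> (\<lambda>x. G x * exp (\<theta> * X x))"
        by (rule int, rule U)
      have "(\<integral>x. G x * exp (\<theta> * X x) * ((exp (h n * X x) - 1) / h n) \<partial>\<nu>)
          = (\<integral>x. (G x * exp ((\<theta> + h n) * X x) - G x * exp (\<theta> * X x)) / h n \<partial>\<nu>)"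
        by (rule Bochner_Integration.integral_cong[OF refl])
           (simp add: distrib_right exp_add algebra_simps)
      also have "\<dots> = (?F (\<theta> + h n) - ?F \<theta>) / h n"
        using i1 i2 by simp
      finally show ?thesis .
    qed
    ultimately show "((\<lambda>h. (?F (\<theta> + h) - ?F \<theta>) / h) \<circ> h) \<longlonglongrightarrow> (\<integral>x. X x * G x * exp (\<theta> * X x) \<partial>\<nu>)"
      by (simp only: comp_def)
  qed
  moreover have "at 0 within cball 0 (e / 2) = at (0::real)"
    by (rule at_within_interior) (use e in \<open>simp add: interior_cball\<close>)
  ultimately show "(?F has_real_derivative (\<integral>x. X x * G x * exp (\<theta> * X x) \<partial>\<nu>)) (at \<theta>)"
    by (simp add: DERIV_def)
qed

section \<open>Positivity and monotonicity of f, convergence of the single-site weights\<close>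

lemma integrable_count_space_int:
  fixes F :: "int \<Rightarrow> real"
  assumes "summable (\<lambda>n. norm (F (int n)))" "summable (\<lambda>n. norm (F (- int n)))"
  shows "integrable (count_space UNIV) F"
proof -
  have "Infinite_Set_Sum.abs_summable_on F (range int)" "Infinite_Set_Sum.abs_summable_on F (range (\<lambda>n. - int n))"
    using assms
    by (auto simp: abs_summable_on_nat_iff' inj_on_def abs_summable_on_reindex_iff[symmetric])
  then have "Infinite_Set_Sum.abs_summable_on F (range int \<union> range (\<lambda>n. - int n))"
    by (rule abs_summable_on_union)
  moreover have "z \<in> range int \<union> range (\<lambda>n. - int n)" for z
    by (cases z rule: int_cases2) auto
  then have "range int \<union> range (\<lambda>n. - int n) = UNIV" by blast
  ultimately show ?thesis by (simp add: abs_summable_on_def)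
qed

lemma infsum_eq_integral_count_space:
  fixes F :: "'a \<Rightarrow> real"
  assumes "integrable (count_space UNIV) (\<lambda>z. if z \<in> A then F z else 0)"
  shows "(\<Sum>\<^sub>\<infinity>z\<in>A. F z) = (\<integral>z. (if z \<in> A then F z else 0) \<partial>count_space UNIV)"
proof -
  have eq: "(\<lambda>z. indicator A z *\<^sub>R F z) = (\<lambda>z. if z \<in> A then F z else 0)"
    by (auto simp: indicator_def)
  have "Infinite_Set_Sum.abs_summable_on F A"
    using assms unfolding abs_summable_on_altdef set_integrable_def eq .
  then have "(\<Sum>\<^sub>\<infinity>z\<in>A. F z) = infsetsum F A"
    by (rule infsetsum_infsum[symmetric])
  then show ?thesis
    unfolding infsetsum_altdef set_lebesgue_integral_def eq .
qed

context deposition_rates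
begin

abbreviation I :: "int set" where "I \<equiv> site_set wmin wmax"
abbreviation \<Theta> :: "real set" where "\<Theta> \<equiv> theta_range wmin wmax f"

lemma mem_I_iff: "z \<in> I \<longleftrightarrow> wmin \<le> Fin z \<and> Fin z \<le> wmax"
  by (simp add: site_set_def)

lemma zero_in_I: "0 \<in> I" and one_in_I: "1 \<in> I"
proof -
  have "Fin 0 \<le> wmax" "wmin \<le> Fin 1"
    using order_trans[OF _ wmax_ge, of "Fin 0"] order_trans[OF wmin_le, of "Fin 1"] by simp_all
  then show "0 \<in> I" "1 \<in> I" using wmin_le wmax_ge by (auto simp: mem_I_iff)
qed

lemma I_between: "x \<in> I \<Longrightarrow> y \<in> I \<Longrightarrow> x \<le> z \<Longrightarrow> z \<le> y \<Longrightarrow> z \<in> I"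
  unfolding mem_I_iff using order_trans[of wmin "Fin x" "Fin z"] order_trans[of "Fin z" "Fin y" wmax] by simp

lemma pred_in_I: "z \<in> I \<Longrightarrow> Fin z \<noteq> wmin \<Longrightarrow> z - 1 \<in> I"
  unfolding mem_I_iff by (cases wmin; cases wmax) auto

lemma rates_cases:
  obtains "\<And>y z. y \<in> I \<Longrightarrow> z \<in> I \<Longrightarrow> Fin y \<noteq> wmin \<Longrightarrow> Fin z \<noteq> wmax \<Longrightarrow> p y z \<noteq> 0"
  | "\<And>y z. y \<in> I \<Longrightarrow> z \<in> I \<Longrightarrow> Fin y \<noteq> wmax \<Longrightarrow> Fin z \<noteq> wmin \<Longrightarrow> q y z \<noteq> 0"
  using rates_nonzero unfolding Let_def by blast

lemma zero_ne_wmax: "Fin 0 \<noteq> wmax"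
  using wmax_ge by auto

text \<open>Pairing \<open>z\<close> with the value \<open>0\<close>, which is below
  \<open>wmax\<close>, gives the rate \<open>p z 0\<close> or \<open>q 0 z\<close>. One of them is
  nonzero by the nonvanishing hypothesis, and it contains \<open>f z\<close> as a factor.\<close>

lemma f_pos:
  assumes z: "z \<in> I" "Fin z \<noteq> wmin"
  shows "0 < f z"
proof -
  have "f z \<noteq> 0"
  proof (rule rates_cases)
    assume "\<And>y z. y \<in> I \<Longrightarrow> z \<in> I \<Longrightarrow> Fin y \<noteq> wmin \<Longrightarrow> Fin z \<noteq> wmax \<Longrightarrow> p y z \<noteq> 0"
    from this[OF z(1) zero_in_I z(2) zero_ne_wmax] show ?thesis
      using p_factor[OF z(1) zero_in_I] by auto
  next
    assume "\<And>y z. y \<in> I \<Longrightarrow> z \<in> I \<Longrightarrow> Fin y \<noteq> wmax \<Longrightarrow> Fin z \<noteq> wmin \<Longrightarrow> q y z \<noteq> 0"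
    from this[OF zero_in_I z(1) zero_ne_wmax z(2)] show ?thesis
      using q_factor[OF zero_in_I z(1)] by auto
  qed
  with f_nonneg[OF z(1)] show ?thesis by simp
qed

text \<open>Attractivity compares the rates at \<open>(z, z)\<close>, \<open>(z, z - 1)\<close> and
  \<open>(z + 1, z - 1)\<close>. By symmetry of \<open>sp\<close> the first and the last have the
  common factor \<open>sp z (z + 1)\<close>, positive because the rate at \<open>(z, z)\<close> is,
  and it cancels. If only \<open>q\<close> is nonzero the mirror image is used.\<close>

lemma f_mono_step:
  assumes z: "z \<in> I" and z1: "z + 1 \<in> I"
  shows "f z \<le> f (z + 1)"
proof (cases "Fin z = wmin")
  case True
  then show ?thesis using f_wmin[of z] f_nonneg[OF z1] by simp
next
  case False
  have zm: "z - 1 \<in> I" using pred_in_I[OF z False] .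
  have zmax: "Fin z \<noteq> wmax" using z1 by (auto simp: mem_I_iff)
  have fz: "0 < f z" using f_pos[OF z False] .
  show ?thesis
  proof (rule rates_cases)
    assume "\<And>y z. y \<in> I \<Longrightarrow> z \<in> I \<Longrightarrow> Fin y \<noteq> wmin \<Longrightarrow> Fin z \<noteq> wmax \<Longrightarrow> p y z \<noteq> 0"
    from this[OF z z False zmax] have "0 < sp z (z + 1) * f z"
      using rates_nonneg[OF z z] p_factor[OF z z] by (simp add: less_le)
    then have s: "0 < sp z (z + 1)" using fz by (simp add: zero_less_mult_iff)
    have "p z z \<le> p z (z - 1)" using attractive[OF z zm] z by simp
    also have "\<dots> \<le> p (z + 1) (z - 1)" using attractive[OF zm z z1] by simp
    finally have "sp z (z + 1) * f z \<le> sp z (z + 1) * f (z + 1)"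
      using p_factor[OF z z] p_factor[OF z1 zm] sp_sym[of z "z + 1"] by simp
    then show ?thesis using s by simp
  next
    assume "\<And>y z. y \<in> I \<Longrightarrow> z \<in> I \<Longrightarrow> Fin y \<noteq> wmax \<Longrightarrow> Fin z \<noteq> wmin \<Longrightarrow> q y z \<noteq> 0"
    from this[OF z z zmax False] have "0 < sq z (z + 1) * f z"
      using rates_nonneg[OF z z] q_factor[OF z z] sq_sym[of z "z + 1"] by (simp add: less_le)
    then have s: "0 < sq z (z + 1)" using fz by (simp add: zero_less_mult_iff)
    have "q z z \<le> q z (z + 1)" using attractive[OF z z z1] by simp
    also have "\<dots> \<le> q (z - 1) (z + 1)" using attractive[OF z1 zm] z by simp
    finally have "sq z (z + 1) * f z \<le> sq z (z + 1) * f (z + 1)"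
      using q_factor[OF z z] q_factor[OF zm z1] sq_sym[of z "z + 1"] by simp
    then show ?thesis using s by simp
  qed
qed

lemma f_mono:
  assumes "x \<in> I" "y \<in> I" "x \<le> y"
  shows "f x \<le> f y"
  using assms(3,2)
proof (induction y rule: int_ge_induct)
  case (step i)
  then have "i \<in> I" using I_between[OF assms(1), of "i + 1" i] by simp
  with step f_mono_step[of i] show ?case by force
qed simp

lemma ffact_pos:
  assumes "z \<in> I"
  shows "0 < ffact f z"
proof -
  have "0 < f y" if "y \<in> {1..z}" for y
    using that assms I_between[OF zero_in_I assms, of y] wmin_le by (intro f_pos) (auto simp: mem_I_iff)
  moreover have "0 < f y" if "y \<in> {z + 1..0}" for y
    using that assms I_between[OF assms zero_in_I, of y] by (intro f_pos) (auto simp: mem_I_iff)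
  ultimately show ?thesis
    unfolding ffact_def by (auto intro!: prod_pos divide_pos_pos)
qed

lemma ffact_succ:
  assumes z: "z \<in> I" and z1: "z + 1 \<in> I"
  shows "ffact f (z + 1) = ffact f z * f (z + 1)"
proof (cases "0 \<le> z")
  case True
  then have "{1..z + 1} = insert (z + 1) {1..z}" by auto
  then show ?thesis using True by (simp add: ffact_def mult.commute)
next
  case False
  have "Fin (z + 1) \<noteq> wmin" using z by (auto simp: mem_I_iff)
  then have "f (z + 1) \<noteq> 0" using f_pos[OF z1] by simp
  moreover have "{z + 1..0} = insert (z + 1) {z + 2..0}" using False by auto
  moreover have "{0 + 1..0 :: int} = {}" by auto
  ultimately show ?thesis
    using False by (cases "z = -1") (auto simp: ffact_def add.assoc)
qed

text \<open>The weights at parameter \<open>0\<close> before normalisation. Setting them to zero off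
  \<open>I\<close> lets all sums run over all integers, as integrals over one counting
  measure.\<close>

definition weight :: "int \<Rightarrow> real" where
  "weight z = (if z \<in> I then 1 / ffact f z else 0)"

lemma weight_nonneg: "0 \<le> weight z"
  using ffact_pos[of z] by (auto simp: weight_def less_imp_le)

lemma weight_pos: "z \<in> I \<Longrightarrow> 0 < weight z"
  using ffact_pos[of z] by (simp add: weight_def)

text \<open>Consecutive terms have ratio \<open>exp \<theta> / f (n + 1)\<close>. It decreases
  because \<open>f\<close> is monotone, and it drops below one because \<open>\<theta>\<close> lies
  below the limit of \<open>ln f\<close>.\<close>

lemma summable_weight_upper:
  assumes \<theta>: "\<theta> \<in> \<Theta>"
  shows "summable (\<lambda>n. norm (weight (int n) * exp (\<theta> * int n)))"
proof (cases wmax)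
  case (Fin b)
  have "int n \<notin> I" if "n \<notin> {..nat b}" for n
    using that unfolding site_set_def Fin by auto
  then have "weight (int n) = 0" if "n \<notin> {..nat b}" for n
    using that unfolding weight_def by simp
  then show ?thesis by (intro summable_finite[of "{..nat b}"]) auto
next
  case Pinf
  have nI: "int n \<in> I" for n
    using wmin_le order_trans[of wmin "Fin 0" "Fin (int n)"] by (simp add: site_set_def Pinf)
  have fn: "0 < f (int (Suc n))" for n
  proof (rule f_pos[OF nI])
    show "Fin (int (Suc n)) \<noteq> wmin" using wmin_le by auto
  qed
  let ?g = "\<lambda>n. ereal (ln (f (int n)))"
  \<comment> \<open>The sequence starts at index one because \<open>f 0 = 0\<close> when
    \<open>wmin = 0\<close>, where the logarithm takes a default value; the limit is not affected by
    the shift.\<close>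
  have inc: "incseq (\<lambda>n. ?g (Suc n))"
  proof (rule incseq_SucI)
    fix n
    have "f (int (Suc n)) \<le> f (int (Suc (Suc n)))" by (rule f_mono[OF nI nI]) simp
    then show "?g (Suc n) \<le> ?g (Suc (Suc n))" using fn[of n] fn[of "Suc n"] by (simp only: ereal_less_eq ln_le_cancel_iff)
  qed
  have "?g \<longlonglongrightarrow> (SUP n. ?g (Suc n))"
    by (rule filterlim_sequentially_Suc[of ?g, THEN iffD1, OF LIMSEQ_SUP[OF inc]])
  then have "theta_upper wmax f = (SUP n. ?g (Suc n))"
    by (simp add: theta_upper_def Pinf limI)
  then have "ereal \<theta> < (SUP n. ?g (Suc n))"
    using \<theta> by (simp add: theta_range_def)
  then obtain N where "ereal \<theta> < ?g (Suc N)" unfolding less_SUP_iff by blast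
  then have N: "exp \<theta> < f (int (Suc N))"
    using fn[of N] by (metis exp_less_mono exp_ln less_ereal.simps(1))
  show ?thesis
  proof (rule summable_ratio_test[where c = "exp \<theta> / f (int (Suc N))" and N = N])
    show "exp \<theta> / f (int (Suc N)) < 1" using N fn[of N] by simp
    fix n assume n: "N \<le> n"
    have le: "f (int (Suc N)) \<le> f (int (Suc n))" using n by (intro f_mono nI) simp
    have "weight (int (Suc n)) = weight (int n) / f (int (Suc n))"
      using ffact_succ[of "int n"] nI[of n] nI[of "Suc n"] by (simp add: weight_def add.commute)
    then have "weight (int (Suc n)) * exp (\<theta> * int (Suc n)) = (exp \<theta> / f (int (Suc n))) * (weight (int n) * exp (\<theta> * int n))"
      by (simp add: algebra_simps exp_add)
    also have "\<dots> \<le> (exp \<theta> / f (int (Suc N))) * (weight (int n) * exp (\<theta> * int n))"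
      using le fn[of N] by (intro mult_right_mono divide_left_mono mult_nonneg_nonneg weight_nonneg mult_pos_pos) auto
    finally show "norm (norm (weight (int (Suc n)) * exp (\<theta> * int (Suc n))))
        \<le> (exp \<theta> / f (int (Suc N))) * norm (norm (weight (int n) * exp (\<theta> * int n)))"
      using weight_nonneg by (simp add: abs_mult)
  qed
next
  case Minf
  then show ?thesis using wmax_ge by simp
qed

text \<open>The mirror image: the ratio is now \<open>f (- n) / exp \<theta>\<close>, and
  \<open>f\<close> decreases to the left.\<close>

lemma summable_weight_lower:
  assumes \<theta>: "\<theta> \<in> \<Theta>"
  shows "summable (\<lambda>n. norm (weight (- int n) * exp (\<theta> * - int n)))"
proof (cases wmin)
  case (Fin b)
  have "- int n \<notin> I" if "n \<notin> {..nat (- b)}" for n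
    using that unfolding site_set_def Fin by auto
  then have "weight (- int n) = 0" if "n \<notin> {..nat (- b)}" for n
    using that unfolding weight_def by simp
  then show ?thesis by (intro summable_finite[of "{..nat (- b)}"]) auto
next
  case Minf
  have nI: "- int n \<in> I" for n
    using wmax_ge order_trans[of "Fin (- int n)" "Fin 1" wmax] by (simp add: site_set_def Minf)
  have fn: "0 < f (- int n)" for n
    by (rule f_pos[OF nI]) (simp add: Minf)
  let ?g = "\<lambda>n. ereal (ln (f (- int n)))"
  have dec: "decseq ?g"
  proof (rule decseq_SucI)
    fix n
    have "f (- int (Suc n)) \<le> f (- int n)" by (rule f_mono[OF nI nI]) simp
    then show "?g (Suc n) \<le> ?g n" using fn[of n] fn[of "Suc n"] by (simp only: ereal_less_eq ln_le_cancel_iff)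
  qed
  have "theta_lower wmin f = (INF n. ?g n)"
    using LIMSEQ_INF[OF dec] by (simp add: theta_lower_def Minf limI)
  then have "(INF n. ?g n) < ereal \<theta>"
    using \<theta> by (simp add: theta_range_def)
  then obtain N where "?g N < ereal \<theta>" unfolding INF_less_iff by blast
  then have N: "f (- int N) < exp \<theta>"
    using fn[of N] by (metis exp_less_mono exp_ln less_ereal.simps(1))
  show ?thesis
  proof (rule summable_ratio_test[where c = "f (- int N) / exp \<theta>" and N = N])
    show "f (- int N) / exp \<theta> < 1" using N by simp
    fix n assume n: "N \<le> n"
    have le: "f (- int n) \<le> f (- int N)" using n by (intro f_mono nI) simp
    have "ffact f (- int n) = ffact f (- int (Suc n)) * f (- int n)"
      using ffact_succ[of "- int (Suc n)"] nI[of n] nI[of "Suc n"] by simp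
    then have "weight (- int (Suc n)) = weight (- int n) * f (- int n)"
      using fn[of n] nI[of n] nI[of "Suc n"] by (simp add: weight_def)
    then have "weight (- int (Suc n)) * exp (\<theta> * - int (Suc n))
        = (f (- int n) / exp \<theta>) * (weight (- int n) * exp (\<theta> * - int n))"
      by (simp add: algebra_simps exp_diff exp_minus divide_inverse)
    also have "\<dots> \<le> (f (- int N) / exp \<theta>) * (weight (- int n) * exp (\<theta> * - int n))"
      using le by (intro mult_right_mono divide_right_mono mult_nonneg_nonneg weight_nonneg) auto
    finally show "norm (norm (weight (- int (Suc n)) * exp (\<theta> * - int (Suc n))))
        \<le> (f (- int N) / exp \<theta>) * norm (norm (weight (- int n) * exp (\<theta> * - int n)))"
      using weight_nonneg by (simp add: abs_mult)
  qed
next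
  case Pinf
  then show ?thesis using wmin_le by simp
qed

lemma integrable_weight:
  assumes "\<theta> \<in> \<Theta>"
  shows "integrable (count_space UNIV) (\<lambda>z. weight z * exp (\<theta> * of_int z))"
  using summable_weight_upper[OF assms] summable_weight_lower[OF assms]
  by (intro integrable_count_space_int) simp_all

lemma open_theta_range: "open \<Theta>"
proof -
  have "\<Theta> = {\<theta>. theta_lower wmin f < ereal \<theta>} \<inter> {\<theta>. ereal \<theta> < theta_upper wmax f}"
    by (auto simp: theta_range_def)
  then show ?thesis
    by (auto intro!: open_Int open_Collect_less continuous_intros continuous_on_ereal)
qed

end

lemma
  fixes F :: "'a \<Rightarrow> real"
  shows integral_pmf_count_space: "(\<integral>z. F z \<partial>measure_pmf s) = (\<integral>z. pmf s z * F z \<partial>count_space UNIV)"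
    and integrable_pmf_count_space:
      "integrable (measure_pmf s) F \<longleftrightarrow> integrable (count_space UNIV) (\<lambda>z. pmf s z * F z)"
  unfolding measure_pmf_eq_density
  by (simp_all add: integral_density integrable_density)

lemma
  fixes F :: "int \<times> int \<Rightarrow> real"
  assumes "i \<noteq> j"
  shows integral_iid_pair: "(\<integral>\<omega>. F (\<omega> i, \<omega> j) \<partial>iid s) = (\<integral>x. F x \<partial>measure_pmf (pair_pmf s s))"
    and integrable_iid_pair:
      "integrable (iid s) (\<lambda>\<omega>. F (\<omega> i, \<omega> j)) \<longleftrightarrow> integrable (measure_pmf (pair_pmf s s)) F"
proof -
  have m: "(\<lambda>\<omega>. (\<omega> i, \<omega> j)) \<in> iid s \<rightarrow>\<^sub>M count_space UNIV"
    unfolding count_space_int_pair[symmetric] measurable_cong_sets[OF sets_iid refl]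
    by (rule measurable_Pair[OF measurable_coordinate measurable_coordinate])
  show "(\<integral>\<omega>. F (\<omega> i, \<omega> j) \<partial>iid s) = (\<integral>x. F x \<partial>measure_pmf (pair_pmf s s))"
    unfolding distr_iid_pair[OF assms, symmetric] by (rule integral_distr[OF m, symmetric]) simp
  show "integrable (iid s) (\<lambda>\<omega>. F (\<omega> i, \<omega> j)) \<longleftrightarrow> integrable (measure_pmf (pair_pmf s s)) F"
    unfolding distr_iid_pair[OF assms, symmetric] by (rule integrable_distr_eq[OF m, symmetric]) simp
qed

lemma integrable_divide_iff:
  fixes F :: "'a \<Rightarrow> real"
  assumes "c \<noteq> 0"
  shows "integrable M (\<lambda>x. F x / c) \<longleftrightarrow> integrable M F"
proof
  assume "integrable M (\<lambda>x. F x / c)"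
  then have "integrable M (\<lambda>x. c * (F x / c))" by (rule integrable_mult_right)
  moreover have "(\<lambda>x. c * (F x / c)) = F" using assms by auto
  ultimately show "integrable M F" by (simp only:)
qed simp

section \<open>The site law, its moments, and the flux as a function of the density\<close>

context deposition_rates
begin

definition Z :: "real \<Rightarrow> real" where
  "Z \<theta> = (\<integral>z. weight z * exp (\<theta> * of_int z) \<partial>count_space UNIV)"

text \<open>Meaningful for \<open>\<theta> \<in> \<Theta>\<close>, where the weights are nonnegative
  with sum one.\<close>

definition site_pmf :: "real \<Rightarrow> int pmf" where
  "site_pmf \<theta> = embed_pmf (site_weight wmin wmax f \<theta>)"

lemma Z_pos:
  assumes "\<theta> \<in> \<Theta>"
  shows "0 < Z \<theta>"
proof -
  have "Z \<theta> \<noteq> 0"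
  proof
    assume "Z \<theta> = 0"
    then have "AE z in count_space UNIV. weight z * exp (\<theta> * of_int z) = 0"
      unfolding Z_def using integral_nonneg_eq_0_iff_AE[OF integrable_weight[OF assms]]
      by (simp add: weight_nonneg)
    then have "weight 0 = 0" by (simp add: AE_count_space)
    then show False using weight_pos[OF zero_in_I] by simp
  qed
  moreover have "0 \<le> Z \<theta>" unfolding Z_def by (intro Bochner_Integration.integral_nonneg) (simp add: weight_nonneg)
  ultimately show ?thesis by simp
qed

lemma site_weight_eq:
  assumes "\<theta> \<in> \<Theta>"
  shows "site_weight wmin wmax f \<theta> z = weight z * exp (\<theta> * of_int z) / Z \<theta>"
proof -
  have "(\<lambda>z. if z \<in> I then exp (\<theta> * of_int z) / ffact f z else 0) = (\<lambda>z. weight z * exp (\<theta> * of_int z))"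
    by (auto simp: weight_def)
  then have "partition_fn wmin wmax f \<theta> = Z \<theta>"
    unfolding partition_fn_def Z_def
    using infsum_eq_integral_count_space[of I "\<lambda>z. exp (\<theta> * of_int z) / ffact f z"] integrable_weight[OF assms]
    by simp
  then show ?thesis by (simp add: site_weight_def weight_def)
qed

lemma pmf_site:
  assumes \<theta>: "\<theta> \<in> \<Theta>"
  shows "pmf (site_pmf \<theta>) z = weight z * exp (\<theta> * of_int z) / Z \<theta>"
proof -
  have nn: "0 \<le> site_weight wmin wmax f \<theta> z" for z
    using Z_pos[OF \<theta>] by (simp add: site_weight_eq[OF \<theta>] weight_nonneg)
  have "(\<integral>\<^sup>+z. ennreal (site_weight wmin wmax f \<theta> z) \<partial>count_space UNIV)
      = ennreal (\<integral>z. site_weight wmin wmax f \<theta> z \<partial>count_space UNIV)"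
    using nn integrable_weight[OF \<theta>] by (intro nn_integral_eq_integral) (auto simp: site_weight_eq[OF \<theta>])
  also have "(\<integral>z. site_weight wmin wmax f \<theta> z \<partial>count_space UNIV) = 1"
    using Z_pos[OF \<theta>] by (simp add: site_weight_eq[OF \<theta>] Z_def[symmetric])
  finally show ?thesis
    unfolding site_pmf_def using nn by (simp add: pmf_embed_pmf site_weight_eq[OF \<theta>])
qed

lemma stat_measure_eq:
  assumes "\<theta> \<in> \<Theta>"
  shows "stat_measure wmin wmax f \<theta> = iid (site_pmf \<theta>)"
  unfolding stat_measure_def iid_def point_measure_def
  by (simp add: measure_pmf_eq_density pmf_site[OF assms] site_weight_eq[OF assms])

lemma weight_eq_0_iff: "weight z = 0 \<longleftrightarrow> z \<notin> I"
  using weight_pos[of z] by (cases "z \<in> I") (simp_all add: weight_def)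

lemma set_site_pmf: "\<theta> \<in> \<Theta> \<Longrightarrow> set_pmf (site_pmf \<theta>) = I"
  using Z_pos[of \<theta>] by (simp add: set_pmf_eq pmf_site weight_eq_0_iff)

definition \<rho> :: "real \<Rightarrow> real" where "\<rho> \<theta> = (\<integral>z. of_int z \<partial>site_pmf \<theta>)"
definition V :: "real \<Rightarrow> real" where "V \<theta> = (\<integral>z. (of_int z - \<rho> \<theta>)\<^sup>2 \<partial>site_pmf \<theta>)"
definition net_rate :: "int \<times> int \<Rightarrow> real" where "net_rate = (\<lambda>(y, z). p y z - q y z)"

lemma density_at_eq: "\<theta> \<in> \<Theta> \<Longrightarrow> density_at wmin wmax f \<theta> = \<rho> \<theta>"
  by (simp add: density_at_def stat_measure_eq \<rho>_def integral_iid_coordinate)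

lemma site_variance_eq: "\<theta> \<in> \<Theta> \<Longrightarrow> site_variance wmin wmax f \<theta> = V \<theta>"
  by (simp add: site_variance_def stat_measure_eq V_def density_at_eq
      integral_iid_coordinate[where F = "\<lambda>z. (of_int z - \<rho> \<theta>)\<^sup>2"])

lemma integral_site_pmf:
  assumes "\<theta> \<in> \<Theta>"
  shows "(\<integral>z. F z \<partial>site_pmf \<theta>) = (\<integral>z. F z * weight z * exp (\<theta> * of_int z) \<partial>count_space UNIV) / Z \<theta>"
proof -
  have "(\<integral>z. F z \<partial>site_pmf \<theta>) = (\<integral>z. (F z * weight z * exp (\<theta> * of_int z)) / Z \<theta> \<partial>count_space UNIV)"
    unfolding integral_pmf_count_space pmf_site[OF assms]
    by (rule Bochner_Integration.integral_cong) simp_all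
  then show ?thesis by simp
qed

lemma integrable_site_pmf:
  assumes "\<theta> \<in> \<Theta>"
  shows "integrable (site_pmf \<theta>) F \<longleftrightarrow> integrable (count_space UNIV) (\<lambda>z. F z * weight z * exp (\<theta> * of_int z))"
proof -
  have "integrable (site_pmf \<theta>) F \<longleftrightarrow> integrable (count_space UNIV) (\<lambda>z. (F z * weight z * exp (\<theta> * of_int z)) / Z \<theta>)"
    unfolding integrable_pmf_count_space pmf_site[OF assms]
    by (rule Bochner_Integration.integrable_cong) simp_all
  then show ?thesis using Z_pos[OF assms] integrable_divide_iff[of "Z \<theta>"] by simp
qed

lemma integrable_moments:
  assumes "\<theta> \<in> \<Theta>"
  shows "integrable (count_space UNIV) (\<lambda>z. of_int z * weight z * exp (\<theta> * of_int z))"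
    and "integrable (count_space UNIV) (\<lambda>z. of_int z * (of_int z * weight z) * exp (\<theta> * of_int z))"
  using integrable_exp_derivative[of of_int "count_space UNIV" weight, OF _ _ open_theta_range _ integrable_weight] assms
    integrable_exp_derivative[of of_int "count_space UNIV" "\<lambda>z. of_int z * weight z", OF _ _ open_theta_range]
  by simp_all

lemma square_integrable_site:
  assumes "\<theta> \<in> \<Theta>"
  shows "square_integrable (site_pmf \<theta>) (\<lambda>z. of_int z)"
  unfolding square_integrable_def integrable_site_pmf[OF assms]
  using integrable_moments(2)[OF assms] by (simp add: power2_eq_square mult.assoc)

lemma integrable_site: "\<theta> \<in> \<Theta> \<Longrightarrow> integrable (site_pmf \<theta>) (\<lambda>z. of_int z :: real)"
  by (rule measure_pmf.square_integrable_imp_integrable[OF square_integrable_site])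

lemma V_eq:
  assumes "\<theta> \<in> \<Theta>"
  shows "V \<theta> = (\<integral>z. (of_int z)\<^sup>2 \<partial>site_pmf \<theta>) - (\<rho> \<theta>)\<^sup>2"
proof -
  have i: "integrable (site_pmf \<theta>) (\<lambda>z. (of_int z)\<^sup>2 :: real)"
    using square_integrable_site[OF assms] by (simp add: square_integrable_def)
  have "V \<theta> = (\<integral>z. (of_int z)\<^sup>2 - 2 * \<rho> \<theta> * of_int z + (\<rho> \<theta>)\<^sup>2 \<partial>site_pmf \<theta>)"
    unfolding V_def by (simp add: power2_diff algebra_simps)
  also have "\<dots> = (\<integral>z. (of_int z)\<^sup>2 \<partial>site_pmf \<theta>) - 2 * \<rho> \<theta> * \<rho> \<theta> + (\<rho> \<theta>)\<^sup>2"
    using i integrable_site[OF assms] by (simp add: \<rho>_def[symmetric])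
  finally show ?thesis by (simp add: power2_eq_square)
qed

text \<open>The values \<open>0\<close> and \<open>1\<close> both carry mass, so the site law is not
  concentrated at its mean.\<close>

lemma V_pos:
  assumes "\<theta> \<in> \<Theta>"
  shows "0 < V \<theta>"
proof -
  have i: "integrable (site_pmf \<theta>) (\<lambda>z. (of_int z - \<rho> \<theta>)\<^sup>2)"
    using square_integrable_diff[OF square_integrable_site[OF assms] measure_pmf.square_integrable_const[of _ "\<rho> \<theta>"]]
    by (simp add: square_integrable_def)
  have "V \<theta> \<noteq> 0"
  proof
    assume "V \<theta> = 0"
    then have "AE z in site_pmf \<theta>. (of_int z - \<rho> \<theta>)\<^sup>2 = 0"
      unfolding V_def using integral_nonneg_eq_0_iff_AE[OF i] by simp
    then have "\<forall>z\<in>I. of_int z = \<rho> \<theta>"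
      by (simp add: AE_measure_pmf_iff set_site_pmf[OF assms])
    then have "of_int 0 = \<rho> \<theta>" "of_int 1 = \<rho> \<theta>" using zero_in_I one_in_I by blast+
    then show False by simp
  qed
  moreover have "0 \<le> V \<theta>" unfolding V_def by simp
  ultimately show ?thesis by simp
qed

lemma has_derivative_Z:
  assumes "\<theta> \<in> \<Theta>"
  shows "(Z has_real_derivative \<rho> \<theta> * Z \<theta>) (at \<theta>)"
proof -
  have "(Z has_real_derivative (\<integral>z. of_int z * weight z * exp (\<theta> * of_int z) \<partial>count_space UNIV)) (at \<theta>)"
    unfolding Z_def[abs_def]
    by (rule has_derivative_exp_integral[OF _ _ open_theta_range assms integrable_weight]) simp_all
  moreover have "(\<integral>z. of_int z * weight z * exp (\<theta> * of_int z) \<partial>count_space UNIV) = \<rho> \<theta> * Z \<theta>"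
    using Z_pos[OF assms] by (simp add: \<rho>_def integral_site_pmf[OF assms])
  ultimately show ?thesis by simp
qed

text \<open>\<open>\<rho>\<close> is the logarithmic derivative of \<open>Z\<close>; differentiating
  once more gives the second moment minus the square of the mean.\<close>

lemma has_derivative_\<rho>:
  assumes \<theta>: "\<theta> \<in> \<Theta>"
  shows "(\<rho> has_real_derivative V \<theta>) (at \<theta>)"
proof -
  define Z1 where "Z1 \<theta> = (\<integral>z. (of_int z * weight z) * exp (\<theta> * of_int z) \<partial>count_space UNIV)" for \<theta>
  define Z2 where "Z2 = (\<integral>z. of_int z * (of_int z * weight z) * exp (\<theta> * of_int z) \<partial>count_space UNIV)"
  have eq: "\<rho> t = Z1 t / Z t" if "t \<in> \<Theta>" for t
    by (simp add: \<rho>_def integral_site_pmf[OF that] Z1_def)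
  have 1: "(Z1 has_real_derivative Z2) (at \<theta>)"
    unfolding Z1_def[abs_def] Z2_def
    by (rule has_derivative_exp_integral[OF _ _ open_theta_range \<theta> integrable_moments(1)]) simp_all
  have "((\<lambda>t. Z1 t / Z t) has_real_derivative (Z2 * Z \<theta> - Z1 \<theta> * (\<rho> \<theta> * Z \<theta>)) / (Z \<theta> * Z \<theta>)) (at \<theta>)"
    using DERIV_divide[OF 1 has_derivative_Z[OF \<theta>]] Z_pos[OF \<theta>] by simp
  also have "(Z2 * Z \<theta> - Z1 \<theta> * (\<rho> \<theta> * Z \<theta>)) / (Z \<theta> * Z \<theta>) = Z2 / Z \<theta> - (\<rho> \<theta>)\<^sup>2"
    using Z_pos[OF \<theta>] by (simp add: eq[OF \<theta>] power2_eq_square divide_simps)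
  also have "\<dots> = V \<theta>"
    unfolding V_eq[OF \<theta>] integral_site_pmf[OF \<theta>] Z2_def by (simp add: power2_eq_square mult.assoc)
  finally show ?thesis
    by (rule DERIV_cong_ev[OF refl _ refl, THEN iffD1, rotated])
       (use eventually_nhds_in_open[OF open_theta_range \<theta>] in \<open>auto elim!: eventually_mono simp: eq\<close>)
qed

lemma inj_on_\<rho>: "inj_on \<rho> \<Theta>"
proof -
  have "\<rho> a < \<rho> b" if "a \<in> \<Theta>" "b \<in> \<Theta>" "a < b" for a b
  proof (rule DERIV_pos_imp_increasing[OF that(3)])
    fix x assume "a \<le> x" "x \<le> b"
    then have x: "ereal a \<le> ereal x" "ereal x \<le> ereal b" by simp_all
    have "theta_lower wmin f < ereal a" "ereal b < theta_upper wmax f"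
      using that by (auto simp: theta_range_def)
    from less_le_trans[OF this(1) x(1)] le_less_trans[OF x(2) this(2)]
    have "x \<in> \<Theta>" by (simp add: theta_range_def)
    then show "\<exists>y. (\<rho> has_real_derivative y) (at x) \<and> 0 < y"
      using has_derivative_\<rho> V_pos by blast
  qed
  note less = this
  show ?thesis
  proof (rule inj_onI)
    fix a b assume "a \<in> \<Theta>" "b \<in> \<Theta>" "\<rho> a = \<rho> b"
    then show "a = b" using less[of a b] less[of b a] by (cases a b rule: linorder_cases) simp_all
  qed
qed

lemma integral_pair_pmf_site:
  assumes "\<theta> \<in> \<Theta>"
  shows "(\<integral>x. F x \<partial>pair_pmf (site_pmf \<theta>) (site_pmf \<theta>))
      = (\<integral>x. F x * (weight (fst x) * weight (snd x)) * exp (\<theta> * of_int (fst x + snd x)) \<partial>count_space UNIV) / (Z \<theta>)\<^sup>2"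
    and "integrable (pair_pmf (site_pmf \<theta>) (site_pmf \<theta>)) F \<longleftrightarrow>
      integrable (count_space UNIV) (\<lambda>x. F x * (weight (fst x) * weight (snd x)) * exp (\<theta> * of_int (fst x + snd x)))"
proof -
  let ?w = "\<lambda>x. F x * (weight (fst x) * weight (snd x)) * exp (\<theta> * of_int (fst x + snd x))"
  have *: "(\<lambda>x. pmf (pair_pmf (site_pmf \<theta>) (site_pmf \<theta>)) x * F x) = (\<lambda>x. ?w x / (Z \<theta>)\<^sup>2)"
    by (auto simp: fun_eq_iff pmf_pair pmf_site[OF assms] distrib_left exp_add power2_eq_square)
  show "(\<integral>x. F x \<partial>pair_pmf (site_pmf \<theta>) (site_pmf \<theta>)) = (\<integral>x. ?w x \<partial>count_space UNIV) / (Z \<theta>)\<^sup>2"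
    unfolding integral_pmf_count_space * by simp
  show "integrable (pair_pmf (site_pmf \<theta>) (site_pmf \<theta>)) F \<longleftrightarrow> integrable (count_space UNIV) ?w"
    unfolding integrable_pmf_count_space *
    by (rule integrable_divide_iff) (use Z_pos[OF assms] in simp)
qed

lemma integrable_rates_pair:
  assumes \<theta>: "\<theta> \<in> \<Theta>"
  shows "square_integrable (pair_pmf (site_pmf \<theta>) (site_pmf \<theta>)) (\<lambda>(y, z). p y z)"
    and "square_integrable (pair_pmf (site_pmf \<theta>) (site_pmf \<theta>)) (\<lambda>(y, z). q y z)"
proof -
  let ?P = "\<lambda>x. (case x of (y, z) \<Rightarrow> p y z)\<^sup>2" and ?Q = "\<lambda>x. (case x of (y, z) \<Rightarrow> q y z)\<^sup>2"
  have "integrable (iid (site_pmf \<theta>)) (\<lambda>\<omega>. ?P (\<omega> 0, \<omega> 1))" "integrable (iid (site_pmf \<theta>)) (\<lambda>\<omega>. ?Q (\<omega> 0, \<omega> 1))"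
    using rate_moments[OF \<theta>, of 2] unfolding stat_measure_eq[OF \<theta>] by simp_all
  then have "integrable (pair_pmf (site_pmf \<theta>) (site_pmf \<theta>)) ?P" "integrable (pair_pmf (site_pmf \<theta>) (site_pmf \<theta>)) ?Q"
    using integrable_iid_pair[where i = 0 and j = 1 and F = ?P] integrable_iid_pair[where i = 0 and j = 1 and F = ?Q]
    by simp_all
  then show "square_integrable (pair_pmf (site_pmf \<theta>) (site_pmf \<theta>)) (\<lambda>(y, z). p y z)"
    "square_integrable (pair_pmf (site_pmf \<theta>) (site_pmf \<theta>)) (\<lambda>(y, z). q y z)"
    unfolding square_integrable_def by simp_all
qed

lemma square_integrable_net_rate:
  assumes "\<theta> \<in> \<Theta>"
  shows "square_integrable (pair_pmf (site_pmf \<theta>) (site_pmf \<theta>)) net_rate"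
  using square_integrable_diff[OF integrable_rates_pair[OF assms]]
  unfolding net_rate_def by (simp add: case_prod_beta')

text \<open>The covariance of the net rate across the origin with the mass of the two sites on which
  it depends; no centring of the rate is written, since the other factor has mean zero.\<close>

definition flux_slope :: "real \<Rightarrow> real" where
  "flux_slope \<theta> = (\<integral>x. ((of_int (fst x) - \<rho> \<theta>) + (of_int (snd x) - \<rho> \<theta>)) * net_rate x \<partial>pair_pmf (site_pmf \<theta>) (site_pmf \<theta>))"

text \<open>A pair of sites is again an exponential family, in the sum of its two values and with
  normalisation \<open>(Z \<theta>)\<^sup>2\<close>. The derivative of the normalisation contributes
  twice the mean, which is what centres the sum.\<close>

lemma has_derivative_mean_net_rate:
  assumes \<theta>: "\<theta> \<in> \<Theta>"
  shows "((\<lambda>\<theta>. \<integral>x. net_rate x \<partial>pair_pmf (site_pmf \<theta>) (site_pmf \<theta>)) has_real_derivative flux_slope \<theta>) (at \<theta>)"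
proof -
  define w where "w x = net_rate x * (weight (fst x) * weight (snd x))" for x
  define X where "X x = real_of_int (fst x + snd x)" for x :: "int \<times> int"
  define N where "N \<theta> = (\<integral>x. w x * exp (\<theta> * X x) \<partial>count_space UNIV)" for \<theta>
  define N1 where "N1 = (\<integral>x. X x * w x * exp (\<theta> * X x) \<partial>count_space UNIV)"
  have eq: "(\<integral>x. net_rate x \<partial>pair_pmf (site_pmf t) (site_pmf t)) = N t / (Z t)\<^sup>2" if "t \<in> \<Theta>" for t
    unfolding integral_pair_pmf_site[OF that] N_def w_def X_def ..
  have int: "integrable (count_space UNIV) (\<lambda>x. w x * exp (t * X x))" if "t \<in> \<Theta>" for t
    using measure_pmf.square_integrable_imp_integrable[OF square_integrable_net_rate[OF that]]
    unfolding integral_pair_pmf_site(2)[OF that] w_def X_def .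
  have N': "(N has_real_derivative N1) (at \<theta>)"
    unfolding N_def[abs_def] N1_def
    by (rule has_derivative_exp_integral[OF _ _ open_theta_range \<theta> int]) simp_all
  have X1: "integrable (pair_pmf (site_pmf \<theta>) (site_pmf \<theta>)) (\<lambda>x. X x * net_rate x)"
    unfolding integral_pair_pmf_site(2)[OF \<theta>]
    using integrable_exp_derivative[OF _ _ open_theta_range \<theta> int] by (simp add: w_def X_def mult.assoc)
  have X2: "(\<integral>x. X x * net_rate x \<partial>pair_pmf (site_pmf \<theta>) (site_pmf \<theta>)) = N1 / (Z \<theta>)\<^sup>2"
    unfolding integral_pair_pmf_site[OF \<theta>] N1_def w_def X_def by (simp add: mult.assoc)
  have Z2: "((\<lambda>t. (Z t)\<^sup>2) has_real_derivative 2 * \<rho> \<theta> * (Z \<theta>)\<^sup>2) (at \<theta>)"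
    using DERIV_power[OF has_derivative_Z[OF \<theta>], of 2] by (simp add: power2_eq_square algebra_simps)
  have alg: "(a * c - n * (2 * b * c)) / (c * c) = a / c - 2 * b * (n / c)" if "c \<noteq> 0" for a b c n :: real
    using that by (simp add: field_simps)
  have "((\<lambda>t. N t / (Z t)\<^sup>2) has_real_derivative (N1 * (Z \<theta>)\<^sup>2 - N \<theta> * (2 * \<rho> \<theta> * (Z \<theta>)\<^sup>2)) / ((Z \<theta>)\<^sup>2 * (Z \<theta>)\<^sup>2)) (at \<theta>)"
    using DERIV_divide[OF N' Z2] Z_pos[OF \<theta>] by simp
  also have "(N1 * (Z \<theta>)\<^sup>2 - N \<theta> * (2 * \<rho> \<theta> * (Z \<theta>)\<^sup>2)) / ((Z \<theta>)\<^sup>2 * (Z \<theta>)\<^sup>2)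
      = N1 / (Z \<theta>)\<^sup>2 - 2 * \<rho> \<theta> * (N \<theta> / (Z \<theta>)\<^sup>2)"
    using Z_pos[OF \<theta>] by (intro alg) simp
  also have "\<dots> = (\<integral>x. X x * net_rate x \<partial>pair_pmf (site_pmf \<theta>) (site_pmf \<theta>))
      - 2 * \<rho> \<theta> * (\<integral>x. net_rate x \<partial>pair_pmf (site_pmf \<theta>) (site_pmf \<theta>))"
    by (simp only: X2 eq[OF \<theta>])
  also have "\<dots> = (\<integral>x. X x * net_rate x - 2 * \<rho> \<theta> * net_rate x \<partial>pair_pmf (site_pmf \<theta>) (site_pmf \<theta>))"
    using X1 measure_pmf.square_integrable_imp_integrable[OF square_integrable_net_rate[OF \<theta>]] by simp
  also have "\<dots> = flux_slope \<theta>"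
    unfolding flux_slope_def by (rule Bochner_Integration.integral_cong[OF refl]) (simp add: X_def algebra_simps)
  finally show ?thesis
    by (rule DERIV_cong_ev[OF refl _ refl, THEN iffD1, rotated])
       (use eventually_nhds_in_open[OF open_theta_range \<theta>] in \<open>auto elim!: eventually_mono simp: eq\<close>)
qed

text \<open>On the range of \<open>\<rho>\<close> the description operator in \<open>flux\<close> is
  the inverse of \<open>\<rho>\<close>, which is differentiable with derivative
  \<open>inverse (V \<theta>)\<close> because \<open>V \<theta>\<close> is positive. The chain rule
  then gives the quotient.\<close>

lemma has_derivative_flux:
  assumes \<theta>: "\<theta> \<in> \<Theta>"
  shows "(flux wmin wmax p q f has_real_derivative flux_slope \<theta> / V \<theta>) (at (\<rho> \<theta>))"
proof -
  define \<tau> where "\<tau> u = (THE \<theta>. \<theta> \<in> \<Theta> \<and> density_at wmin wmax f \<theta> = u)" for u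
  define G where "G \<theta> = (\<integral>\<omega>. p (\<omega> 0) (\<omega> 1) - q (\<omega> 0) (\<omega> 1) \<partial>stat_measure wmin wmax f \<theta>)" for \<theta>
  have flux: "flux wmin wmax p q f = (\<lambda>u. G (\<tau> u))"
    by (simp add: fun_eq_iff flux_def G_def \<tau>_def)
  have inv: "\<tau> (\<rho> t) = t" if "t \<in> \<Theta>" for t
    unfolding \<tau>_def using that inj_on_\<rho> by (intro the_equality) (auto simp: density_at_eq inj_on_def)
  have "(\<tau> has_derivative (*) (inverse (V \<theta>))) (at (\<rho> \<theta>))"
  proof (rule has_derivative_inverse_strong[where f = \<rho> and x = \<theta>, OF open_theta_range \<theta>])
    show "\<tau> (\<rho> t) = t" if "t \<in> \<Theta>" for t by (rule inv[OF that])
    show "continuous_on \<Theta> \<rho>"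
      using has_derivative_\<rho> DERIV_isCont by (intro continuous_at_imp_continuous_on) blast
    show "(\<rho> has_derivative (*) (V \<theta>)) (at \<theta>)"
      using has_derivative_\<rho>[OF \<theta>] by (simp add: has_field_derivative_def)
    show "(*) (V \<theta>) \<circ> (*) (inverse (V \<theta>)) = id"
      using V_pos[OF \<theta>] by (auto simp: fun_eq_iff)
  qed
  then have \<tau>': "(\<tau> has_real_derivative inverse (V \<theta>)) (at (\<rho> \<theta>))"
    by (simp add: has_field_derivative_def)
  have G: "G t = (\<integral>x. net_rate x \<partial>pair_pmf (site_pmf t) (site_pmf t))" if "t \<in> \<Theta>" for t
    unfolding G_def stat_measure_eq[OF that]
    using integral_iid_pair[where i = 0 and j = 1 and F = net_rate and s = "site_pmf t"] by (simp add: net_rate_def)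
  have "(G has_real_derivative flux_slope \<theta>) (at \<theta>)"
    using has_derivative_mean_net_rate[OF \<theta>]
    by (rule DERIV_cong_ev[OF refl _ refl, THEN iffD1, rotated])
       (use eventually_nhds_in_open[OF open_theta_range \<theta>] in \<open>auto elim!: eventually_mono simp: G\<close>)
  then have "(G has_real_derivative flux_slope \<theta>) (at (\<tau> (\<rho> \<theta>)))" by (simp add: inv[OF \<theta>])
  from DERIV_chain2[OF this \<tau>'] show ?thesis
    by (simp add: flux divide_inverse)
qed

end

section \<open>The initial law of the second class particle\<close>

lemma
  fixes F :: "'a \<Rightarrow> real"
  assumes S: "finite S" and F: "\<And>z. z \<notin> S \<Longrightarrow> F z = 0"
  shows integrable_count_space_finite: "integrable (count_space UNIV) F"
    and integral_count_space_finite: "(\<integral>z. F z \<partial>count_space UNIV) = sum F S"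
proof -
  have eq: "F = (\<lambda>z. \<Sum>a\<in>S. F a * indicator {a} z)"
  proof
    fix z
    have "(\<Sum>a\<in>S. F a * indicator {a} z) = (\<Sum>a\<in>S. if z = a then F a else 0)"
      by (intro sum.cong refl) (simp add: indicator_def)
    also have "\<dots> = F z" using S F[of z] by simp
    finally show "F z = (\<Sum>a\<in>S. F a * indicator {a} z)" ..
  qed
  have i: "integrable (count_space UNIV) (indicator {a} :: 'a \<Rightarrow> real)" for a
    by (rule integrable_real_indicator) simp_all
  have "integrable (count_space UNIV) (\<lambda>z. \<Sum>a\<in>S. F a * indicator {a} z)"
    by (intro Bochner_Integration.integrable_sum integrable_mult_right i)
  then show "integrable (count_space UNIV) F" by (simp only: eq[symmetric])
  have "(\<integral>z. (\<Sum>a\<in>S. F a * indicator {a} z) \<partial>count_space UNIV) = (\<Sum>a\<in>S. \<integral>z. F a * indicator {a} z \<partial>count_space UNIV)"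
    by (intro Bochner_Integration.integral_sum integrable_mult_right i)
  also have "\<dots> = sum F S" by simp
  finally show "(\<integral>z. F z \<partial>count_space UNIV) = sum F S" by (simp only: eq[symmetric])
qed

lemma telescope_int:
  fixes F :: "int \<Rightarrow> real"
  assumes "a \<le> b"
  shows "(\<Sum>y\<in>{a..<b}. F (y + 1) - F y) = F b - F a"
  using assms
proof (induction b rule: int_ge_induct)
  case (step i)
  then have "{a..<i + 1} = insert i {a..<i}" by auto
  then show ?case using step by simp
qed simp

text \<open>Summation by parts on the integers; \<open>k z y\<close> is the kernel for which
  \<open>F z - F 0 = (\<Sum>y. k z y * (F (y + 1) - F y))\<close>.\<close>

lemma
  fixes u F :: "int \<Rightarrow> real"
  assumes u: "integrable (count_space UNIV) u" and zu: "integrable (count_space UNIV) (\<lambda>z. of_int z * u z)"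
    and u0: "(\<integral>z. u z \<partial>count_space UNIV) = 0" and F: "\<And>y. \<bar>F (y + 1) - F y\<bar> \<le> B"
  defines "G \<equiv> \<lambda>y. \<integral>z. (if y < z then u z else 0) \<partial>count_space UNIV"
  shows summation_by_parts:
      "(\<integral>y. G y * (F (y + 1) - F y) \<partial>count_space UNIV) = (\<integral>z. u z * (F z - F 0) \<partial>count_space UNIV)"
    and summation_by_parts_integrable: "integrable (count_space UNIV) (\<lambda>y. G y * (F (y + 1) - F y))"
proof -
  let ?C = "count_space (UNIV :: int set)"
  interpret pair_sigma_finite ?C ?C
    by (intro pair_sigma_finite.intro sigma_finite_measure_count_space)
  define D where "D y = F (y + 1) - F y" for y
  define k :: "int \<Rightarrow> int \<Rightarrow> real" where
    "k z y = (if 0 \<le> y \<and> y < z then 1 else if z \<le> y \<and> y < 0 then -1 else 0)" for z y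
  define S :: "int \<Rightarrow> int set" where "S z = {0..<z} \<union> {z..<0}" for z
  have kS: "k z y = 0" if "y \<notin> S z" for z y using that by (auto simp: k_def S_def)
  have fS: "finite (S z)" for z by (simp add: S_def)
  have kD: "(\<Sum>y\<in>S z. k z y * D y) = F z - F 0" for z
  proof (cases "0 \<le> z")
    case True
    then have "S z = {0..<z}" by (auto simp: S_def)
    then have "(\<Sum>y\<in>S z. k z y * D y) = (\<Sum>y\<in>{0..<z}. F (y + 1) - F y)"
      by (intro sum.cong) (auto simp: k_def D_def)
    then show ?thesis using telescope_int[OF True, of F] by simp
  next
    case False
    then have "S z = {z..<0}" by (auto simp: S_def)
    then have "(\<Sum>y\<in>S z. k z y * D y) = (\<Sum>y\<in>{z..<0}. - (F (y + 1) - F y))"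
      by (intro sum.cong) (auto simp: k_def D_def)
    then show ?thesis using telescope_int[of z 0 F] False by (simp only: sum_negf)
  qed
  \<comment> \<open>The sum has \<open>\<bar>z\<bar>\<close> terms, each at most \<open>B\<close>,
    so the first absolute moment of \<open>u\<close> makes the double series absolutely
    convergent.\<close>
  have kabs: "(\<Sum>y\<in>S z. \<bar>k z y * D y\<bar>) \<le> \<bar>of_int z\<bar> * B" for z
  proof -
    have "(\<Sum>y\<in>S z. \<bar>k z y * D y\<bar>) \<le> (\<Sum>y\<in>S z. B)"
      using F F[unfolded abs_minus_commute[of "F (_ + 1)"]] by (intro sum_mono) (auto simp: k_def D_def S_def)
    also have "\<dots> = \<bar>of_int z\<bar> * B"
      by (cases "0 \<le> z") (auto simp: S_def)
    finally show ?thesis .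
  qed
  have int1: "integrable ?C (\<lambda>y. u z * k z y * D y)" for z
    by (rule integrable_count_space_finite[OF fS[of z]]) (simp add: kS)
  have val1: "(\<integral>y. u z * k z y * D y \<partial>?C) = u z * (F z - F 0)" for z
  proof -
    have "(\<integral>y. u z * k z y * D y \<partial>?C) = (\<Sum>y\<in>S z. u z * k z y * D y)"
      by (rule integral_count_space_finite[OF fS]) (simp add: kS)
    then show ?thesis by (simp only: kD[symmetric] sum_distrib_left mult.assoc)
  qed
  have val1': "(\<integral>y. norm (u z * k z y * D y) \<partial>?C) \<le> \<bar>of_int z * u z\<bar> * B" for z
  proof -
    have "(\<integral>y. norm (u z * k z y * D y) \<partial>?C) = (\<Sum>y\<in>S z. norm (u z * k z y * D y))"
      by (rule integral_count_space_finite[OF fS]) (simp add: kS)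
    also have "\<dots> = \<bar>u z\<bar> * (\<Sum>y\<in>S z. \<bar>k z y * D y\<bar>)"
      by (simp add: sum_distrib_left abs_mult mult.assoc)
    also have "\<dots> \<le> \<bar>u z\<bar> * (\<bar>of_int z\<bar> * B)" by (rule mult_left_mono[OF kabs]) simp
    finally show ?thesis by (simp add: abs_mult mult_ac)
  qed
  have pair: "integrable (?C \<Otimes>\<^sub>M ?C) (\<lambda>(z, y). u z * k z y * D y)"
  proof (rule Fubini_integrable)
    show "(\<lambda>(z, y). u z * k z y * D y) \<in> borel_measurable (?C \<Otimes>\<^sub>M ?C)"
      by (simp add: count_space_int_pair)
    show "integrable ?C (\<lambda>z. \<integral>y. norm (case (z, y) of (z, y) \<Rightarrow> u z * k z y * D y) \<partial>?C)"
    proof (rule Bochner_Integration.integrable_bound)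
      show "integrable ?C (\<lambda>z. \<bar>of_int z * u z\<bar> * B)" using zu by simp
      show "AE z in ?C. norm (\<integral>y. norm (case (z, y) of (z, y) \<Rightarrow> u z * k z y * D y) \<partial>?C) \<le> norm (\<bar>of_int z * u z\<bar> * B)"
      proof (rule AE_I2)
        fix z
        have "0 \<le> (\<integral>y. norm (u z * k z y * D y) \<partial>?C)" by simp
        then show "norm (\<integral>y. norm (case (z, y) of (z, y) \<Rightarrow> u z * k z y * D y) \<partial>?C) \<le> norm (\<bar>of_int z * u z\<bar> * B)"
          using val1'[of z] by simp
      qed
    qed simp
    show "AE z in ?C. integrable ?C (\<lambda>y. case (z, y) of (z, y) \<Rightarrow> u z * k z y * D y)"
      using int1 by simp
  qed
  have Gk: "(\<integral>z. u z * k z y \<partial>?C) = G y" for y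
  proof (cases "0 \<le> y")
    case True
    then have "(\<lambda>z. u z * k z y) = (\<lambda>z. if y < z then u z else 0)" by (auto simp: k_def)
    then show ?thesis by (simp add: G_def)
  next
    \<comment> \<open>For negative \<open>y\<close> the kernel is the indicator of
      \<open>y < z\<close> minus one. The subtracted total mass of \<open>u\<close> is zero, so one
      formula for \<open>G\<close> serves both signs.\<close>
    case False
    have i: "integrable ?C (\<lambda>z. if y < z then u z else 0)"
      by (rule Bochner_Integration.integrable_bound[OF u]) (auto intro!: AE_I2)
    have "(\<lambda>z. u z * k z y) = (\<lambda>z. (if y < z then u z else 0) - u z)"
      using False by (auto simp: k_def)
    then have "(\<integral>z. u z * k z y \<partial>?C) = G y - (\<integral>z. u z \<partial>?C)"
      using i u by (simp add: G_def)
    then show ?thesis by (simp add: u0)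
  qed
  have val2: "(\<integral>z. u z * k z y * D y \<partial>?C) = G y * D y" for y
    by (simp add: Gk)
  show "integrable ?C (\<lambda>y. G y * (F (y + 1) - F y))"
    using integrable_snd[OF pair] by (simp only: val2 D_def[symmetric])
  have "(\<integral>y. (\<integral>z. u z * k z y * D y \<partial>?C) \<partial>?C) = (\<integral>z. (\<integral>y. u z * k z y * D y \<partial>?C) \<partial>?C)"
    by (rule Fubini_integral[OF pair])
  then show "(\<integral>y. G y * (F (y + 1) - F y) \<partial>?C) = (\<integral>z. u z * (F z - F 0) \<partial>?C)"
    by (simp only: val1 val2 D_def[symmetric])
qed

context deposition_rates
begin

text \<open>The sum in \<open>hat_weight\<close> before division by the variance, with the site
  weights extended by zero to all integers.\<close>

definition tail :: "real \<Rightarrow> int \<Rightarrow> real" where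
  "tail \<theta> y = (\<integral>z. (if y < z then pmf (site_pmf \<theta>) z * (of_int z - \<rho> \<theta>) else 0) \<partial>count_space UNIV)"

definition hat_pmf :: "real \<Rightarrow> int pmf" where
  "hat_pmf \<theta> = embed_pmf (hat_weight wmin wmax f \<theta>)"

lemma centred_eq:
  assumes \<theta>: "\<theta> \<in> \<Theta>"
  shows "centred wmin wmax f \<theta> z = of_int z - \<rho> \<theta>"
proof -
  have eq: "(\<lambda>z. if z \<in> I then of_int z * site_weight wmin wmax f \<theta> z else 0) = (\<lambda>z. pmf (site_pmf \<theta>) z * of_int z)"
    by (auto simp: fun_eq_iff site_weight_eq[OF \<theta>] pmf_site[OF \<theta>] weight_def)
  have "(\<Sum>\<^sub>\<infinity>y\<in>I. of_int y * site_weight wmin wmax f \<theta> y) = \<rho> \<theta>"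
    using infsum_eq_integral_count_space[of I "\<lambda>z. of_int z * site_weight wmin wmax f \<theta> z"]
      integrable_site[OF \<theta>]
    unfolding eq integrable_pmf_count_space \<rho>_def integral_pmf_count_space by simp
  then show ?thesis by (simp add: centred_def)
qed

lemma centred_integrable:
  assumes \<theta>: "\<theta> \<in> \<Theta>"
  defines "u \<equiv> \<lambda>z. pmf (site_pmf \<theta>) z * (of_int z - \<rho> \<theta>)"
  shows "integrable (count_space UNIV) u"
    and "integrable (count_space UNIV) (\<lambda>z. of_int z * u z)"
    and "(\<integral>z. u z \<partial>count_space UNIV) = 0"
    and "(\<integral>z. of_int z * u z \<partial>count_space UNIV) = V \<theta>"
proof -
  note i1 = integrable_site[OF \<theta>]
  have i2: "integrable (site_pmf \<theta>) (\<lambda>z. (of_int z)\<^sup>2 :: real)"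
    using square_integrable_site[OF \<theta>] by (simp add: square_integrable_def)
  have "integrable (site_pmf \<theta>) (\<lambda>z. of_int z - \<rho> \<theta>)" using i1 by simp
  then show "integrable (count_space UNIV) u"
    unfolding integrable_pmf_count_space u_def .
  have eq: "(\<lambda>z. of_int z * u z) = (\<lambda>z. pmf (site_pmf \<theta>) z * ((of_int z)\<^sup>2 - \<rho> \<theta> * of_int z))"
    by (simp add: u_def fun_eq_iff power2_eq_square algebra_simps)
  have i3: "integrable (site_pmf \<theta>) (\<lambda>z. (of_int z)\<^sup>2 - \<rho> \<theta> * of_int z)" using i1 i2 by simp
  then show "integrable (count_space UNIV) (\<lambda>z. of_int z * u z)"
    unfolding eq integrable_pmf_count_space .
  have "(\<integral>z. of_int z - \<rho> \<theta> \<partial>site_pmf \<theta>) = 0" using i1 by (simp add: \<rho>_def[symmetric])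
  then show "(\<integral>z. u z \<partial>count_space UNIV) = 0"
    unfolding integral_pmf_count_space u_def .
  have "(\<integral>z. (of_int z)\<^sup>2 - \<rho> \<theta> * of_int z \<partial>site_pmf \<theta>) = V \<theta>"
    using i1 i2 by (simp add: V_eq[OF \<theta>] \<rho>_def[symmetric] power2_eq_square)
  then show "(\<integral>z. of_int z * u z \<partial>count_space UNIV) = V \<theta>"
    unfolding eq integral_pmf_count_space .
qed

text \<open>Above the range nothing is left to sum; below it the sum is the whole centred mass,
  which is zero. At the top value of \<open>I\<close> the tail vanishes too, and this leaves room
  for the extra particle.\<close>

lemma tail_eq_0:
  assumes \<theta>: "\<theta> \<in> \<Theta>" and y: "y \<notin> I \<or> y + 1 \<notin> I"
  shows "tail \<theta> y = 0"
proof (cases "0 \<le> y")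
  case True
  have "z \<notin> I" if "y < z" for z
    using I_between[OF zero_in_I, of z y] I_between[OF zero_in_I, of z "y + 1"] y that True by fastforce
  then have "(\<lambda>z. if y < z then pmf (site_pmf \<theta>) z * (of_int z - \<rho> \<theta>) else 0) = (\<lambda>z. 0)"
    by (auto simp: pmf_site[OF \<theta>] weight_def)
  then show ?thesis by (simp add: tail_def)
next
  case False
  have "z \<notin> I" if "\<not> y < z" for z
    using I_between[OF _ zero_in_I, of z y] I_between[OF _ zero_in_I, of z "y + 1"] y that False by fastforce
  then have "(\<lambda>z. if y < z then pmf (site_pmf \<theta>) z * (of_int z - \<rho> \<theta>) else 0) = (\<lambda>z. pmf (site_pmf \<theta>) z * (of_int z - \<rho> \<theta>))"
    by (auto simp: fun_eq_iff pmf_site[OF \<theta>] weight_def)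
  then show ?thesis using centred_integrable(3)[OF \<theta>] by (simp add: tail_def)
qed

text \<open>If \<open>y + 1\<close> is at least the mean, all summands are nonnegative. Otherwise,
  the total being zero, the tail is minus the sum over \<open>z \<le> y\<close>, whose terms are
  nonpositive.\<close>

lemma tail_nonneg:
  assumes \<theta>: "\<theta> \<in> \<Theta>"
  shows "0 \<le> tail \<theta> y"
proof (cases "\<rho> \<theta> \<le> of_int y + 1")
  case True
  have "0 \<le> of_int z - \<rho> \<theta>" if "y < z" for z
  proof -
    have "y + 1 \<le> z" using that by simp
    then have "of_int (y + 1) \<le> (of_int z :: real)" by (simp only: of_int_le_iff)
    then show ?thesis using True by simp
  qed
  then show ?thesis unfolding tail_def by (intro Bochner_Integration.integral_nonneg) simp
next
  case False
  let ?u = "\<lambda>z. pmf (site_pmf \<theta>) z * (of_int z - \<rho> \<theta>)"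
  note u = centred_integrable(1)[OF \<theta>]
  have i: "integrable (count_space UNIV) (\<lambda>z. if y < z then ?u z else 0)"
    by (rule Bochner_Integration.integrable_bound[OF u]) (auto intro!: AE_I2)
  have nn: "0 \<le> (if y < z then ?u z else 0) - ?u z" for z
  proof (cases "y < z")
    case False
    then have "of_int z \<le> (of_int y :: real)" by simp
    then have "of_int z - \<rho> \<theta> \<le> 0" using \<open>\<not> \<rho> \<theta> \<le> of_int y + 1\<close> by simp
    then have "pmf (site_pmf \<theta>) z * (of_int z - \<rho> \<theta>) \<le> 0" by (simp add: mult_nonneg_nonpos)
    then show ?thesis using False by simp
  qed simp
  have "0 \<le> (\<integral>z. (if y < z then ?u z else 0) - ?u z \<partial>count_space UNIV)"
    using nn by (rule Bochner_Integration.integral_nonneg)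
  also have "\<dots> = tail \<theta> y"
    using i u centred_integrable(3)[OF \<theta>] by (simp add: tail_def)
  finally show ?thesis .
qed

lemma hat_weight_eq:
  assumes \<theta>: "\<theta> \<in> \<Theta>"
  shows "hat_weight wmin wmax f \<theta> y = tail \<theta> y / V \<theta>"
proof (cases "y \<in> I")
  case True
  let ?A = "{z \<in> I. y + 1 \<le> z}"
  let ?F = "\<lambda>z. centred wmin wmax f \<theta> z * site_weight wmin wmax f \<theta> z"
  have eq: "(\<lambda>z. if z \<in> ?A then ?F z else 0) = (\<lambda>z. if y < z then pmf (site_pmf \<theta>) z * (of_int z - \<rho> \<theta>) else 0)"
    by (auto simp: fun_eq_iff centred_eq[OF \<theta>] site_weight_eq[OF \<theta>] pmf_site[OF \<theta>] weight_def)
  have "integrable (count_space UNIV) (\<lambda>z. if y < z then pmf (site_pmf \<theta>) z * (of_int z - \<rho> \<theta>) else 0)"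
    by (rule Bochner_Integration.integrable_bound[OF centred_integrable(1)[OF \<theta>]]) (auto intro!: AE_I2)
  then have "(\<Sum>\<^sub>\<infinity>z\<in>?A. ?F z) = tail \<theta> y"
    using infsum_eq_integral_count_space[of ?A ?F] unfolding eq tail_def by simp
  then show ?thesis using True by (simp add: hat_weight_def site_variance_eq[OF \<theta>])
next
  case False
  then show ?thesis using tail_eq_0[OF \<theta>, of y] by (simp add: hat_weight_def)
qed

text \<open>Summation by parts with \<open>F\<close> the identity, whose increments are one: the
  tails add up to the integral of \<open>z\<close> against the centred law, which is the variance.
  Hence the normalisation of \<open>hat_weight\<close>.\<close>

lemma
  assumes \<theta>: "\<theta> \<in> \<Theta>"
  shows integrable_tail: "integrable (count_space UNIV) (tail \<theta>)"
    and integral_tail: "(\<integral>y. tail \<theta> y \<partial>count_space UNIV) = V \<theta>"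
proof -
  let ?u = "\<lambda>z. pmf (site_pmf \<theta>) z * (of_int z - \<rho> \<theta>)"
  note c = centred_integrable[OF \<theta>]
  show "integrable (count_space UNIV) (tail \<theta>)"
    using summation_by_parts_integrable[OF c(1-3), of of_int 1] by (simp add: tail_def[abs_def])
  show "(\<integral>y. tail \<theta> y \<partial>count_space UNIV) = V \<theta>"
    using summation_by_parts[OF c(1-3), of of_int 1] c(4) by (simp add: tail_def mult.commute)
qed

lemma pmf_hat:
  assumes \<theta>: "\<theta> \<in> \<Theta>"
  shows "pmf (hat_pmf \<theta>) y = tail \<theta> y / V \<theta>"
proof -
  have nn: "0 \<le> hat_weight wmin wmax f \<theta> y" for y
    using tail_nonneg[OF \<theta>] V_pos[OF \<theta>] by (simp add: hat_weight_eq[OF \<theta>])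
  have "(\<integral>\<^sup>+z. ennreal (hat_weight wmin wmax f \<theta> z) \<partial>count_space UNIV)
      = ennreal (\<integral>z. hat_weight wmin wmax f \<theta> z \<partial>count_space UNIV)"
    using nn integrable_tail[OF \<theta>] by (intro nn_integral_eq_integral) (auto simp: hat_weight_eq[OF \<theta>])
  also have "(\<integral>z. hat_weight wmin wmax f \<theta> z \<partial>count_space UNIV) = 1"
    using V_pos[OF \<theta>] integral_tail[OF \<theta>] by (simp add: hat_weight_eq[OF \<theta>])
  finally show ?thesis
    unfolding hat_pmf_def using nn by (simp add: pmf_embed_pmf hat_weight_eq[OF \<theta>])
qed

lemma hat_measure_eq:
  assumes \<theta>: "\<theta> \<in> \<Theta>"
  shows "hat_measure wmin wmax f \<theta> = iid_except (hat_pmf \<theta>) (site_pmf \<theta>)"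
  unfolding hat_measure_def iid_except_def
proof (rule arg_cong[where f = "Pi\<^sub>M UNIV"], rule ext)
  fix i :: int
  show "point_measure UNIV (\<lambda>z. ennreal (if i = 0 then hat_weight wmin wmax f \<theta> z else site_weight wmin wmax f \<theta> z))
      = measure_pmf (if i = 0 then hat_pmf \<theta> else site_pmf \<theta>)"
    by (cases "i = 0") (simp_all add: point_measure_def measure_pmf_eq_density hat_weight_eq[OF \<theta>]
        site_weight_eq[OF \<theta>] pmf_hat[OF \<theta>] pmf_site[OF \<theta>])
qed

lemma set_hat_pmf:
  assumes \<theta>: "\<theta> \<in> \<Theta>" and y: "y \<in> set_pmf (hat_pmf \<theta>)"
  shows "y \<in> I" and "y + 1 \<in> I"
  using y tail_eq_0[OF \<theta>, of y] by (auto simp: set_pmf_eq pmf_hat[OF \<theta>])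

text \<open>The identity for which the law at the origin is designed: its masses are the tails of
  the centred site law, so summation by parts returns the covariance. Boundedness of
  \<open>F\<close> bounds the increments, and \<open>F 0\<close> drops out because the centred law
  has total mass zero.\<close>

lemma hat_pmf_difference:
  fixes F :: "int \<Rightarrow> real"
  assumes \<theta>: "\<theta> \<in> \<Theta>" and B: "\<And>z. \<bar>F z\<bar> \<le> B"
  shows "(\<integral>x. F (x + 1) - F x \<partial>hat_pmf \<theta>) = (\<integral>x. (of_int x - \<rho> \<theta>) * F x \<partial>site_pmf \<theta>) / V \<theta>"
proof -
  let ?u = "\<lambda>z. pmf (site_pmf \<theta>) z * (of_int z - \<rho> \<theta>)"
  note c = centred_integrable[OF \<theta>]
  have uF: "integrable (count_space UNIV) (\<lambda>z. ?u z * F z)"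
  proof (rule Bochner_Integration.integrable_bound)
    show "integrable (count_space UNIV) (\<lambda>z. ?u z * B)" using c(1) by (rule integrable_mult_left)
    have "\<bar>F z\<bar> \<le> \<bar>B\<bar>" for z using B[of z] by linarith
    then show "AE z in count_space UNIV. norm (?u z * F z) \<le> norm (?u z * B)"
      by (intro AE_I2) (simp add: abs_mult mult_left_mono)
  qed simp
  have "(\<integral>x. F (x + 1) - F x \<partial>hat_pmf \<theta>) = (\<integral>x. tail \<theta> x * (F (x + 1) - F x) / V \<theta> \<partial>count_space UNIV)"
    unfolding integral_pmf_count_space pmf_hat[OF \<theta>] by simp
  also have "\<dots> = (\<integral>x. tail \<theta> x * (F (x + 1) - F x) \<partial>count_space UNIV) / V \<theta>" by simp
  also have "(\<integral>x. tail \<theta> x * (F (x + 1) - F x) \<partial>count_space UNIV) = (\<integral>z. ?u z * (F z - F 0) \<partial>count_space UNIV)"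
    unfolding tail_def
  proof (rule summation_by_parts[OF c(1-3)])
    show "\<bar>F (y + 1) - F y\<bar> \<le> 2 * B" for y using B[of y] B[of "y + 1"] by linarith
  qed
  also have "\<dots> = (\<integral>z. ?u z * F z - F 0 * ?u z \<partial>count_space UNIV)"
    by (rule Bochner_Integration.integral_cong[OF refl]) (simp add: algebra_simps)
  also have "\<dots> = (\<integral>z. ?u z * F z \<partial>count_space UNIV)"
    using uF c(1) c(3) by simp
  also have "\<dots> = (\<integral>x. (of_int x - \<rho> \<theta>) * F x \<partial>site_pmf \<theta>)"
    unfolding integral_pmf_count_space by (simp add: mult.assoc)
  finally show ?thesis .
qed

lemma plus_delta_update: "(\<lambda>i. (X(0 := x)) i + delta_conf 0 i) = X(0 := x + 1)"
  by (auto simp: fun_eq_iff delta_conf_def)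

lemma measurable_plus_delta:
  "(\<lambda>\<omega> i. \<omega> i + delta_conf 0 i) \<in> int_seq_space \<rightarrow>\<^sub>M int_seq_space"
  by (rule measurable_int_seqI,
      rule measurable_int2[OF measurable_coordinate measurable_const, where F = "(+)"]) simp_all

text \<open>The one-site identity with all other sites frozen, then averaged over them. It will be
  applied with \<open>F\<close> the expectation of an observable at time \<open>t\<close> as a
  function of the initial configuration.\<close>

lemma hat_measure_difference:
  fixes F :: "int_seq \<Rightarrow> real"
  assumes \<theta>: "\<theta> \<in> \<Theta>" and F: "F \<in> borel_measurable int_seq_space" and B: "\<And>\<omega>. \<bar>F \<omega>\<bar> \<le> B"
  shows "(\<integral>\<omega>. F (\<lambda>i. \<omega> i + delta_conf 0 i) - F \<omega> \<partial>iid_except (hat_pmf \<theta>) (site_pmf \<theta>))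
      = (\<integral>\<omega>. (of_int (\<omega> 0) - \<rho> \<theta>) * F \<omega> \<partial>iid (site_pmf \<theta>)) / V \<theta>"
proof -
  let ?d = "hat_pmf \<theta>" and ?s = "site_pmf \<theta>"
  interpret H: prob_space "iid_except ?d ?s" by (rule prob_space_iid_except)
  interpret S: prob_space "iid ?s" by (rule prob_space_iid)
  have Fd: "(\<lambda>\<omega>. F (\<lambda>i. \<omega> i + delta_conf 0 i)) \<in> borel_measurable int_seq_space"
    by (rule measurable_compose[OF measurable_plus_delta F])
  have H1: "(\<lambda>\<omega>. F (\<lambda>i. \<omega> i + delta_conf 0 i) - F \<omega>) \<in> borel_measurable int_seq_space"
    by (rule borel_measurable_diff[OF Fd F])
  have Hi: "integrable (iid_except ?d ?s) (\<lambda>\<omega>. F (\<lambda>i. \<omega> i + delta_conf 0 i) - F \<omega>)"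
  proof (rule H.integrable_const_bound[where B = "2 * B"])
    show "AE \<omega> in iid_except ?d ?s. norm (F (\<lambda>i. \<omega> i + delta_conf 0 i) - F \<omega>) \<le> 2 * B"
    proof (rule AE_I2)
      fix \<omega>
      show "norm (F (\<lambda>i. \<omega> i + delta_conf 0 i) - F \<omega>) \<le> 2 * B"
        using B[of \<omega>] B[of "\<lambda>i. \<omega> i + delta_conf 0 i"] unfolding real_norm_def by linarith
    qed
    show "(\<lambda>\<omega>. F (\<lambda>i. \<omega> i + delta_conf 0 i) - F \<omega>) \<in> borel_measurable (iid_except ?d ?s)"
      unfolding measurable_cong_sets[OF sets_iid_except refl] by (rule H1)
  qed
  have w: "(\<lambda>\<omega>. of_int (\<omega> 0) - \<rho> \<theta> :: real) \<in> borel_measurable int_seq_space"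
    by (rule measurable_compose[OF measurable_coordinate]) simp
  have wF: "(\<lambda>\<omega>. (of_int (\<omega> 0) - \<rho> \<theta>) * F \<omega>) \<in> borel_measurable int_seq_space"
    by (rule borel_measurable_times[OF w F])
  have wi: "integrable (iid ?s) (\<lambda>\<omega>. of_int (\<omega> 0) - \<rho> \<theta>)"
    using integrable_site[OF \<theta>] integrable_iid_coordinate[of ?s "\<lambda>z. of_int z - \<rho> \<theta>" 0] by simp
  have wFi: "integrable (iid_except ?s ?s) (\<lambda>\<omega>. (of_int (\<omega> 0) - \<rho> \<theta>) * F \<omega>)"
    unfolding iid_except_same
  proof (rule Bochner_Integration.integrable_bound)
    show "integrable (iid ?s) (\<lambda>\<omega>. (of_int (\<omega> 0) - \<rho> \<theta>) * B)" using wi by (rule integrable_mult_left)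
    show "(\<lambda>\<omega>. (of_int (\<omega> 0) - \<rho> \<theta>) * F \<omega>) \<in> borel_measurable (iid ?s)"
      unfolding measurable_cong_sets[OF sets_iid refl] by (rule wF)
    have "\<bar>F z\<bar> \<le> \<bar>B\<bar>" for z using B[of z] by linarith
    then show "AE \<omega> in iid ?s. norm ((of_int (\<omega> 0) - \<rho> \<theta>) * F \<omega>) \<le> norm ((of_int (\<omega> 0) - \<rho> \<theta>) * B)"
      by (intro AE_I2) (simp add: abs_mult mult_left_mono)
  qed
  have "(\<integral>\<omega>. F (\<lambda>i. \<omega> i + delta_conf 0 i) - F \<omega> \<partial>iid_except ?d ?s)
      = (\<integral>X. (\<integral>x. F (X(0 := x + 1)) - F (X(0 := x)) \<partial>?d) \<partial>iid_rest ?s)"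
    unfolding integral_iid_except[OF H1 Hi] plus_delta_update ..
  also have "\<dots> = (\<integral>X. (\<integral>x. (of_int x - \<rho> \<theta>) * F (X(0 := x)) \<partial>?s) / V \<theta> \<partial>iid_rest ?s)"
    by (simp only: hat_pmf_difference[OF \<theta>, of "\<lambda>x. F (_(0 := x))", OF B])
  also have "\<dots> = (\<integral>X. (\<integral>x. (of_int x - \<rho> \<theta>) * F (X(0 := x)) \<partial>?s) \<partial>iid_rest ?s) / V \<theta>"
    by simp
  also have "(\<integral>X. (\<integral>x. (of_int x - \<rho> \<theta>) * F (X(0 := x)) \<partial>?s) \<partial>iid_rest ?s)
      = (\<integral>\<omega>. (of_int (\<omega> 0) - \<rho> \<theta>) * F \<omega> \<partial>iid ?s)"
    using integral_iid_except[OF wF wFi] by (simp add: iid_except_same)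
  finally show ?thesis .
qed

text \<open>A value \<open>x\<close> with positive mass under the modified law has \<open>x\<close>
  and \<open>x + 1\<close> in \<open>I\<close>, the support of the site law. With the other sites
  fixed, the configurations without and with the extra particle are therefore both among those
  already known to be tempered.\<close>

lemma AE_hat_measure:
  assumes \<theta>: "\<theta> \<in> \<Theta>" and T: "T \<in> sets int_seq_space" and AE: "AE \<omega> in iid (site_pmf \<theta>). \<omega> \<in> T"
  shows "AE \<omega> in iid_except (hat_pmf \<theta>) (site_pmf \<theta>). \<omega> \<in> T \<and> (\<lambda>i. \<omega> i + delta_conf 0 i) \<in> T"
proof -
  have "AE X in iid_rest (site_pmf \<theta>). \<forall>x\<in>I. X(0 := x) \<in> T"
    using AE AE_iid_except[of "\<lambda>\<omega>. \<omega> \<in> T" "site_pmf \<theta>" "site_pmf \<theta>"] T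
    unfolding iid_except_same set_site_pmf[OF \<theta>] by simp
  then have *: "AE X in iid_rest (site_pmf \<theta>). \<forall>x\<in>set_pmf (hat_pmf \<theta>).
      X(0 := x) \<in> T \<and> (\<lambda>i. (X(0 := x)) i + delta_conf 0 i) \<in> T"
    unfolding plus_delta_update by eventually_elim (use set_hat_pmf[OF \<theta>] in blast)
  have "{\<omega>. (\<lambda>i. \<omega> i + delta_conf 0 i) \<in> T} \<in> sets int_seq_space"
    using measurable_sets[OF measurable_plus_delta T] by (simp add: vimage_def)
  from sets.Int[OF T this] have "{\<omega>. \<omega> \<in> T \<and> (\<lambda>i. \<omega> i + delta_conf 0 i) \<in> T} \<in> sets int_seq_space"
    by (simp add: Int_def)
  then show ?thesis
    using AE_iid_except[of "\<lambda>\<omega>. \<omega> \<in> T \<and> (\<lambda>i. \<omega> i + delta_conf 0 i) \<in> T"] * by blast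
qed

end

section \<open>Stationary evolution of the heights\<close>

lemma incr_eq_imp:
  assumes "incr g = incr h"
  shows "g i - g 0 = h i - h 0"
proof (induction i rule: int_induct[where k = 0])
  case (step1 i)
  have "incr g (i + 1) = incr h (i + 1)" by (simp add: assms)
  then show ?case using step1 by (simp add: incr_def)
next
  case (step2 i)
  have "incr g i = incr h i" by (simp add: assms)
  then show ?case using step2 by (simp add: incr_def)
qed simp

lemma height_of_0 [simp]: "height_of \<omega> 0 = 0"
  by (simp add: height_of_def)

lemma incr_shift: "incr (shift a c h) = (\<lambda>i. incr h (i + a))"
  by (simp add: fun_eq_iff incr_def shift_def algebra_simps)

lemma height_of_shift: "height_of (\<lambda>i. \<omega> (i + a)) = shift a (- height_of \<omega> a) (height_of \<omega>)"
proof
  fix i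
  have "incr (height_of (\<lambda>i. \<omega> (i + a))) = incr (shift a (- height_of \<omega> a) (height_of \<omega>))"
    by (simp only: incr_shift incr_height_of)
  from incr_eq_imp[OF this, of i] show "height_of (\<lambda>i. \<omega> (i + a)) i = shift a (- height_of \<omega> a) (height_of \<omega>) i"
    by (simp add: shift_def)
qed

lemma infsum_single_int:
  fixes F :: "int \<Rightarrow> real"
  assumes "\<And>i. i \<noteq> 0 \<Longrightarrow> F i = 0"
  shows "(\<Sum>\<^sub>\<infinity>i. F i) = F 0"
proof -
  have "(\<Sum>\<^sub>\<infinity>i. F i) = (\<Sum>\<^sub>\<infinity>i\<in>{0}. F i)"
    by (rule infsum_cong_neutral) (use assms in auto)
  then show ?thesis by simp
qed

text \<open>Only a brick added or removed at the origin changes \<open>h 0\<close>, so each infinite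
  sum has one nonzero term.\<close>

lemma gen_origin:
  "gen p q (\<lambda>h. \<psi> (h 0)) h = p (incr h 0) (incr h 1) * (\<psi> (h 0 + 1) - \<psi> (h 0))
     + q (incr h 0) (incr h 1) * (\<psi> (h 0 - 1) - \<psi> (h 0))"
  unfolding gen_def by (subst (1 2) infsum_single_int) (simp_all add: add_brick_def remove_brick_def)

lemma cylinder_origin: "cylinder (\<lambda>h. \<psi> (h 0))"
  unfolding cylinder_def by (rule exI[of _ "{0}"]) auto

locale equilibrium = deposition_dynamics +
  fixes \<theta> :: real
  assumes \<theta>: "\<theta> \<in> \<Theta>"
begin

abbreviation site :: "int pmf" where "site \<equiv> site_pmf \<theta>"
abbreviation \<mu> :: "int_seq measure" where "\<mu> \<equiv> iid site"
abbreviation times :: "real measure" where "times \<equiv> restrict_space borel {0..}"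

sublocale \<mu>: prob_space \<mu>
  by (rule prob_space_iid)

lemma \<mu>_prob_algebra: "\<mu> \<in> space (prob_algebra int_seq_space)"
  by (simp add: space_prob_algebra \<mu>.prob_space_axioms)

lemma kernel_joint: "(\<lambda>(t, x). P t x) \<in> times \<Otimes>\<^sub>M int_seq_space \<rightarrow>\<^sub>M prob_algebra int_seq_space"
  using semigroup by (simp add: markov_semigroup_def)

lemma kernel_height:
  "(\<lambda>(t, \<omega>). P t (height_of \<omega>)) \<in> times \<Otimes>\<^sub>M int_seq_space \<rightarrow>\<^sub>M prob_algebra int_seq_space"
proof -
  have "(\<lambda>x. (fst x, height_of (snd x))) \<in> times \<Otimes>\<^sub>M int_seq_space \<rightarrow>\<^sub>M times \<Otimes>\<^sub>M int_seq_space"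
    by (intro measurable_Pair measurable_fst measurable_compose[OF measurable_snd measurable_height_of])
  from measurable_compose[OF this kernel_joint] show ?thesis by (simp add: case_prod_beta')
qed

text \<open>The initial increments are kept beside the heights at time \<open>t\<close>, so that
  covariances between the two times are integrals under one measure. The heights retain the current,
  which increments at time \<open>t\<close> alone would lose.\<close>

definition \<kappa> :: "real \<Rightarrow> int_seq \<Rightarrow> (int_seq \<times> int_seq) measure" where
  "\<kappa> t \<omega> = distr (P t (height_of \<omega>)) pair_space (Pair \<omega>)"

definition joint :: "real \<Rightarrow> (int_seq \<times> int_seq) measure" where
  "joint t = \<mu> \<bind> \<kappa> t"

lemma \<kappa>_measurable: "(\<lambda>(t, \<omega>). \<kappa> t \<omega>) \<in> times \<Otimes>\<^sub>M int_seq_space \<rightarrow>\<^sub>M prob_algebra pair_space"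
proof -
  have "(\<lambda>(x, y). (snd x, y)) \<in> (times \<Otimes>\<^sub>M int_seq_space) \<Otimes>\<^sub>M int_seq_space \<rightarrow>\<^sub>M pair_space"
    unfolding case_prod_beta'
    by (intro measurable_Pair measurable_snd measurable_compose[OF measurable_fst measurable_snd])
  from measurable_distr_prob_space2[OF kernel_height this]
  show ?thesis by (simp add: \<kappa>_def case_prod_beta')
qed

lemma at_time:
  assumes "0 \<le> t" and F: "(\<lambda>(t, \<omega>). F t \<omega>) \<in> times \<Otimes>\<^sub>M int_seq_space \<rightarrow>\<^sub>M N"
  shows "F t \<in> int_seq_space \<rightarrow>\<^sub>M N"
proof -
  have "Pair t \<in> int_seq_space \<rightarrow>\<^sub>M times \<Otimes>\<^sub>M int_seq_space"
    by (rule measurable_Pair1') (use assms(1) in \<open>simp add: space_restrict_space\<close>)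
  from measurable_compose[OF this F] show ?thesis by simp
qed

lemma \<kappa>_kernel: "0 \<le> t \<Longrightarrow> \<kappa> t \<in> \<mu> \<rightarrow>\<^sub>M prob_algebra pair_space"
  unfolding measurable_cong_sets[OF sets_iid refl] by (rule at_time[OF _ \<kappa>_measurable])

lemma P_height_kernel: "0 \<le> t \<Longrightarrow> (\<lambda>\<omega>. P t (height_of \<omega>)) \<in> \<mu> \<rightarrow>\<^sub>M prob_algebra int_seq_space"
  unfolding measurable_cong_sets[OF sets_iid refl] by (rule at_time[OF _ kernel_height])

lemma prob_space_P: "0 \<le> t \<Longrightarrow> prob_space (P t (height_of \<omega>))"
  and sets_P: "0 \<le> t \<Longrightarrow> sets (P t (height_of \<omega>)) = sets int_seq_space"
  using measurable_space[OF P_height_kernel, of t \<omega>] by (simp_all add: space_prob_algebra)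

lemma joint_measurable: "joint \<in> times \<rightarrow>\<^sub>M prob_algebra pair_space"
  unfolding joint_def[abs_def]
  by (rule measurable_bind_prob_space2[OF measurable_const[OF \<mu>_prob_algebra] \<kappa>_measurable])

lemma prob_space_joint: "0 \<le> t \<Longrightarrow> prob_space (joint t)"
  and sets_joint: "0 \<le> t \<Longrightarrow> sets (joint t) = sets pair_space"
  using measurable_space[OF joint_measurable, of t] by (simp_all add: space_prob_algebra space_restrict_space)

lemma measurable_joint: "0 \<le> t \<Longrightarrow> F \<in> pair_space \<rightarrow>\<^sub>M N \<Longrightarrow> F \<in> joint t \<rightarrow>\<^sub>M N"
  unfolding measurable_cong_sets[OF sets_joint refl] .

lemma integral_\<kappa>:
  fixes F :: "int_seq \<times> int_seq \<Rightarrow> real"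
  assumes t: "0 \<le> t" and F: "F \<in> borel_measurable pair_space"
  shows "(\<integral>x. F x \<partial>\<kappa> t \<omega>) = (\<integral>h. F (\<omega>, h) \<partial>P t (height_of \<omega>))"
  unfolding \<kappa>_def
proof (rule integral_distr[OF _ F])
  show "Pair \<omega> \<in> P t (height_of \<omega>) \<rightarrow>\<^sub>M pair_space"
    unfolding measurable_cong_sets[OF sets_P[OF t] refl] by (rule measurable_Pair1') simp
qed

lemma
  fixes F :: "int_seq \<times> int_seq \<Rightarrow> real"
  assumes t: "0 \<le> t" and F: "F \<in> borel_measurable pair_space" and Fi: "integrable (joint t) F"
  shows integral_joint: "(\<integral>x. F x \<partial>joint t) = (\<integral>\<omega>. (\<integral>x. F x \<partial>\<kappa> t \<omega>) \<partial>\<mu>)"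
    and integrable_joint: "integrable \<mu> (\<lambda>\<omega>. \<integral>x. F x \<partial>\<kappa> t \<omega>)"
  using integral_bind_kernel[OF \<kappa>_kernel[OF t] Fi[unfolded joint_def] F]
    integrable_bind_kernel[OF \<kappa>_kernel[OF t] Fi[unfolded joint_def] F]
  by (simp_all add: joint_def)

lemma distr_joint:
  assumes t: "0 \<le> t" and g: "g \<in> pair_space \<rightarrow>\<^sub>M N"
  shows "distr (joint t) N g = \<mu> \<bind> (\<lambda>\<omega>. distr (P t (height_of \<omega>)) N (\<lambda>h. g (\<omega>, h)))"
proof -
  have "distr (joint t) N g = \<mu> \<bind> (\<lambda>\<omega>. distr (\<kappa> t \<omega>) N g)"
    unfolding joint_def
    by (rule distr_bind[OF measurable_prob_algebraD[OF \<kappa>_kernel[OF t]] _ g]) simp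
  also have "\<dots> = \<mu> \<bind> (\<lambda>\<omega>. distr (P t (height_of \<omega>)) N (\<lambda>h. g (\<omega>, h)))"
  proof (rule bind_cong[OF refl])
    fix \<omega>
    have "Pair \<omega> \<in> P t (height_of \<omega>) \<rightarrow>\<^sub>M pair_space"
      unfolding measurable_cong_sets[OF sets_P[OF t] refl] by (rule measurable_Pair1') simp
    then show "distr (\<kappa> t \<omega>) N g = distr (P t (height_of \<omega>)) N (\<lambda>h. g (\<omega>, h))"
      unfolding \<kappa>_def by (subst distr_distr[OF g]) (simp_all add: comp_def)
  qed
  finally show ?thesis .
qed

lemma distr_joint_fst:
  assumes t: "0 \<le> t"
  shows "distr (joint t) int_seq_space fst = \<mu>"
proof -
  have "distr (joint t) int_seq_space fst = \<mu> \<bind> (\<lambda>\<omega>. distr (P t (height_of \<omega>)) int_seq_space (\<lambda>h. fst (\<omega>, h)))"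
    by (rule distr_joint[OF t measurable_fst])
  also have "\<dots> = \<mu> \<bind> return int_seq_space"
  proof (rule bind_cong[OF refl])
    fix \<omega>
    interpret prob_space "P t (height_of \<omega>)" by (rule prob_space_P[OF t])
    show "distr (P t (height_of \<omega>)) int_seq_space (\<lambda>h. fst (\<omega>, h)) = return int_seq_space \<omega>"
      by (simp add: distr_const)
  qed
  also have "\<dots> = \<mu>" by (rule bind_return'') simp
  finally show ?thesis .
qed

lemma measurable_incr_snd: "(\<lambda>x. incr (snd x)) \<in> pair_space \<rightarrow>\<^sub>M int_seq_space"
  by (rule measurable_compose[OF measurable_snd measurable_incr])

lemma distr_joint_incr:
  assumes t: "0 \<le> t"
  shows "distr (joint t) int_seq_space (\<lambda>x. incr (snd x)) = \<mu>"
proof -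
  have "distr (joint t) int_seq_space (\<lambda>x. incr (snd x))
      = \<mu> \<bind> (\<lambda>\<omega>. distr (P t (height_of \<omega>)) int_seq_space (\<lambda>h. incr (snd (\<omega>, h))))"
    by (rule distr_joint[OF t measurable_incr_snd])
  also have "\<dots> = \<mu> \<bind> (\<lambda>\<omega>. distr (P t (height_of \<omega>)) int_seq_space incr)"
    by simp
  also have "\<dots> = distr (\<mu> \<bind> (\<lambda>\<omega>. P t (height_of \<omega>))) int_seq_space incr"
    by (rule distr_bind[symmetric, OF measurable_prob_algebraD[OF P_height_kernel[OF t]] _ measurable_incr]) simp
  also have "\<dots> = \<mu>"
    using stationary[OF t \<theta>] unfolding stat_measure_eq[OF \<theta>] .
  finally show ?thesis .
qed

lemma
  fixes G :: "int_seq \<Rightarrow> real"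
  assumes t: "0 \<le> t" and G: "G \<in> borel_measurable int_seq_space"
  shows integral_initial: "(\<integral>x. G (fst x) \<partial>joint t) = (\<integral>\<omega>. G \<omega> \<partial>\<mu>)"
    and integral_final: "(\<integral>x. G (incr (snd x)) \<partial>joint t) = (\<integral>\<omega>. G \<omega> \<partial>\<mu>)"
    and integrable_initial: "integrable (joint t) (\<lambda>x. G (fst x)) \<longleftrightarrow> integrable \<mu> G"
    and integrable_final: "integrable (joint t) (\<lambda>x. G (incr (snd x))) \<longleftrightarrow> integrable \<mu> G"
proof -
  note m = measurable_joint[OF t measurable_fst] measurable_joint[OF t measurable_incr_snd]
  show "(\<integral>x. G (fst x) \<partial>joint t) = (\<integral>\<omega>. G \<omega> \<partial>\<mu>)"
    using integral_distr[OF m(1) G] unfolding distr_joint_fst[OF t] by simp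
  show "(\<integral>x. G (incr (snd x)) \<partial>joint t) = (\<integral>\<omega>. G \<omega> \<partial>\<mu>)"
    using integral_distr[OF m(2) G] unfolding distr_joint_incr[OF t] by simp
  show "integrable (joint t) (\<lambda>x. G (fst x)) \<longleftrightarrow> integrable \<mu> G"
    using integrable_distr_eq[OF m(1) G] unfolding distr_joint_fst[OF t] by simp
  show "integrable (joint t) (\<lambda>x. G (incr (snd x))) \<longleftrightarrow> integrable \<mu> G"
    using integrable_distr_eq[OF m(2) G] unfolding distr_joint_incr[OF t] by simp
qed

lemma measurable_of_\<mu>: "G \<in> borel_measurable \<mu> \<longleftrightarrow> G \<in> borel_measurable int_seq_space"
  unfolding measurable_cong_sets[OF sets_iid refl] ..

lemma
  assumes t: "0 \<le> t" and G: "square_integrable \<mu> G"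
  shows square_integrable_initial: "square_integrable (joint t) (\<lambda>x. G (fst x))"
    and square_integrable_final: "square_integrable (joint t) (\<lambda>x. G (incr (snd x)))"
proof -
  have Gm: "G \<in> borel_measurable int_seq_space" and Gi: "integrable \<mu> (\<lambda>\<omega>. (G \<omega>)\<^sup>2)"
    using G by (simp_all add: square_integrable_def measurable_of_\<mu>)
  have G2: "(\<lambda>\<omega>. (G \<omega>)\<^sup>2) \<in> borel_measurable int_seq_space" using Gm by (rule borel_measurable_power)
  show "square_integrable (joint t) (\<lambda>x. G (fst x))"
    unfolding square_integrable_def
    using integrable_initial[OF t G2] Gi measurable_joint[OF t measurable_compose[OF measurable_fst Gm]] by simp
  show "square_integrable (joint t) (\<lambda>x. G (incr (snd x)))"
    unfolding square_integrable_def
    using integrable_final[OF t G2] Gi measurable_joint[OF t measurable_compose[OF measurable_incr_snd Gm]] by simp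
qed

text \<open>Besides moving site \<open>a\<close> to the origin, the initial height at
  \<open>a\<close> is subtracted, so that the translated evolution again starts at height zero at
  the origin.\<close>

definition \<sigma> :: "int \<Rightarrow> int_seq \<times> int_seq \<Rightarrow> int_seq \<times> int_seq" where
  "\<sigma> a = (\<lambda>(\<omega>, h). (\<lambda>i. \<omega> (i + a), shift a (- height_of \<omega> a) h))"

lemma measurable_\<sigma>: "\<sigma> a \<in> pair_space \<rightarrow>\<^sub>M pair_space"
proof -
  have 1: "(\<lambda>x. height_of (fst x) a) \<in> pair_space \<rightarrow>\<^sub>M count_space UNIV"
    by (rule measurable_compose[OF measurable_fst measurable_compose[OF measurable_height_of measurable_coordinate]])
  have 2: "(\<lambda>x. snd x i) \<in> pair_space \<rightarrow>\<^sub>M count_space UNIV" for i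
    by (rule measurable_compose[OF measurable_snd measurable_coordinate])
  have "(\<lambda>x i. snd x (i + a) + - height_of (fst x) a) \<in> pair_space \<rightarrow>\<^sub>M int_seq_space"
    by (rule measurable_int_seqI, rule measurable_int2[OF 2 1, where F = "\<lambda>u v. u + - v"]) simp
  then have 3: "(\<lambda>x. shift a (- height_of (fst x) a) (snd x)) \<in> pair_space \<rightarrow>\<^sub>M int_seq_space"
    by (simp only: Defs.shift_def[abs_def])
  have "(\<lambda>x. (\<lambda>i. fst x (i + a), shift a (- height_of (fst x) a) (snd x))) \<in> pair_space \<rightarrow>\<^sub>M pair_space"
    by (rule measurable_Pair[OF measurable_compose[OF measurable_fst measurable_shift_seq] 3])
  then show ?thesis by (simp add: \<sigma>_def case_prod_beta')
qed

lemma AE_T: "AE \<omega> in \<mu>. \<omega> \<in> T"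
  using T_full[OF \<theta>] unfolding stat_measure_eq[OF \<theta>] .

lemma measurable_shift_\<mu>: "(\<lambda>\<omega> i. \<omega> (i + a)) \<in> \<mu> \<rightarrow>\<^sub>M int_seq_space"
  unfolding measurable_cong_sets[OF sets_iid refl] by (rule measurable_shift_seq)

text \<open>The product law is invariant under translation and the kernel commutes with it by
  \<open>homogeneous\<close>. That hypothesis speaks of tempered heights only, so the kernels agree
  almost surely, where both the configuration and its translate lie in \<open>T\<close>.\<close>

lemma distr_joint_\<sigma>:
  assumes t: "0 \<le> t"
  shows "distr (joint t) pair_space (\<sigma> a) = joint t"
proof -
  have shT: "AE \<omega> in \<mu>. (\<lambda>i. \<omega> (i + a)) \<in> T"
  proof -
    have "AE \<omega> in distr \<mu> int_seq_space (\<lambda>\<omega> i. \<omega> (i + a)). \<omega> \<in> T"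
      unfolding distr_iid_shift by (rule AE_T)
    then show ?thesis
      by (rule AE_distrD[OF measurable_shift_\<mu>])
  qed
  have \<kappa>S: "\<kappa> t \<in> int_seq_space \<rightarrow>\<^sub>M subprob_algebra pair_space"
    using measurable_prob_algebraD[OF \<kappa>_kernel[OF t]] unfolding measurable_cong_sets[OF sets_iid refl] .
  have "joint t = distr \<mu> int_seq_space (\<lambda>\<omega> i. \<omega> (i + a)) \<bind> \<kappa> t"
    unfolding distr_iid_shift joint_def ..
  also have "\<dots> = \<mu> \<bind> (\<lambda>\<omega>. \<kappa> t (\<lambda>i. \<omega> (i + a)))"
    by (rule bind_distr[OF measurable_shift_\<mu> \<kappa>S]) simp
  also have "\<dots> = \<mu> \<bind> (\<lambda>\<omega>. distr (\<kappa> t \<omega>) pair_space (\<sigma> a))"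
  proof (rule bind_cong_AE[OF refl])
    show "(\<lambda>\<omega>. \<kappa> t (\<lambda>i. \<omega> (i + a))) \<in> \<mu> \<rightarrow>\<^sub>M subprob_algebra pair_space"
      by (rule measurable_compose[OF measurable_shift_\<mu> \<kappa>S])
    show "(\<lambda>\<omega>. distr (\<kappa> t \<omega>) pair_space (\<sigma> a)) \<in> \<mu> \<rightarrow>\<^sub>M subprob_algebra pair_space"
      by (rule measurable_compose[OF measurable_prob_algebraD[OF \<kappa>_kernel[OF t]] measurable_distr[OF measurable_\<sigma>]])
    show "AE \<omega> in \<mu>. \<kappa> t (\<lambda>i. \<omega> (i + a)) = distr (\<kappa> t \<omega>) pair_space (\<sigma> a)"
      using AE_T shT
    proof eventually_elim
      case (elim \<omega>)
      let ?h = "height_of \<omega>" and ?\<omega>' = "\<lambda>i. \<omega> (i + a)"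
      have m: "Pair \<omega> \<in> P t ?h \<rightarrow>\<^sub>M pair_space"
        unfolding measurable_cong_sets[OF sets_P[OF t] refl] by (rule measurable_Pair1') simp
      have m': "Pair ?\<omega>' \<in> int_seq_space \<rightarrow>\<^sub>M pair_space" by (rule measurable_Pair1') simp
      have ms: "shift a c \<in> P t ?h \<rightarrow>\<^sub>M int_seq_space" for c
        unfolding measurable_cong_sets[OF sets_P[OF t] refl] by (rule measurable_shift)
      have "P t (height_of ?\<omega>') = distr (P t ?h) int_seq_space (shift a (- ?h a))"
        unfolding height_of_shift using elim
        by (intro homogeneous t) (simp_all add: regular_heights_def incr_height_of incr_shift)
      then have "\<kappa> t ?\<omega>' = distr (P t ?h) pair_space (\<lambda>h. (?\<omega>', shift a (- ?h a) h))"
        unfolding \<kappa>_def by (simp only: distr_distr[OF m' ms] comp_def)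
      also have "\<dots> = distr (\<kappa> t \<omega>) pair_space (\<sigma> a)"
        unfolding \<kappa>_def distr_distr[OF measurable_\<sigma> m] by (simp add: comp_def \<sigma>_def)
      finally show ?case .
    qed
  qed
  also have "\<dots> = distr (joint t) pair_space (\<sigma> a)"
    unfolding joint_def
    by (rule distr_bind[symmetric, OF measurable_prob_algebraD[OF \<kappa>_kernel[OF t]] _ measurable_\<sigma>]) simp
  finally show ?thesis ..
qed

lemma
  fixes F :: "int_seq \<times> int_seq \<Rightarrow> real"
  assumes t: "0 \<le> t" and F: "F \<in> borel_measurable pair_space"
  shows integral_\<sigma>: "(\<integral>x. F (\<sigma> a x) \<partial>joint t) = (\<integral>x. F x \<partial>joint t)"
    and integrable_\<sigma>: "integrable (joint t) (\<lambda>x. F (\<sigma> a x)) \<longleftrightarrow> integrable (joint t) F"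
  using integral_distr[OF measurable_joint[OF t measurable_\<sigma>] F, of a]
    integrable_distr_eq[OF measurable_joint[OF t measurable_\<sigma>] F, of a]
  unfolding distr_joint_\<sigma>[OF t] by simp_all

end

section \<open>Clamped heights and finite time windows\<close>

lemma square_integrable_dominated:
  assumes f: "square_integrable M f" and g: "g \<in> borel_measurable M" and le: "\<And>x. \<bar>g x\<bar> \<le> \<bar>f x\<bar>"
  shows "square_integrable M g" and "(\<integral>x. (g x)\<^sup>2 \<partial>M) \<le> (\<integral>x. (f x)\<^sup>2 \<partial>M)"
proof -
  have le2: "(g x)\<^sup>2 \<le> (f x)\<^sup>2" for x using le[of x] by (simp add: abs_le_square_iff)
  have f2: "integrable M (\<lambda>x. (f x)\<^sup>2)" using f by (simp add: square_integrable_def)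
  have g2: "integrable M (\<lambda>x. (g x)\<^sup>2)"
    by (rule Bochner_Integration.integrable_bound[OF f2]) (use g le2 in auto)
  then show "square_integrable M g" using g by (simp add: square_integrable_def)
  show "(\<integral>x. (g x)\<^sup>2 \<partial>M) \<le> (\<integral>x. (f x)\<^sup>2 \<partial>M)"
    by (rule integral_mono[OF g2 f2 le2])
qed

text \<open>Boundedness admits the clamped height to the forward equation, steps of size at most one
  bound the generator uniformly in \<open>N\<close>, and growth of the absolute value in
  \<open>N\<close> permits monotone convergence.\<close>

definition clamp_int :: "nat \<Rightarrow> int \<Rightarrow> real" where
  "clamp_int N z = of_int (max (- int N) (min (int N) z))"

lemma abs_clamp_int_le: "\<bar>clamp_int N z\<bar> \<le> real N"
proof -
  have "max (- int N) (min (int N) z) \<le> int N" "- int N \<le> max (- int N) (min (int N) z)" by auto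
  then have "clamp_int N z \<le> of_int (int N)" "of_int (- int N) \<le> clamp_int N z"
    unfolding clamp_int_def by (simp_all only: of_int_le_iff)
  then show ?thesis by simp
qed

lemma clamp_int_eq: "nat \<bar>z\<bar> \<le> N \<Longrightarrow> clamp_int N z = of_int z"
proof -
  assume "nat \<bar>z\<bar> \<le> N"
  then have "max (- int N) (min (int N) z) = z" by linarith
  then show ?thesis by (simp only: clamp_int_def)
qed

lemma abs_clamp_int_le_abs: "\<bar>clamp_int N z\<bar> \<le> \<bar>of_int z\<bar>"
proof -
  have "\<bar>max (- int N) (min (int N) z)\<bar> \<le> \<bar>z\<bar>" by auto
  then have "of_int \<bar>max (- int N) (min (int N) z)\<bar> \<le> (of_int \<bar>z\<bar> :: real)" by (simp only: of_int_le_iff)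
  then show ?thesis by (simp add: clamp_int_def)
qed

lemma clamp_int_step: "\<bar>clamp_int N (z + 1) - clamp_int N z\<bar> \<le> 1"
proof -
  have "\<bar>max (- int N) (min (int N) (z + 1)) - max (- int N) (min (int N) z)\<bar> \<le> 1" by auto
  then have "of_int \<bar>max (- int N) (min (int N) (z + 1)) - max (- int N) (min (int N) z)\<bar> \<le> (of_int 1 :: real)"
    by (simp only: of_int_le_iff)
  then show ?thesis by (simp add: clamp_int_def)
qed

lemma clamp_int_tendsto: "(\<lambda>N. clamp_int N z) \<longlonglongrightarrow> of_int z"
  by (rule tendsto_eventually) (use eventually_ge_at_top[of "nat \<bar>z\<bar>"] in eventually_elim, rule clamp_int_eq)

lemma clamp_int_mono: "M \<le> N \<Longrightarrow> \<bar>clamp_int M z\<bar> \<le> \<bar>clamp_int N z\<bar>"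
proof -
  assume "M \<le> N"
  then have "\<bar>max (- int M) (min (int M) z)\<bar> \<le> \<bar>max (- int N) (min (int N) z)\<bar>" by auto
  then have "of_int \<bar>max (- int M) (min (int M) z)\<bar> \<le> (of_int \<bar>max (- int N) (min (int N) z)\<bar> :: real)"
    by (simp only: of_int_le_iff)
  then show ?thesis by (simp add: clamp_int_def)
qed

lemma abs_step_back: "(\<And>z :: int. \<bar>\<psi> (z + 1) - \<psi> z\<bar> \<le> (C :: real)) \<Longrightarrow> \<bar>\<psi> (z - 1) - \<psi> z\<bar> \<le> C"
  by (metis abs_minus_commute diff_add_cancel)

abbreviation window :: "real \<Rightarrow> real measure" where "window t \<equiv> restrict_space lborel {0..t}"

lemma finite_window: "finite_measure (window t)"
  by (intro finite_measureI) (simp add: emeasure_restrict_space space_restrict_space emeasure_lborel_Icc_eq)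

lemma integral_window_const: "0 \<le> t \<Longrightarrow> (\<integral>s. c \<partial>window t) = t * (c :: real)"
  by (simp add: measure_restrict_space space_restrict_space)

lemma space_window [simp]: "space (window t) = {0..t}"
  by (simp add: space_restrict_space)

lemma set_integral_window:
  fixes F :: "real \<Rightarrow> real"
  shows "(LINT s:{0..t}|lborel. F s) = (\<integral>s. F s \<partial>window t)"
  unfolding set_lebesgue_integral_def by (subst integral_restrict_space) auto

lemma measurable_window: "g \<in> restrict_space borel {0..} \<rightarrow>\<^sub>M N \<Longrightarrow> g \<in> window t \<rightarrow>\<^sub>M N"
proof -
  assume "g \<in> restrict_space borel {0..} \<rightarrow>\<^sub>M N"
  then have "g \<in> restrict_space borel {0..t} \<rightarrow>\<^sub>M N"
    by (rule measurable_restrict_mono) auto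
  moreover have "sets (window t) = sets (restrict_space borel {0..t})"
    by (rule sets_restrict_space_cong) simp
  ultimately show ?thesis by (simp cong: measurable_cong_sets)
qed

section \<open>The forward equation averaged over the stationary law\<close>

context equilibrium
begin

text \<open>The common bound for the generator and for the net rate. Absolute values are taken
  because the rates have a sign only on \<open>I\<close>, whereas configurations here range over all
  integer sequences.\<close>

definition rate_sum :: "int_seq \<Rightarrow> real" where "rate_sum \<omega> = \<bar>p (\<omega> 0) (\<omega> 1)\<bar> + \<bar>q (\<omega> 0) (\<omega> 1)\<bar>"

lemma measurable_two_sites: "(\<lambda>\<omega>. F (\<omega> i) (\<omega> j) :: real) \<in> borel_measurable int_seq_space"
  by (rule measurable_int2[OF measurable_coordinate measurable_coordinate]) simp

lemma square_integrable_two_sites: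
  assumes "i \<noteq> j" and F: "square_integrable (measure_pmf (pair_pmf site site)) (\<lambda>(y, z). F y z)"
  shows "square_integrable \<mu> (\<lambda>\<omega>. F (\<omega> i) (\<omega> j))"
  using F integrable_iid_pair[OF assms(1), of site "\<lambda>x. (case x of (y, z) \<Rightarrow> F y z)\<^sup>2"]
    measurable_two_sites[of F i j]
  unfolding square_integrable_def measurable_of_\<mu> by simp

lemma square_integrable_rate_sum: "square_integrable \<mu> rate_sum"
proof -
  note pq = square_integrable_two_sites[OF _ integrable_rates_pair(1)[OF \<theta>], of 0 1]
    square_integrable_two_sites[OF _ integrable_rates_pair(2)[OF \<theta>], of 0 1]
  have "square_integrable \<mu> (\<lambda>\<omega>. \<bar>p (\<omega> 0) (\<omega> 1)\<bar> + \<bar>q (\<omega> 0) (\<omega> 1)\<bar>)"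
    by (intro square_integrable_add square_integrable_abs pq) simp_all
  then show ?thesis unfolding rate_sum_def[abs_def] .
qed

lemma measurable_gen_origin: "gen p q (\<lambda>h. \<psi> (h 0)) \<in> borel_measurable int_seq_space"
proof -
  have 1: "(\<lambda>h. F (incr h 0) (incr h 1) :: real) \<in> borel_measurable int_seq_space" for F
    by (rule measurable_compose[OF measurable_incr measurable_two_sites])
  have 2: "(\<lambda>h. \<psi> (h 0 + 1) - \<psi> (h 0)) \<in> borel_measurable int_seq_space"
    by (rule measurable_compose[OF measurable_coordinate, where g = "\<lambda>z. \<psi> (z + 1) - \<psi> z"]) simp
  have 3: "(\<lambda>h. \<psi> (h 0 - 1) - \<psi> (h 0)) \<in> borel_measurable int_seq_space"
    by (rule measurable_compose[OF measurable_coordinate, where g = "\<lambda>z. \<psi> (z - 1) - \<psi> z"]) simp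
  have "(\<lambda>h. p (incr h 0) (incr h 1) * (\<psi> (h 0 + 1) - \<psi> (h 0)) + q (incr h 0) (incr h 1) * (\<psi> (h 0 - 1) - \<psi> (h 0)))
      \<in> borel_measurable int_seq_space"
    by (intro borel_measurable_add borel_measurable_times 1 2 3)
  then show ?thesis by (simp only: gen_origin[symmetric])
qed

lemma abs_gen_origin_le:
  assumes "\<And>z. \<bar>\<psi> (z + 1) - \<psi> z\<bar> \<le> C"
  shows "\<bar>gen p q (\<lambda>h. \<psi> (h 0)) h\<bar> \<le> C * rate_sum (incr h)"
proof -
  have "\<bar>gen p q (\<lambda>h. \<psi> (h 0)) h\<bar> \<le> \<bar>p (incr h 0) (incr h 1)\<bar> * \<bar>\<psi> (h 0 + 1) - \<psi> (h 0)\<bar>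
      + \<bar>q (incr h 0) (incr h 1)\<bar> * \<bar>\<psi> (h 0 - 1) - \<psi> (h 0)\<bar>"
    unfolding gen_origin abs_mult[symmetric] by (rule abs_triangle_ineq)
  also have "\<dots> \<le> \<bar>p (incr h 0) (incr h 1)\<bar> * C + \<bar>q (incr h 0) (incr h 1)\<bar> * C"
    using assms abs_step_back[of \<psi> C, OF assms] by (intro add_mono mult_left_mono) auto
  finally show ?thesis by (simp add: rate_sum_def algebra_simps)
qed

text \<open>By stationarity the rates at time \<open>t\<close> have the moments they have initially.
  The bound sees \<open>\<psi>\<close> only through its step size \<open>C\<close>, so it is the
  same for all clamping levels and all times.\<close>

lemma square_integrable_gen:
  assumes t: "0 \<le> t" and C: "\<And>z. \<bar>\<psi> (z + 1) - \<psi> z\<bar> \<le> C"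
  shows "square_integrable (joint t) (\<lambda>x. gen p q (\<lambda>h. \<psi> (h 0)) (snd x))"
    and "(\<integral>x. (gen p q (\<lambda>h. \<psi> (h 0)) (snd x))\<^sup>2 \<partial>joint t) \<le> C\<^sup>2 * (\<integral>\<omega>. (rate_sum \<omega>)\<^sup>2 \<partial>\<mu>)"
proof -
  have sq: "square_integrable (joint t) (\<lambda>x. C * rate_sum (incr (snd x)))"
    by (rule square_integrable_cmult[OF square_integrable_final[OF t square_integrable_rate_sum]])
  have m: "(\<lambda>x. gen p q (\<lambda>h. \<psi> (h 0)) (snd x)) \<in> borel_measurable (joint t)"
    by (rule measurable_joint[OF t measurable_compose[OF measurable_snd measurable_gen_origin]])
  have le: "\<bar>gen p q (\<lambda>h. \<psi> (h 0)) (snd x)\<bar> \<le> \<bar>C * rate_sum (incr (snd x))\<bar>" for x :: "int_seq \<times> int_seq"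
    using abs_gen_origin_le[of \<psi> C, OF C] by (meson abs_ge_self order_trans)
  note d = square_integrable_dominated[OF sq m le]
  show "square_integrable (joint t) (\<lambda>x. gen p q (\<lambda>h. \<psi> (h 0)) (snd x))" by (rule d(1))
  have Rm: "(\<lambda>\<omega>. (rate_sum \<omega>)\<^sup>2) \<in> borel_measurable int_seq_space"
    using square_integrable_rate_sum unfolding square_integrable_def measurable_of_\<mu>
    by (intro borel_measurable_power) blast
  have "(\<integral>x. (C * rate_sum (incr (snd x)))\<^sup>2 \<partial>joint t) = C\<^sup>2 * (\<integral>x. (rate_sum (incr (snd x)))\<^sup>2 \<partial>joint t)"
    by (simp add: power_mult_distrib)
  also have "\<dots> = C\<^sup>2 * (\<integral>\<omega>. (rate_sum \<omega>)\<^sup>2 \<partial>\<mu>)"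
    by (simp only: integral_final[OF t Rm])
  finally show "(\<integral>x. (gen p q (\<lambda>h. \<psi> (h 0)) (snd x))\<^sup>2 \<partial>joint t) \<le> C\<^sup>2 * (\<integral>\<omega>. (rate_sum \<omega>)\<^sup>2 \<partial>\<mu>)"
    using d(2) by simp
qed

lemma joint_integral_measurable:
  fixes F :: "int_seq \<times> int_seq \<Rightarrow> real"
  assumes "F \<in> borel_measurable pair_space"
  shows "(\<lambda>s. \<integral>x. F x \<partial>joint s) \<in> borel_measurable (window t)"
  by (rule measurable_window, rule measurable_compose[OF measurable_prob_algebraD[OF joint_measurable]
      integral_measurable_subprob_algebra[OF assms]])

text \<open>The forward equation from each starting configuration is multiplied by \<open>W\<close>
  of that configuration and integrated. Exchanging time and configuration is legitimate because the
  absolute moment of \<open>L\<close> is bounded uniformly in time.\<close>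

lemma
  fixes \<psi> :: "int \<Rightarrow> real" and W :: "int_seq \<Rightarrow> real"
  assumes t: "0 \<le> t" and W: "square_integrable \<mu> W"
    and B: "\<And>z. \<bar>\<psi> z\<bar> \<le> B" and C: "\<And>z. \<bar>\<psi> (z + 1) - \<psi> z\<bar> \<le> C"
  defines "L \<equiv> \<lambda>x. W (fst x) * gen p q (\<lambda>h. \<psi> (h 0)) (snd x)"
  shows averaged_forward: "(\<integral>x. W (fst x) * \<psi> (snd x 0) \<partial>joint t)
      = \<psi> 0 * (\<integral>\<omega>. W \<omega> \<partial>\<mu>) + (\<integral>s. (\<integral>x. L x \<partial>joint s) \<partial>window t)"
    and averaged_forward_integrable: "integrable (window t) (\<lambda>s. \<integral>x. L x \<partial>joint s)"
proof -
  let ?\<phi> = "\<lambda>h :: int_seq. \<psi> (h 0)"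
  interpret \<Lambda>: finite_measure "window t" by (rule finite_window)
  interpret D: pair_sigma_finite "window t" \<mu> ..
  note gsq = square_integrable_gen[where \<psi> = \<psi> and C = C, OF _ C]
  define b where "b = ((\<integral>\<omega>. (W \<omega>)\<^sup>2 \<partial>\<mu>) + C\<^sup>2 * (\<integral>\<omega>. (rate_sum \<omega>)\<^sup>2 \<partial>\<mu>)) / 2"
  have Wm: "W \<in> borel_measurable int_seq_space" using W by (simp add: square_integrable_def measurable_of_\<mu>)
  have W2m: "(\<lambda>\<omega>. (W \<omega>)\<^sup>2) \<in> borel_measurable int_seq_space" using Wm by (rule borel_measurable_power)
  have Lm: "L \<in> borel_measurable pair_space" unfolding L_def
    by (intro borel_measurable_times measurable_compose[OF measurable_fst Wm]
        measurable_compose[OF measurable_snd measurable_gen_origin])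
  have absLm: "(\<lambda>x. \<bar>L x\<bar>) \<in> borel_measurable pair_space" using Lm by (rule borel_measurable_abs)
  have Li: "integrable (joint s) L" if "0 \<le> s" for s
    unfolding L_def
    by (rule square_integrable_integrable_mult[OF square_integrable_initial[OF that W] gsq(1)[OF that]])
  have Lb: "(\<integral>x. \<bar>L x\<bar> \<partial>joint s) \<le> b" if "0 \<le> s" for s
  proof -
    note sq = square_integrable_abs[OF square_integrable_initial[OF that W]]
      square_integrable_abs[OF gsq(1)[OF that]]
    have "(\<integral>x. \<bar>L x\<bar> \<partial>joint s) \<le> \<bar>\<integral>x. \<bar>W (fst x)\<bar> * \<bar>gen p q ?\<phi> (snd x)\<bar> \<partial>joint s\<bar>"
      by (simp add: L_def abs_mult)
    also have "\<dots> \<le> ((\<integral>x. (W (fst x))\<^sup>2 \<partial>joint s) + (\<integral>x. (gen p q ?\<phi> (snd x))\<^sup>2 \<partial>joint s)) / 2"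
      using square_integrable_mult_bound[OF sq] by simp
    also have "\<dots> \<le> b"
      unfolding b_def using integral_initial[OF that W2m] gsq(2)[OF that] by simp
    finally show ?thesis .
  qed
  define F where "F s \<omega> = (\<integral>x. L x \<partial>\<kappa> s \<omega>)" for s \<omega>
  have F_eq: "F s \<omega> = W \<omega> * (\<integral>h. gen p q ?\<phi> h \<partial>P s (height_of \<omega>))" if "0 \<le> s" for s \<omega>
    unfolding F_def integral_\<kappa>[OF that Lm] by (simp add: L_def)
  \<comment> \<open>Fubini requires measurability in time and configuration together, which goes
    back to the joint measurability of the semigroup.\<close>
  have Fm: "(\<lambda>(s, \<omega>). F s \<omega>) \<in> borel_measurable (window t \<Otimes>\<^sub>M \<mu>)"
  proof -
    have "(\<lambda>x. x) \<in> window t \<rightarrow>\<^sub>M times" by (rule measurable_window) simp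
    then have "(\<lambda>x. (fst x, snd x)) \<in> window t \<Otimes>\<^sub>M int_seq_space \<rightarrow>\<^sub>M times \<Otimes>\<^sub>M int_seq_space"
      by (intro measurable_Pair measurable_snd measurable_compose[OF measurable_fst])
    from measurable_compose[OF this measurable_compose[OF measurable_prob_algebraD[OF \<kappa>_measurable]
      integral_measurable_subprob_algebra[OF Lm]]]
    have "(\<lambda>(s, \<omega>). F s \<omega>) \<in> borel_measurable (window t \<Otimes>\<^sub>M int_seq_space)"
      by (simp add: F_def case_prod_beta')
    moreover have "sets (window t \<Otimes>\<^sub>M \<mu>) = sets (window t \<Otimes>\<^sub>M int_seq_space)"
      by (rule sets_pair_measure_cong) simp_all
    ultimately show ?thesis by (simp cong: measurable_cong_sets)
  qed
  have F1: "integrable \<mu> (F s)" and F2: "(\<integral>\<omega>. F s \<omega> \<partial>\<mu>) = (\<integral>x. L x \<partial>joint s)"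
    and F3: "(\<integral>\<omega>. norm (F s \<omega>) \<partial>\<mu>) \<le> b" if s: "0 \<le> s" for s
  proof -
    show F1: "integrable \<mu> (F s)" unfolding F_def[abs_def] by (rule integrable_joint[OF s Lm Li[OF s]])
    show "(\<integral>\<omega>. F s \<omega> \<partial>\<mu>) = (\<integral>x. L x \<partial>joint s)"
      unfolding F_def by (rule integral_joint[OF s Lm Li[OF s], symmetric])
    have aL: "integrable (joint s) (\<lambda>x. \<bar>L x\<bar>)" using Li[OF s] by (rule integrable_abs)
    have "(\<integral>\<omega>. norm (F s \<omega>) \<partial>\<mu>) \<le> (\<integral>\<omega>. (\<integral>x. \<bar>L x\<bar> \<partial>\<kappa> s \<omega>) \<partial>\<mu>)"
    proof (rule integral_mono)
      show "integrable \<mu> (\<lambda>\<omega>. norm (F s \<omega>))" using F1 by (rule integrable_norm)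
      show "integrable \<mu> (\<lambda>\<omega>. \<integral>x. \<bar>L x\<bar> \<partial>\<kappa> s \<omega>)" by (rule integrable_joint[OF s absLm aL])
      show "norm (F s \<omega>) \<le> (\<integral>x. \<bar>L x\<bar> \<partial>\<kappa> s \<omega>)" for \<omega>
        unfolding F_def real_norm_def by (rule integral_abs_bound)
    qed
    also have "\<dots> = (\<integral>x. \<bar>L x\<bar> \<partial>joint s)" by (rule integral_joint[OF s absLm aL, symmetric])
    also have "\<dots> \<le> b" by (rule Lb[OF s])
    finally show "(\<integral>\<omega>. norm (F s \<omega>) \<partial>\<mu>) \<le> b" .
  qed
  have pair: "integrable (window t \<Otimes>\<^sub>M \<mu>) (\<lambda>(s, \<omega>). F s \<omega>)"
  proof (rule D.Fubini_integrable[OF Fm])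
    show "integrable (window t) (\<lambda>s. \<integral>\<omega>. norm (case (s, \<omega>) of (s, \<omega>) \<Rightarrow> F s \<omega>) \<partial>\<mu>)"
    proof (rule \<Lambda>.integrable_const_bound[where B = b])
      have "0 \<le> (\<integral>\<omega>. norm (F s \<omega>) \<partial>\<mu>)" for s by simp
      then show "AE s in window t. norm (\<integral>\<omega>. norm (case (s, \<omega>) of (s, \<omega>) \<Rightarrow> F s \<omega>) \<partial>\<mu>) \<le> b"
        using F3 by (intro AE_I2) simp
      have "(\<lambda>(s, \<omega>). norm (F s \<omega>)) \<in> borel_measurable (window t \<Otimes>\<^sub>M \<mu>)"
        using borel_measurable_abs[OF Fm] by (simp add: case_prod_beta')
      from \<mu>.borel_measurable_lebesgue_integral[OF this]
      show "(\<lambda>s. \<integral>\<omega>. norm (case (s, \<omega>) of (s, \<omega>) \<Rightarrow> F s \<omega>) \<partial>\<mu>) \<in> borel_measurable (window t)"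
        by simp
    qed
    show "AE s in window t. integrable \<mu> (\<lambda>\<omega>. case (s, \<omega>) of (s, \<omega>) \<Rightarrow> F s \<omega>)"
      using F1 by (intro AE_I2) simp
  qed
  have sum_eq: "(\<integral>\<omega>. (\<integral>s. F s \<omega> \<partial>window t) \<partial>\<mu>) = (\<integral>s. (\<integral>x. L x \<partial>joint s) \<partial>window t)"
  proof -
    have "(\<integral>\<omega>. (\<integral>s. F s \<omega> \<partial>window t) \<partial>\<mu>) = (\<integral>s. (\<integral>\<omega>. F s \<omega> \<partial>\<mu>) \<partial>window t)"
      by (rule D.Fubini_integral[OF pair])
    also have "\<dots> = (\<integral>s. (\<integral>x. L x \<partial>joint s) \<partial>window t)"
      by (rule Bochner_Integration.integral_cong[OF refl]) (simp add: F2)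
    finally show ?thesis .
  qed
  have "integrable (window t) (\<lambda>s. \<integral>\<omega>. F s \<omega> \<partial>\<mu>)"
    using D.integrable_fst[OF pair] by simp
  then show "integrable (window t) (\<lambda>s. \<integral>x. L x \<partial>joint s)"
    by (rule Bochner_Integration.integrable_cong[OF refl, THEN iffD1, rotated]) (simp add: F2)
  have inner: "integrable \<mu> (\<lambda>\<omega>. \<integral>s. F s \<omega> \<partial>window t)"
    using D.integrable_snd[OF pair] by simp
  \<comment> \<open>All starting heights vanish at the origin, so the initial value is the constant
    \<open>\<psi> 0\<close>.\<close>
  have fwd: "(\<integral>h. \<psi> (h 0) \<partial>P t (height_of \<omega>)) = \<psi> 0 + (\<integral>s. (\<integral>h. gen p q ?\<phi> h \<partial>P s (height_of \<omega>)) \<partial>window t)"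
    if "\<omega> \<in> T" for \<omega>
  proof -
    have "bounded (range ?\<phi>)" using B by (intro boundedI[where B = B]) auto
    from generator[OF cylinder_origin this]
    have "\<forall>x\<in>regular_heights T. \<forall>t\<ge>0. (\<integral>y. ?\<phi> y \<partial>P t x) = ?\<phi> x + (LINT s:{0..t}|lborel. (\<integral>y. gen p q ?\<phi> y \<partial>P s x))"
      unfolding forward_equation_def by blast
    moreover have "height_of \<omega> \<in> regular_heights T" using that by (simp add: regular_heights_def incr_height_of)
    ultimately show ?thesis using t unfolding set_integral_window by fastforce
  qed
  have \<psi>m: "(\<lambda>x. \<psi> (snd x 0)) \<in> borel_measurable pair_space"
    by (rule measurable_compose[OF measurable_snd measurable_compose[OF measurable_coordinate]]) simp
  have W\<psi>: "(\<lambda>x. W (fst x) * \<psi> (snd x 0)) \<in> borel_measurable pair_space"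
    by (intro borel_measurable_times measurable_compose[OF measurable_fst Wm] \<psi>m)
  interpret J: prob_space "joint t" by (rule prob_space_joint[OF t])
  have W\<psi>i: "integrable (joint t) (\<lambda>x. W (fst x) * \<psi> (snd x 0))"
    by (rule square_integrable_integrable_mult[OF square_integrable_initial[OF t W]
        J.square_integrable_bounded[OF measurable_joint[OF t \<psi>m] B]])
  have "(\<integral>x. W (fst x) * \<psi> (snd x 0) \<partial>joint t) = (\<integral>\<omega>. W \<omega> * (\<integral>h. \<psi> (h 0) \<partial>P t (height_of \<omega>)) \<partial>\<mu>)"
    unfolding integral_joint[OF t W\<psi> W\<psi>i] integral_\<kappa>[OF t W\<psi>] by simp
  also have "\<dots> = (\<integral>\<omega>. \<psi> 0 * W \<omega> + (\<integral>s. F s \<omega> \<partial>window t) \<partial>\<mu>)"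
  proof (rule integral_cong_AE)
    have "(\<lambda>\<omega>. \<integral>x. W (fst x) * \<psi> (snd x 0) \<partial>\<kappa> t \<omega>) \<in> borel_measurable \<mu>"
      using integrable_joint[OF t W\<psi> W\<psi>i] by (rule borel_measurable_integrable)
    then show "(\<lambda>\<omega>. W \<omega> * (\<integral>h. \<psi> (h 0) \<partial>P t (height_of \<omega>))) \<in> borel_measurable \<mu>"
      unfolding integral_\<kappa>[OF t W\<psi>] by simp
    show "(\<lambda>\<omega>. \<psi> 0 * W \<omega> + (\<integral>s. F s \<omega> \<partial>window t)) \<in> borel_measurable \<mu>"
      using W inner by (auto simp: square_integrable_def)
    show "AE \<omega> in \<mu>. W \<omega> * (\<integral>h. \<psi> (h 0) \<partial>P t (height_of \<omega>)) = \<psi> 0 * W \<omega> + (\<integral>s. F s \<omega> \<partial>window t)"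
      using AE_T
    proof eventually_elim
      case (elim \<omega>)
      have "(\<integral>s. F s \<omega> \<partial>window t) = (\<integral>s. W \<omega> * (\<integral>h. gen p q ?\<phi> h \<partial>P s (height_of \<omega>)) \<partial>window t)"
        by (rule Bochner_Integration.integral_cong[OF refl]) (simp add: F_eq)
      then show ?case unfolding fwd[OF elim] by (simp add: algebra_simps)
    qed
  qed
  also have "\<dots> = \<psi> 0 * (\<integral>\<omega>. W \<omega> \<partial>\<mu>) + (\<integral>\<omega>. (\<integral>s. F s \<omega> \<partial>window t) \<partial>\<mu>)"
    using \<mu>.square_integrable_imp_integrable[OF W] inner by simp
  finally show "(\<integral>x. W (fst x) * \<psi> (snd x 0) \<partial>joint t)
      = \<psi> 0 * (\<integral>\<omega>. W \<omega> \<partial>\<mu>) + (\<integral>s. (\<integral>x. L x \<partial>joint s) \<partial>window t)"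
    by (simp only: sum_eq)
qed

end

section \<open>Second moment of the current through the origin\<close>

context equilibrium
begin

text \<open>Twice \<open>t * A\<close>, where \<open>A\<close> is the sum in parentheses: the bound
  on \<open>m\<close> contained in \<open>m \<le> t * A + m / 2\<close>, with \<open>m\<close> the
  supremum over \<open>[0, t]\<close> of the clamped second moment.\<close>

definition height_bound :: "real \<Rightarrow> real" where
  "height_bound t = 2 * t * (2 * t * (\<integral>\<omega>. (rate_sum \<omega>)\<^sup>2 \<partial>\<mu>) + (\<integral>\<omega>. rate_sum \<omega> \<partial>\<mu>))"

lemma measurable_rate_sum: "rate_sum \<in> borel_measurable int_seq_space"
  using square_integrable_rate_sum by (simp add: square_integrable_def measurable_of_\<mu>)

lemma integrable_rate_sum: "integrable \<mu> rate_sum"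
  by (rule \<mu>.square_integrable_imp_integrable[OF square_integrable_rate_sum])

lemma clamp_square_step: "\<bar>(clamp_int N (z + 1))\<^sup>2 - (clamp_int N z)\<^sup>2\<bar> \<le> 2 * \<bar>clamp_int N z\<bar> + 1"
  and clamp_square_step_back: "\<bar>(clamp_int N (z - 1))\<^sup>2 - (clamp_int N z)\<^sup>2\<bar> \<le> 2 * \<bar>clamp_int N z\<bar> + 1"
proof -
  have *: "\<bar>a\<^sup>2 - b\<^sup>2\<bar> \<le> 2 * \<bar>b\<bar> + 1" if "\<bar>a - b\<bar> \<le> 1" for a b :: real
  proof -
    have "\<bar>a + b\<bar> \<le> 2 * \<bar>b\<bar> + 1" using that by linarith
    then have "\<bar>a - b\<bar> * \<bar>a + b\<bar> \<le> 1 * (2 * \<bar>b\<bar> + 1)" using that by (intro mult_mono) auto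
    moreover have "\<bar>a\<^sup>2 - b\<^sup>2\<bar> = \<bar>a - b\<bar> * \<bar>a + b\<bar>"
      by (simp add: power2_eq_square square_diff_square_factored abs_mult mult.commute)
    ultimately show ?thesis by simp
  qed
  show "\<bar>(clamp_int N (z + 1))\<^sup>2 - (clamp_int N z)\<^sup>2\<bar> \<le> 2 * \<bar>clamp_int N z\<bar> + 1"
    by (rule *[OF clamp_int_step])
  show "\<bar>(clamp_int N (z - 1))\<^sup>2 - (clamp_int N z)\<^sup>2\<bar> \<le> 2 * \<bar>clamp_int N z\<bar> + 1"
    by (rule *[OF abs_step_back[of "clamp_int N" 1, OF clamp_int_step]])
qed

lemma measurable_height: "(\<lambda>x. F (snd x 0) :: real) \<in> borel_measurable pair_space"
  by (rule measurable_compose[OF measurable_snd measurable_compose[OF measurable_coordinate]]) simp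

text \<open>Young's inequality with weight \<open>2 t\<close> absorbs the clamped second moment on the right,
  so no Gronwall argument is needed.\<close>

lemma clamped_second_moment:
  assumes t: "0 < t" and s: "0 \<le> s" "s \<le> t"
  shows "(\<integral>x. (clamp_int N (snd x 0))\<^sup>2 \<partial>joint s) \<le> height_bound t"
proof -
  define \<psi> where "\<psi> z = (clamp_int N z)\<^sup>2" for z
  define u where "u s = (\<integral>x. \<psi> (snd x 0) \<partial>joint s)" for s
  define A where "A = 2 * t * (\<integral>\<omega>. (rate_sum \<omega>)\<^sup>2 \<partial>\<mu>) + (\<integral>\<omega>. rate_sum \<omega> \<partial>\<mu>)"
  have R0: "0 \<le> rate_sum \<omega>" for \<omega> by (simp add: rate_sum_def)
  have A0: "0 \<le> A" unfolding A_def using t R0 by simp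
  have \<psi>B: "\<bar>\<psi> z\<bar> \<le> (real N)\<^sup>2" for z
    using abs_clamp_int_le[of N z] unfolding \<psi>_def by (simp add: abs_le_square_iff[symmetric])
  have \<psi>C: "\<bar>\<psi> (z + 1) - \<psi> z\<bar> \<le> 2 * real N + 1" for z
    using clamp_square_step[of N z] abs_clamp_int_le[of N z] unfolding \<psi>_def by linarith
  have \<psi>i: "integrable (joint v) (\<lambda>x. \<psi> (snd x 0))" if "0 \<le> v" for v
  proof -
    interpret J: prob_space "joint v" by (rule prob_space_joint[OF that])
    show ?thesis
      by (rule J.square_integrable_imp_integrable, rule J.square_integrable_bounded[OF measurable_joint[OF that measurable_height] \<psi>B])
  qed
  have uN: "u v \<le> (real N)\<^sup>2" if "0 \<le> v" for v
  proof -
    interpret J: prob_space "joint v" by (rule prob_space_joint[OF that])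
    have "u v \<le> (\<integral>x. (real N)\<^sup>2 \<partial>joint v)"
      unfolding u_def using \<psi>B by (intro integral_mono \<psi>i[OF that]) (auto intro: order_trans[OF abs_ge_self])
    then show ?thesis by (simp add: J.prob_space)
  qed
  \<comment> \<open>Clamping makes this supremum finite; only then can \<open>m / 2\<close> be moved
    to the left side at the end.\<close>
  define m where "m = (SUP v\<in>{0..t}. u v)"
  have bdd: "bdd_above (u ` {0..t})" by (rule bdd_aboveI2[where M = "(real N)\<^sup>2"]) (simp add: uN)
  have um: "u v \<le> m" if "v \<in> {0..t}" for v
    unfolding m_def using that bdd by (rule cSUP_upper)
  have gen: "gen p q (\<lambda>h. \<psi> (h 0)) h \<le> 2 * t * (rate_sum (incr h))\<^sup>2 + rate_sum (incr h) + \<psi> (h 0) / (2 * t)" for h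
  proof -
    let ?c = "\<bar>clamp_int N (h 0)\<bar>" and ?R = "rate_sum (incr h)"
    have "gen p q (\<lambda>h. \<psi> (h 0)) h \<le> \<bar>p (incr h 0) (incr h 1)\<bar> * \<bar>\<psi> (h 0 + 1) - \<psi> (h 0)\<bar>
        + \<bar>q (incr h 0) (incr h 1)\<bar> * \<bar>\<psi> (h 0 - 1) - \<psi> (h 0)\<bar>"
      unfolding gen_origin abs_mult[symmetric] by (intro add_mono abs_ge_self)
    also have "\<dots> \<le> \<bar>p (incr h 0) (incr h 1)\<bar> * (2 * ?c + 1) + \<bar>q (incr h 0) (incr h 1)\<bar> * (2 * ?c + 1)"
      unfolding \<psi>_def by (intro add_mono mult_left_mono clamp_square_step clamp_square_step_back) auto
    also have "\<dots> = 2 * ?R * ?c + ?R" by (simp add: rate_sum_def algebra_simps)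
    also have "2 * ?R * ?c \<le> 2 * t * ?R\<^sup>2 + ?c\<^sup>2 / (2 * t)"
    proof -
      have "0 \<le> (2 * t * ?R - ?c)\<^sup>2 / (2 * t)" using t by simp
      also have "\<dots> = 2 * t * ?R\<^sup>2 + ?c\<^sup>2 / (2 * t) - 2 * ?R * ?c"
        using t by (simp add: power2_eq_square field_simps)
      finally show ?thesis by simp
    qed
    finally show ?thesis by (simp add: \<psi>_def algebra_simps)
  qed
  have step: "u v \<le> t * A + m / 2" if v: "v \<in> {0..t}" for v
  proof -
    have v0: "0 \<le> v" using v by simp
    let ?g = "\<lambda>w. \<integral>x. 1 * gen p q (\<lambda>h. \<psi> (h 0)) (snd x) \<partial>joint w"
    interpret W: finite_measure "window v" by (rule finite_window)
    have sq1: "square_integrable \<mu> (\<lambda>_. 1)" by (rule \<mu>.square_integrable_const)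
    have gb: "?g w \<le> A + m / (2 * t)" if w: "w \<in> {0..t}" for w
    proof -
      have w0: "0 \<le> w" using w by simp
      interpret J: prob_space "joint w" by (rule prob_space_joint[OF w0])
      have R2m: "(\<lambda>\<omega>. (rate_sum \<omega>)\<^sup>2) \<in> borel_measurable int_seq_space"
        using measurable_rate_sum by (rule borel_measurable_power)
      have R2i: "integrable \<mu> (\<lambda>\<omega>. (rate_sum \<omega>)\<^sup>2)" using square_integrable_rate_sum by (simp add: square_integrable_def)
      have i1: "integrable (joint w) (\<lambda>x. (rate_sum (incr (snd x)))\<^sup>2)"
        using integrable_final[OF w0 R2m] R2i by simp
      have i2: "integrable (joint w) (\<lambda>x. rate_sum (incr (snd x)))"
        using integrable_final[OF w0 measurable_rate_sum] integrable_rate_sum by simp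
      have "?g w \<le> (\<integral>x. 2 * t * (rate_sum (incr (snd x)))\<^sup>2 + rate_sum (incr (snd x)) + \<psi> (snd x 0) / (2 * t) \<partial>joint w)"
      proof (rule integral_mono)
        show "integrable (joint w) (\<lambda>x. 1 * gen p q (\<lambda>h. \<psi> (h 0)) (snd x))"
          using J.square_integrable_imp_integrable[OF square_integrable_gen(1)[where \<psi> = \<psi>, OF w0 \<psi>C]] by simp
        show "integrable (joint w) (\<lambda>x. 2 * t * (rate_sum (incr (snd x)))\<^sup>2 + rate_sum (incr (snd x)) + \<psi> (snd x 0) / (2 * t))"
          using i1 i2 \<psi>i[OF w0] by simp
      qed (simp add: gen)
      also have "\<dots> = A + u w / (2 * t)"
        using i1 i2 \<psi>i[OF w0] integral_final[OF w0 R2m] integral_final[OF w0 measurable_rate_sum]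
        by (simp add: A_def u_def)
      also have "\<dots> \<le> A + m / (2 * t)"
        using um[OF w] t by (simp add: divide_right_mono)
      finally show ?thesis .
    qed
    have m0: "0 \<le> m"
    proof -
      have "0 \<le> u v" unfolding u_def \<psi>_def by simp
      then show ?thesis using um[OF v] by simp
    qed
    have "u v = \<psi> 0 * (\<integral>\<omega>. 1 \<partial>\<mu>) + (\<integral>w. ?g w \<partial>window v)"
      using averaged_forward[where \<psi> = \<psi>, OF v0 sq1 \<psi>B \<psi>C] by (simp add: u_def)
    also have "\<psi> 0 = 0" by (simp add: \<psi>_def clamp_int_def)
    also have "(\<integral>w. ?g w \<partial>window v) \<le> (\<integral>w. A + m / (2 * t) \<partial>window v)"
    proof (rule integral_mono)
      show "integrable (window v) ?g" by (rule averaged_forward_integrable[where \<psi> = \<psi>, OF v0 sq1 \<psi>B \<psi>C])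
      show "?g w \<le> A + m / (2 * t)" if "w \<in> space (window v)" for w
        using that v by (intro gb) simp
    qed simp
    also have "\<dots> = v * (A + m / (2 * t))" using v0 by (rule integral_window_const)
    also have "\<dots> \<le> t * (A + m / (2 * t))"
      using v A0 m0 t by (intro mult_right_mono) auto
    also have "\<dots> = t * A + m / 2" using t by (simp add: distrib_left)
    finally show ?thesis by simp
  qed
  have "m \<le> t * A + m / 2"
    unfolding m_def by (rule cSUP_least) (use t step[unfolded m_def] in auto)
  then have "m \<le> 2 * t * A" by simp
  then show ?thesis
    using um[of s] s by (simp add: u_def \<psi>_def height_bound_def A_def)
qed

text \<open>The bound on the clamped moments does not depend on \<open>N\<close>, so monotone
  convergence removes the clamp.\<close>

lemma
  assumes t: "0 < t" and s: "0 \<le> s" "s \<le> t"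
  shows square_integrable_height: "square_integrable (joint s) (\<lambda>x. of_int (snd x 0))"
    and second_moment_height: "(\<integral>x. (of_int (snd x 0))\<^sup>2 \<partial>joint s) \<le> height_bound t"
proof -
  interpret J: prob_space "joint s" by (rule prob_space_joint[OF s(1)])
  let ?f = "\<lambda>N x. (clamp_int N (snd x 0))\<^sup>2 :: real"
  have fm: "(\<lambda>x. clamp_int N (snd x 0)) \<in> borel_measurable (joint s)" for N
    by (rule measurable_joint[OF s(1) measurable_height[of "clamp_int N"]])
  have fi: "integrable (joint s) (?f N)" for N
  proof -
    have "square_integrable (joint s) (\<lambda>x. clamp_int N (snd x 0))"
      by (rule J.square_integrable_bounded[OF fm]) (rule abs_clamp_int_le)
    then show ?thesis by (simp only: square_integrable_def)
  qed
  have inc: "incseq (\<lambda>N. \<integral>x. ?f N x \<partial>joint s)"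
  proof (rule incseq_SucI)
    show "(\<integral>x. ?f N x \<partial>joint s) \<le> (\<integral>x. ?f (Suc N) x \<partial>joint s)" for N
      using clamp_int_mono[of N "Suc N"] by (intro integral_mono fi) (simp add: abs_le_square_iff)
  qed
  obtain L where L: "(\<lambda>N. \<integral>x. ?f N x \<partial>joint s) \<longlonglongrightarrow> L" "\<forall>N. (\<integral>x. ?f N x \<partial>joint s) \<le> L"
    using incseq_convergent[OF inc, of "height_bound t"] clamped_second_moment[OF t s] by blast
  have hm: "(\<lambda>x. of_int (snd x 0) :: real) \<in> borel_measurable (joint s)"
    by (rule measurable_joint[OF s(1) measurable_height[of of_int]])
  have lim: "integrable (joint s) (\<lambda>x. (of_int (snd x 0))\<^sup>2 :: real) \<and> (\<integral>x. (of_int (snd x 0))\<^sup>2 \<partial>joint s) = L"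
  proof (rule conjI)
    have 1: "AE x in joint s. mono (\<lambda>N. ?f N x)"
      using clamp_int_mono by (intro AE_I2 monoI) (simp add: abs_le_square_iff)
    have 2: "AE x in joint s. (\<lambda>N. ?f N x) \<longlonglongrightarrow> (of_int (snd x 0))\<^sup>2"
      by (intro AE_I2 tendsto_power clamp_int_tendsto)
    have 3: "(\<lambda>x. (of_int (snd x 0))\<^sup>2 :: real) \<in> borel_measurable (joint s)"
      using hm by (rule borel_measurable_power)
    show "integrable (joint s) (\<lambda>x. (of_int (snd x 0))\<^sup>2 :: real)"
      by (rule integrable_monotone_convergence[OF fi 1 2 L(1) 3])
    show "(\<integral>x. (of_int (snd x 0))\<^sup>2 \<partial>joint s) = L"
      by (rule integral_monotone_convergence[OF fi 1 2 L(1) 3])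
  qed
  then show "square_integrable (joint s) (\<lambda>x. of_int (snd x 0))"
    using hm unfolding square_integrable_def by blast
  have "L \<le> height_bound t"
    using L(1) by (rule LIMSEQ_le_const2) (use clamped_second_moment[OF t s] in blast)
  then show "(\<integral>x. (of_int (snd x 0))\<^sup>2 \<partial>joint s) \<le> height_bound t" using lim by simp
qed

definition origin_rate :: "int_seq \<Rightarrow> real" where "origin_rate \<omega> = net_rate (\<omega> 0, \<omega> 1)"

lemma origin_rate_eq: "origin_rate \<omega> = p (\<omega> 0) (\<omega> 1) - q (\<omega> 0) (\<omega> 1)"
  by (simp add: origin_rate_def net_rate_def)

lemma abs_origin_rate_le: "\<bar>origin_rate \<omega>\<bar> \<le> rate_sum \<omega>"
  unfolding origin_rate_eq rate_sum_def by linarith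

lemma measurable_origin_rate: "origin_rate \<in> borel_measurable int_seq_space"
  unfolding origin_rate_eq[abs_def] by (rule measurable_two_sites)

lemma square_integrable_origin_rate: "square_integrable \<mu> origin_rate"
  by (rule square_integrable_dominated(1)[OF square_integrable_rate_sum])
     (use measurable_origin_rate abs_origin_rate_le in \<open>auto simp: measurable_of_\<mu> intro: order_trans[OF _ abs_ge_self]\<close>)

text \<open>The averaged forward equation for the clamped height, with \<open>N\<close> sent to
  infinity. The generator then tends to \<open>p - q\<close>. On the left the second moment of the
  height dominates; on the right \<open>rate_sum\<close> dominates inside, and the constant
  \<open>b\<close> dominates in the integral over time.\<close>

lemma height_representation:
  assumes t: "0 < t" and W: "square_integrable \<mu> W"
  shows "(\<integral>x. W (fst x) * of_int (snd x 0) \<partial>joint t) = (\<integral>s. (\<integral>x. W (fst x) * origin_rate (incr (snd x)) \<partial>joint s) \<partial>window t)"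
proof -
  have t0: "0 \<le> t" using t by simp
  have C1: "\<bar>clamp_int N (z + 1) - clamp_int N z\<bar> \<le> 1" for N z by (rule clamp_int_step)
  let ?G = "\<lambda>N h. gen p q (\<lambda>h. clamp_int N (h 0)) h"
  have Wm: "W \<in> borel_measurable int_seq_space" using W by (simp add: square_integrable_def measurable_of_\<mu>)
  have W2m: "(\<lambda>\<omega>. (W \<omega>)\<^sup>2) \<in> borel_measurable int_seq_space" using Wm by (rule borel_measurable_power)
  have Wm': "(\<lambda>x. W (fst x)) \<in> borel_measurable (joint s)" if "0 \<le> s" for s
    by (rule measurable_joint[OF that measurable_compose[OF measurable_fst Wm]])
  have eq: "(\<integral>x. W (fst x) * clamp_int N (snd x 0) \<partial>joint t)
      = (\<integral>s. (\<integral>x. W (fst x) * ?G N (snd x) \<partial>joint s) \<partial>window t)" for N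
    using averaged_forward[where \<psi> = "clamp_int N", OF t0 W abs_clamp_int_le C1]
    by (simp add: clamp_int_def[of N 0])
  have lhs: "(\<lambda>N. \<integral>x. W (fst x) * clamp_int N (snd x 0) \<partial>joint t) \<longlonglongrightarrow> (\<integral>x. W (fst x) * of_int (snd x 0) \<partial>joint t)"
  proof (rule integral_dominated_convergence[where w = "\<lambda>x. \<bar>W (fst x) * of_int (snd x 0)\<bar>"])
    have h: "(\<lambda>x. F (snd x 0) :: real) \<in> borel_measurable (joint t)" for F
      by (rule measurable_joint[OF t0 measurable_height])
    show "(\<lambda>x. W (fst x) * of_int (snd x 0)) \<in> borel_measurable (joint t)"
      by (rule borel_measurable_times[OF Wm'[OF t0] h[of of_int]])
    show "(\<lambda>x. W (fst x) * clamp_int N (snd x 0)) \<in> borel_measurable (joint t)" for N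
      by (rule borel_measurable_times[OF Wm'[OF t0] h[of "clamp_int N"]])
    show "integrable (joint t) (\<lambda>x. \<bar>W (fst x) * of_int (snd x 0)\<bar>)"
      by (rule integrable_abs[OF square_integrable_integrable_mult[OF square_integrable_initial[OF t0 W]
          square_integrable_height[OF t t0 order_refl]]])
    show "AE x in joint t. (\<lambda>N. W (fst x) * clamp_int N (snd x 0)) \<longlonglongrightarrow> W (fst x) * of_int (snd x 0)"
      by (intro AE_I2 tendsto_mult_left clamp_int_tendsto)
    show "AE x in joint t. norm (W (fst x) * clamp_int N (snd x 0)) \<le> \<bar>W (fst x) * of_int (snd x 0)\<bar>" for N
      using abs_clamp_int_le_abs by (intro AE_I2) (simp add: abs_mult mult_left_mono)
  qed
  have Glim: "(\<lambda>N. ?G N h) \<longlonglongrightarrow> origin_rate (incr h)" for h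
  proof -
    have "(\<lambda>N. ?G N h) \<longlonglongrightarrow> p (incr h 0) (incr h 1) * (of_int (h 0 + 1) - of_int (h 0))
        + q (incr h 0) (incr h 1) * (of_int (h 0 - 1) - of_int (h 0))"
      unfolding gen_origin
      by (intro tendsto_add tendsto_mult_left tendsto_diff clamp_int_tendsto)
    then show ?thesis by (simp add: origin_rate_eq)
  qed
  have Gle: "\<bar>?G N h\<bar> \<le> rate_sum (incr h)" for N h
    using abs_gen_origin_le[where \<psi> = "clamp_int N", OF C1, of h] by simp
  have WR: "integrable (joint s) (\<lambda>x. \<bar>W (fst x)\<bar> * rate_sum (incr (snd x)))" if "0 \<le> s" for s
    by (rule square_integrable_integrable_mult[OF square_integrable_abs[OF square_integrable_initial[OF that W]]
        square_integrable_final[OF that square_integrable_rate_sum]])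
  have inner: "(\<lambda>N. \<integral>x. W (fst x) * ?G N (snd x) \<partial>joint s) \<longlonglongrightarrow> (\<integral>x. W (fst x) * origin_rate (incr (snd x)) \<partial>joint s)"
    if s: "0 \<le> s" for s
  proof (rule integral_dominated_convergence[where w = "\<lambda>x. \<bar>W (fst x)\<bar> * rate_sum (incr (snd x))"])
    show "(\<lambda>x. W (fst x) * origin_rate (incr (snd x))) \<in> borel_measurable (joint s)"
      by (rule borel_measurable_times[OF Wm'[OF s] measurable_joint[OF s measurable_compose[OF measurable_incr_snd measurable_origin_rate]]])
    show "(\<lambda>x. W (fst x) * ?G N (snd x)) \<in> borel_measurable (joint s)" for N
      by (rule borel_measurable_times[OF Wm'[OF s] measurable_joint[OF s measurable_compose[OF measurable_snd measurable_gen_origin]]])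
    show "AE x in joint s. (\<lambda>N. W (fst x) * ?G N (snd x)) \<longlonglongrightarrow> W (fst x) * origin_rate (incr (snd x))"
      by (intro AE_I2 tendsto_mult_left Glim)
    show "AE x in joint s. norm (W (fst x) * ?G N (snd x)) \<le> \<bar>W (fst x)\<bar> * rate_sum (incr (snd x))" for N
      using Gle by (intro AE_I2) (simp add: abs_mult mult_left_mono)
  qed (rule WR[OF s])
  define b where "b = ((\<integral>\<omega>. (W \<omega>)\<^sup>2 \<partial>\<mu>) + (\<integral>\<omega>. (rate_sum \<omega>)\<^sup>2 \<partial>\<mu>)) / 2"
  have bound: "\<bar>\<integral>x. W (fst x) * ?G N (snd x) \<partial>joint s\<bar> \<le> b" if s: "0 \<le> s" for N s
  proof -
    have "\<bar>\<integral>x. W (fst x) * ?G N (snd x) \<partial>joint s\<bar>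
        \<le> ((\<integral>x. (W (fst x))\<^sup>2 \<partial>joint s) + (\<integral>x. (?G N (snd x))\<^sup>2 \<partial>joint s)) / 2"
      by (rule square_integrable_mult_bound[OF square_integrable_initial[OF s W]
          square_integrable_gen(1)[where \<psi> = "clamp_int N", OF s C1]])
    also have "\<dots> \<le> b"
      using integral_initial[OF s W2m] square_integrable_gen(2)[where \<psi> = "clamp_int N", OF s C1]
      by (simp add: b_def)
    finally show ?thesis .
  qed
  interpret F: finite_measure "window t" by (rule finite_window)
  have rhs: "(\<lambda>N. \<integral>s. (\<integral>x. W (fst x) * ?G N (snd x) \<partial>joint s) \<partial>window t)
      \<longlonglongrightarrow> (\<integral>s. (\<integral>x. W (fst x) * origin_rate (incr (snd x)) \<partial>joint s) \<partial>window t)"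
  proof (rule integral_dominated_convergence[where w = "\<lambda>_. b"])
    show "(\<lambda>s. \<integral>x. W (fst x) * origin_rate (incr (snd x)) \<partial>joint s) \<in> borel_measurable (window t)"
      by (rule joint_integral_measurable, rule borel_measurable_times[OF measurable_compose[OF measurable_fst Wm]
          measurable_compose[OF measurable_incr_snd measurable_origin_rate]])
    show "(\<lambda>s. \<integral>x. W (fst x) * ?G N (snd x) \<partial>joint s) \<in> borel_measurable (window t)" for N
      by (rule joint_integral_measurable, rule borel_measurable_times[OF measurable_compose[OF measurable_fst Wm]
          measurable_compose[OF measurable_snd measurable_gen_origin]])
    show "AE s in window t. (\<lambda>N. \<integral>x. W (fst x) * ?G N (snd x) \<partial>joint s) \<longlonglongrightarrow> (\<integral>x. W (fst x) * origin_rate (incr (snd x)) \<partial>joint s)"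
      by (rule AE_I2) (simp add: inner)
    show "AE s in window t. norm (\<integral>x. W (fst x) * ?G N (snd x) \<partial>joint s) \<le> b" for N
      by (rule AE_I2) (simp add: bound)
  qed simp
  show ?thesis
    using LIMSEQ_unique[OF lhs rhs[folded eq]] .
qed

end

section \<open>Covariances of the currents\<close>

context equilibrium
begin

definition dev :: "int \<Rightarrow> int_seq \<Rightarrow> real" where "dev j \<omega> = of_int (\<omega> j) - \<rho> \<theta>"

definition J :: "int \<Rightarrow> int_seq \<times> int_seq \<Rightarrow> real" where
  "J i x = of_int (snd x i - height_of (fst x) i)"

text \<open>The \<open>a\<^sub>i\<close> of the overview. It is a covariance although
  \<open>J i\<close> is not centred, because \<open>dev 0\<close> has mean zero.\<close>

definition height_cov :: "real \<Rightarrow> int \<Rightarrow> real" where "height_cov t i = (\<integral>x. dev 0 (fst x) * J i x \<partial>joint t)"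

definition two_point :: "real \<Rightarrow> int \<Rightarrow> real" where "two_point t i = (\<integral>x. dev 0 (fst x) * dev i (incr (snd x)) \<partial>joint t)"

lemma measurable_dev: "dev j \<in> borel_measurable int_seq_space"
  unfolding dev_def[abs_def]
  by (rule measurable_compose[OF measurable_coordinate, where g = "\<lambda>z. of_int z - \<rho> \<theta>"]) simp

lemma square_integrable_dev: "square_integrable \<mu> (dev j)"
proof -
  have "square_integrable (measure_pmf site) (\<lambda>z. of_int z - \<rho> \<theta>)"
    by (rule square_integrable_diff[OF square_integrable_site[OF \<theta>] measure_pmf.square_integrable_const])
  then have "integrable \<mu> (\<lambda>\<omega>. (dev j \<omega>)\<^sup>2)"
    using integrable_iid_coordinate[of site "\<lambda>z. (of_int z - \<rho> \<theta>)\<^sup>2" j]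
    unfolding square_integrable_def dev_def by blast
  then show ?thesis using measurable_dev unfolding square_integrable_def measurable_of_\<mu> by blast
qed

lemma integrable_dev: "integrable \<mu> (dev j)"
  by (rule \<mu>.square_integrable_imp_integrable[OF square_integrable_dev])

lemma integral_dev: "(\<integral>\<omega>. dev j \<omega> \<partial>\<mu>) = 0"
  using integral_iid_coordinate[where F = "\<lambda>z. of_int z - \<rho> \<theta>" and i = j and s = site] integrable_site[OF \<theta>]
  by (simp add: dev_def \<rho>_def[symmetric])

lemma integral_dev_dev: "(\<integral>\<omega>. dev i \<omega> * dev j \<omega> \<partial>\<mu>) = (if i = j then V \<theta> else 0)"
proof (cases "i = j")
  case True
  then show ?thesis
    using integral_iid_coordinate[where F = "\<lambda>z. (of_int z - \<rho> \<theta>)\<^sup>2" and i = j and s = site]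
    by (simp add: dev_def V_def power2_eq_square)
next
  case False
  have "(\<integral>\<omega>. dev i \<omega> * dev j \<omega> \<partial>\<mu>) = (\<integral>\<omega>. dev i \<omega> \<partial>\<mu>) * (\<integral>\<omega>. dev j \<omega> \<partial>\<mu>)"
  proof (rule iid_integral_mult[where A = "{i}" and B = "{j}", OF measurable_dev measurable_dev])
    show "dev k \<omega> = dev k \<omega>'" if "\<And>i. i \<in> {k} \<Longrightarrow> \<omega> i = \<omega>' i" for k \<omega> \<omega>'
      using that[of k] by (simp add: dev_def)
    then show "dev j \<omega> = dev j \<omega>'" if "\<And>i. i \<in> {j} \<Longrightarrow> \<omega> i = \<omega>' i" for \<omega> \<omega>' using that by blast
    show "{i} \<inter> {j} = {}" using False by simp
  qed (rule integrable_dev)+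
  then show ?thesis using False by (simp add: integral_dev)
qed

lemma J_0: "J 0 = (\<lambda>x. of_int (snd x 0))"
  by (simp add: J_def fun_eq_iff)

lemma J_\<sigma>: "J i (\<sigma> k x) = J (i + k) x"
  by (cases x) (simp add: J_def \<sigma>_def height_of_shift Defs.shift_def)

lemma fst_\<sigma>: "fst (\<sigma> k x) = (\<lambda>i. fst x (i + k))"
  and incr_snd_\<sigma>: "incr (snd (\<sigma> k x)) = (\<lambda>i. incr (snd x) (i + k))"
  by (cases x; simp add: \<sigma>_def incr_shift)+

lemma J_eq_\<sigma>: "J i = (\<lambda>x. J 0 (\<sigma> i x))"
  by (simp add: fun_eq_iff J_\<sigma>)

lemma measurable_J: "J i \<in> borel_measurable pair_space"
  unfolding J_eq_\<sigma>[of i] J_0 by (rule measurable_compose[OF measurable_\<sigma> measurable_height[of of_int]])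

text \<open>Conservation of mass at one site: its content changes by the flow in from the left minus
  the flow out to the right.\<close>

lemma J_step: "J (i - 1) x - J i x = dev i (incr (snd x)) - dev i (fst x)"
proof -
  have "fst x i = height_of (fst x) (i - 1) - height_of (fst x) i"
    using fun_cong[OF incr_height_of[of "fst x"], of i] by (simp add: incr_def)
  then show ?thesis by (simp add: J_def dev_def incr_def)
qed

lemma J_telescope:
  assumes "k \<le> m"
  shows "(\<Sum>j\<in>{k + 1..m}. dev j (incr (snd x)) - dev j (fst x)) = J k x - J m x"
  using assms
proof (induction m rule: int_ge_induct)
  case (step i)
  then have "{k + 1..i + 1} = insert (i + 1) {k + 1..i}" by auto
  then show ?case using step J_step[of "i + 1" x] by simp
qed simp

context
  fixes t u :: real
  assumes u: "0 < u" "0 \<le> t" "t \<le> u"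
begin

text \<open>Translation invariance carries the bound from the origin to every site. The constant
  depends on the horizon \<open>u\<close> and not on \<open>t\<close>, as the later integration over
  all earlier times demands.\<close>

lemma square_integrable_J: "square_integrable (joint t) (J i)"
  and J_second_moment: "(\<integral>x. (J i x)\<^sup>2 \<partial>joint t) \<le> height_bound u"
  and J_second_moment_shift: "(\<integral>x. (J i x)\<^sup>2 \<partial>joint t) = (\<integral>x. (J 0 x)\<^sup>2 \<partial>joint t)"
proof -
  have m: "(\<lambda>x. (J 0 x)\<^sup>2) \<in> borel_measurable pair_space"
    using measurable_J by (rule borel_measurable_power)
  have 0: "square_integrable (joint t) (J 0)" "(\<integral>x. (J 0 x)\<^sup>2 \<partial>joint t) \<le> height_bound u"
    using square_integrable_height[OF u] second_moment_height[OF u] unfolding J_0 .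
  have "integrable (joint t) (\<lambda>x. (J i x)\<^sup>2)"
    using integrable_\<sigma>[OF u(2) m, of i] 0(1) unfolding J_\<sigma> square_integrable_def by simp
  then show "square_integrable (joint t) (J i)"
    using measurable_joint[OF u(2) measurable_J] unfolding square_integrable_def by blast
  show *: "(\<integral>x. (J i x)\<^sup>2 \<partial>joint t) = (\<integral>x. (J 0 x)\<^sup>2 \<partial>joint t)"
    using integral_\<sigma>[OF u(2) m, of i] unfolding J_\<sigma> by simp
  show "(\<integral>x. (J i x)\<^sup>2 \<partial>joint t) \<le> height_bound u" using 0(2) * by simp
qed

lemma J_mean_shift: "(\<integral>x. J i x \<partial>joint t) = (\<integral>x. J 0 x \<partial>joint t)"
  using integral_\<sigma>[OF u(2) measurable_J, of 0 i] unfolding J_\<sigma> by simp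

lemmas dev_initial = square_integrable_initial[OF u(2) square_integrable_dev]
lemmas dev_final = square_integrable_final[OF u(2) square_integrable_dev]
lemmas integrable_dev_J = square_integrable_integrable_mult[OF dev_initial square_integrable_J]

text \<open>Translating by \<open>i\<close> moves that site to the origin. Hence a current far from
  a fixed site may be replaced by a fixed current and a far site, and the values at different sites
  are orthogonal.\<close>

lemma covariance_shift: "(\<integral>x. dev i (fst x) * J k x \<partial>joint t) = height_cov t (k - i)"
proof -
  have "(\<lambda>x. dev 0 (fst x) * J (k - i) x) \<in> borel_measurable pair_space"
    by (rule borel_measurable_times[OF measurable_compose[OF measurable_fst measurable_dev] measurable_J])
  from integral_\<sigma>[OF u(2) this, of i] show ?thesis
    by (simp add: J_\<sigma> fst_\<sigma> dev_def height_cov_def)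
qed

lemma dev_initial_orthogonal:
  "(\<integral>x. dev i (fst x) * dev j (fst x) \<partial>joint t) = (if i = j then V \<theta> else 0)"
  using integral_initial[OF u(2) borel_measurable_times[OF measurable_dev[of i] measurable_dev[of j]]]
  by (simp add: integral_dev_dev)

lemma height_cov_tendsto_0:
  assumes inj: "inj g"
  shows "(\<lambda>n. height_cov t (g (n :: nat))) \<longlonglongrightarrow> 0"
proof -
  have "(\<lambda>n. \<integral>x. J 0 x * dev (- g n) (fst x) \<partial>joint t) \<longlonglongrightarrow> 0"
  proof (rule orthogonal_coefficients_tendsto_zero[OF square_integrable_J dev_initial])
    show "(\<integral>x. dev (- g m) (fst x) * dev (- g n) (fst x) \<partial>joint t) = 0" if "m \<noteq> n" for m n
      using that inj by (simp add: dev_initial_orthogonal inj_eq)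
    show "(\<integral>x. (dev (- g n) (fst x))\<^sup>2 \<partial>joint t) = V \<theta>" for n
      using dev_initial_orthogonal[of "- g n" "- g n"] by (simp add: power2_eq_square)
  qed
  moreover have "(\<integral>x. J 0 x * dev (- g n) (fst x) \<partial>joint t) = height_cov t (g n)" for n
    using covariance_shift[of "- g n" 0] by (simp add: mult.commute)
  ultimately show ?thesis by simp
qed

lemma height_cov_step: "height_cov t (i - 1) - height_cov t i = two_point t i - (if i = 0 then V \<theta> else 0)"
proof -
  have "height_cov t (i - 1) - height_cov t i = (\<integral>x. dev 0 (fst x) * J (i - 1) x - dev 0 (fst x) * J i x \<partial>joint t)"
    unfolding height_cov_def by (rule Bochner_Integration.integral_diff[symmetric]) (rule integrable_dev_J)+
  also have "\<dots> = (\<integral>x. dev 0 (fst x) * dev i (incr (snd x)) - dev 0 (fst x) * dev i (fst x) \<partial>joint t)"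
    by (rule Bochner_Integration.integral_cong[OF refl]) (simp only: J_step right_diff_distrib[symmetric])
  also have "\<dots> = two_point t i - (\<integral>x. dev 0 (fst x) * dev i (fst x) \<partial>joint t)"
    unfolding two_point_def
    by (rule Bochner_Integration.integral_diff)
       (rule square_integrable_integrable_mult[OF dev_initial dev_final] square_integrable_integrable_mult[OF dev_initial dev_initial])+
  also have "\<dots> = two_point t i - (if i = 0 then V \<theta> else 0)"
    by (auto simp: dev_initial_orthogonal)
  finally show ?thesis .
qed

text \<open>With \<open>S\<close> the centred mass of \<open>m\<close> consecutive sites, the left side is
  \<open>E (S (\<omega>\<^sub>0) * (S (\<omega>\<^sub>0) - S (\<omega>\<^sub>t)))\<close>, which by stationarity is half of \<open>E (S (\<omega>\<^sub>0) - S (\<omega>\<^sub>t))\<^sup>2\<close>.\<close>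

lemma height_cov_difference_bound:
  "(\<Sum>i\<in>{1 - int m..0}. height_cov t (- i) - height_cov t (- int m - i)) \<le> 2 * height_bound u"
proof -
  define A where "A = {1 - int m..0}"
  define S where "S \<omega> = (\<Sum>j\<in>A. dev j \<omega>)" for \<omega>
  have Sq: "square_integrable \<mu> S" unfolding S_def[abs_def]
    by (rule square_integrable_sum[OF square_integrable_dev])
  note S0 = square_integrable_initial[OF u(2) Sq] and S1 = square_integrable_final[OF u(2) Sq]
  have Sm: "(\<lambda>\<omega>. (S \<omega>)\<^sup>2) \<in> borel_measurable int_seq_space"
    using Sq unfolding square_integrable_def measurable_of_\<mu> by (intro borel_measurable_power) blast
  have diff: "S (incr (snd x)) - S (fst x) = J (- int m) x - J 0 x" for x
    using J_telescope[of "- int m" 0 x] by (simp add: S_def A_def sum_subtractf add.commute)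
  have i: "integrable (joint t) (\<lambda>x. (S (fst x))\<^sup>2)" "integrable (joint t) (\<lambda>x. (S (incr (snd x)))\<^sup>2)"
    "integrable (joint t) (\<lambda>x. S (fst x) * S (incr (snd x)))"
    using S0 S1 square_integrable_integrable_mult[OF S0 S1] unfolding square_integrable_def by blast+
  have e: "(\<integral>x. (S (incr (snd x)))\<^sup>2 \<partial>joint t) = (\<integral>x. (S (fst x))\<^sup>2 \<partial>joint t)"
    unfolding integral_initial[OF u(2) Sm] integral_final[OF u(2) Sm] ..
  have "(\<Sum>i\<in>A. height_cov t (- i) - height_cov t (- int m - i))
      = (\<Sum>i\<in>A. \<integral>x. dev i (fst x) * J 0 x - dev i (fst x) * J (- int m) x \<partial>joint t)"
  proof (rule sum.cong[OF refl])
    fix i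
    have "(\<integral>x. dev i (fst x) * J 0 x - dev i (fst x) * J (- int m) x \<partial>joint t)
        = (\<integral>x. dev i (fst x) * J 0 x \<partial>joint t) - (\<integral>x. dev i (fst x) * J (- int m) x \<partial>joint t)"
      by (rule Bochner_Integration.integral_diff) (rule integrable_dev_J)+
    then show "height_cov t (- i) - height_cov t (- int m - i) = (\<integral>x. dev i (fst x) * J 0 x - dev i (fst x) * J (- int m) x \<partial>joint t)"
      by (simp add: covariance_shift)
  qed
  also have "\<dots> = (\<integral>x. (\<Sum>i\<in>A. dev i (fst x) * J 0 x - dev i (fst x) * J (- int m) x) \<partial>joint t)"
    by (rule Bochner_Integration.integral_sum[symmetric]) (intro Bochner_Integration.integrable_diff integrable_dev_J)
  also have "\<dots> = (\<integral>x. (S (fst x))\<^sup>2 - S (fst x) * S (incr (snd x)) \<partial>joint t)"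
  proof (rule Bochner_Integration.integral_cong[OF refl])
    fix x
    have "(\<Sum>i\<in>A. dev i (fst x) * J 0 x - dev i (fst x) * J (- int m) x) = S (fst x) * (J 0 x - J (- int m) x)"
      by (simp add: S_def sum_distrib_right right_diff_distrib sum_subtractf)
    also have "J 0 x - J (- int m) x = S (fst x) - S (incr (snd x))" using diff[of x] by simp
    finally show "(\<Sum>i\<in>A. dev i (fst x) * J 0 x - dev i (fst x) * J (- int m) x) = (S (fst x))\<^sup>2 - S (fst x) * S (incr (snd x))"
      by (simp add: power2_eq_square right_diff_distrib)
  qed
  also have "\<dots> = (\<integral>x. (S (fst x))\<^sup>2 \<partial>joint t) - (\<integral>x. S (fst x) * S (incr (snd x)) \<partial>joint t)"
    using i by simp
  also have "\<dots> = (\<integral>x. (S (incr (snd x)))\<^sup>2 + (S (fst x))\<^sup>2 - 2 * (S (fst x) * S (incr (snd x))) \<partial>joint t) / 2"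
    using i e by simp
  also have "\<dots> = (\<integral>x. (J (- int m) x - J 0 x)\<^sup>2 \<partial>joint t) / 2"
    unfolding diff[symmetric] by (simp add: power2_diff mult.commute mult.left_commute)
  also have "\<dots> \<le> (\<integral>x. 2 * (J (- int m) x)\<^sup>2 + 2 * (J 0 x)\<^sup>2 \<partial>joint t) / 2"
  proof (intro divide_right_mono integral_mono)
    show "integrable (joint t) (\<lambda>x. (J (- int m) x - J 0 x)\<^sup>2)"
      using square_integrable_diff[OF square_integrable_J square_integrable_J] by (simp only: square_integrable_def)
    show "integrable (joint t) (\<lambda>x. 2 * (J (- int m) x)\<^sup>2 + 2 * (J 0 x)\<^sup>2)"
      using square_integrable_J unfolding square_integrable_def
      by (intro Bochner_Integration.integrable_add integrable_mult_right) blast+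
    show "(J (- int m) x - J 0 x)\<^sup>2 \<le> 2 * (J (- int m) x)\<^sup>2 + 2 * (J 0 x)\<^sup>2" for x
      using zero_le_power2[of "J (- int m) x + J 0 x"] by (simp add: power2_sum power2_diff)
  qed simp
  also have "\<dots> = 2 * (\<integral>x. (J 0 x)\<^sup>2 \<partial>joint t)"
    using square_integrable_J[of 0] square_integrable_J[of "- int m"] J_second_moment_shift[of "- int m"]
    by (simp add: square_integrable_def)
  also have "\<dots> \<le> 2 * height_bound u" using J_second_moment[of 0] by simp
  finally show ?thesis unfolding A_def .
qed

section \<open>Decorrelation of distant currents and rates\<close>

definition centred_rate :: "int \<Rightarrow> int_seq \<Rightarrow> real" where
  "centred_rate k \<omega> = origin_rate (\<lambda>i. \<omega> (i + k)) - (\<integral>\<omega>. origin_rate \<omega> \<partial>\<mu>)"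

lemma centred_rate_sites: "centred_rate k \<omega> = net_rate (\<omega> k, \<omega> (k + 1)) - (\<integral>\<omega>. origin_rate \<omega> \<partial>\<mu>)"
  by (simp add: centred_rate_def origin_rate_def add.commute)

lemma measurable_centred_rate: "centred_rate k \<in> borel_measurable int_seq_space"
  unfolding centred_rate_def[abs_def]
  by (intro borel_measurable_diff measurable_compose[OF measurable_shift_seq measurable_origin_rate] measurable_const) simp

lemma square_integrable_centred_rate: "square_integrable \<mu> (centred_rate k)"
proof -
  have "(\<lambda>\<omega>. (origin_rate \<omega>)\<^sup>2) \<in> borel_measurable int_seq_space" using measurable_origin_rate by (rule borel_measurable_power)
  from integral_iid_shift(2)[OF this, of site k]
  have "integrable \<mu> (\<lambda>\<omega>. (origin_rate (\<lambda>i. \<omega> (i + k)))\<^sup>2)" using square_integrable_origin_rate by (simp add: square_integrable_def)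
  then have "square_integrable \<mu> (\<lambda>\<omega>. origin_rate (\<lambda>i. \<omega> (i + k)))"
    using measurable_compose[OF measurable_shift_seq measurable_origin_rate] unfolding square_integrable_def measurable_of_\<mu> by blast
  from square_integrable_diff[OF this \<mu>.square_integrable_const] show ?thesis
    unfolding centred_rate_def[abs_def] .
qed

lemma integral_centred_rate: "(\<integral>\<omega>. centred_rate k \<omega> \<partial>\<mu>) = 0"
proof -
  have "(\<integral>\<omega>. origin_rate (\<lambda>i. \<omega> (i + k)) \<partial>\<mu>) = (\<integral>\<omega>. origin_rate \<omega> \<partial>\<mu>)" by (rule integral_iid_shift(1)[OF measurable_origin_rate])
  moreover have "integrable \<mu> (\<lambda>\<omega>. origin_rate (\<lambda>i. \<omega> (i + k)))"
    using integral_iid_shift(2)[OF measurable_origin_rate] \<mu>.square_integrable_imp_integrable[OF square_integrable_origin_rate] by blast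
  ultimately show ?thesis by (simp add: centred_rate_def \<mu>.prob_space[unfolded space_iid])
qed

text \<open>Rates at distance two or more depend on disjoint pairs of sites and are independent;
  neighbouring rates share a site.\<close>

lemma centred_rate_orthogonal:
  assumes "\<bar>k - l\<bar> \<ge> 2"
  shows "(\<integral>\<omega>. centred_rate k \<omega> * centred_rate l \<omega> \<partial>\<mu>) = 0"
proof -
  have "(\<integral>\<omega>. centred_rate k \<omega> * centred_rate l \<omega> \<partial>\<mu>) = (\<integral>\<omega>. centred_rate k \<omega> \<partial>\<mu>) * (\<integral>\<omega>. centred_rate l \<omega> \<partial>\<mu>)"
  proof (rule iid_integral_mult[where A = "{k, k + 1}" and B = "{l, l + 1}"])
    show "centred_rate k \<omega> = centred_rate k \<omega>'" if "\<And>i. i \<in> {k, k + 1} \<Longrightarrow> \<omega> i = \<omega>' i" for k \<omega> \<omega>'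
      using that[of k] that[of "k + 1"] by (simp add: centred_rate_sites)
    then show "centred_rate l \<omega> = centred_rate l \<omega>'" if "\<And>i. i \<in> {l, l + 1} \<Longrightarrow> \<omega> i = \<omega>' i" for \<omega> \<omega>' using that by blast
    show "{k, k + 1} \<inter> {l, l + 1} = {}" using assms by auto
  qed (rule measurable_centred_rate \<mu>.square_integrable_imp_integrable[OF square_integrable_centred_rate])+
  then show ?thesis by (simp add: integral_centred_rate)
qed

lemma integral_centred_rate_square: "(\<integral>\<omega>. (centred_rate k \<omega>)\<^sup>2 \<partial>\<mu>) = (\<integral>\<omega>. (centred_rate 0 \<omega>)\<^sup>2 \<partial>\<mu>)"
proof -
  have "(\<lambda>\<omega>. (centred_rate 0 \<omega>)\<^sup>2) \<in> borel_measurable int_seq_space" using measurable_centred_rate by (rule borel_measurable_power)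
  from integral_iid_shift(1)[OF this, of site k] show ?thesis by (simp add: centred_rate_def)
qed

lemma J_centred_rate_shift:
  "(\<integral>x. J k x * centred_rate 0 (incr (snd x)) \<partial>joint t) = (\<integral>x. J 0 x * centred_rate (- k) (incr (snd x)) \<partial>joint t)"
proof -
  have "(\<lambda>x. J 0 x * centred_rate (- k) (incr (snd x))) \<in> borel_measurable pair_space"
    by (rule borel_measurable_times[OF measurable_J measurable_compose[OF measurable_incr_snd measurable_centred_rate]])
  from integral_\<sigma>[OF u(2) this, of k] show ?thesis
    by (simp add: J_\<sigma> incr_snd_\<sigma> centred_rate_def)
qed

text \<open>After translation the current sits at the origin and the rates move. Gaps of at least
  two make the moving rates an orthogonal family of constant norm, so the coefficients of
  \<open>J 0\<close> along it vanish in the limit.\<close>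

lemma J_centred_rate_tendsto_0:
  assumes g: "\<And>m n :: nat. m \<noteq> n \<Longrightarrow> \<bar>g m - g n\<bar> \<ge> 2"
  shows "(\<lambda>n. \<integral>x. J (g n) x * centred_rate 0 (incr (snd x)) \<partial>joint t) \<longlonglongrightarrow> 0"
  unfolding J_centred_rate_shift
proof (rule orthogonal_coefficients_tendsto_zero[OF square_integrable_J square_integrable_final[OF u(2) square_integrable_centred_rate]])
  show "(\<integral>x. centred_rate (- g m) (incr (snd x)) * centred_rate (- g n) (incr (snd x)) \<partial>joint t) = 0" if "m \<noteq> n" for m n
    using integral_final[OF u(2) borel_measurable_times[OF measurable_centred_rate[of "- g m"] measurable_centred_rate[of "- g n"]]]
      centred_rate_orthogonal[of "- g m" "- g n"] g[OF that] by simp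
  show "(\<integral>x. (centred_rate (- g n) (incr (snd x)))\<^sup>2 \<partial>joint t) = (\<integral>\<omega>. (centred_rate 0 \<omega>)\<^sup>2 \<partial>\<mu>)" for n
    using integral_final[OF u(2) borel_measurable_power[OF measurable_centred_rate[of "- g n"], of 2]] integral_centred_rate_square by simp
qed

lemma origin_rate_centred_rate: "origin_rate \<omega> = centred_rate 0 \<omega> + (\<integral>\<omega>. origin_rate \<omega> \<partial>\<mu>)"
  by (simp add: centred_rate_def)

text \<open>The net rate at the origin depends on sites \<open>0\<close> and \<open>1\<close> only.
  The block is symmetric about this pair and contains it as soon as \<open>m\<close> is one; every
  other site is independent of the rate and contributes zero.\<close>

lemma integral_dev_origin_rate: "1 \<le> m \<Longrightarrow> (\<integral>\<omega>. (\<Sum>j\<in>{1 - int m..int m}. dev j \<omega>) * origin_rate \<omega> \<partial>\<mu>) = flux_slope \<theta>"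
proof -
  assume m: "1 \<le> m"
  have i: "integrable \<mu> (\<lambda>\<omega>. dev j \<omega> * origin_rate \<omega>)" for j
    by (rule square_integrable_integrable_mult[OF square_integrable_dev square_integrable_origin_rate])
  have 0: "(\<integral>\<omega>. dev j \<omega> * origin_rate \<omega> \<partial>\<mu>) = 0" if "j \<notin> {0, 1}" for j
  proof -
    have "(\<integral>\<omega>. dev j \<omega> * origin_rate \<omega> \<partial>\<mu>) = (\<integral>\<omega>. dev j \<omega> \<partial>\<mu>) * (\<integral>\<omega>. origin_rate \<omega> \<partial>\<mu>)"
    proof (rule iid_integral_mult[where A = "{j}" and B = "{0, 1}", OF measurable_dev measurable_origin_rate])
      show "dev j \<omega> = dev j \<omega>'" if "\<And>i. i \<in> {j} \<Longrightarrow> \<omega> i = \<omega>' i" for \<omega> \<omega>'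
        using that by (simp add: dev_def)
      show "origin_rate \<omega> = origin_rate \<omega>'" if "\<And>i. i \<in> {0, 1} \<Longrightarrow> \<omega> i = \<omega>' i" for \<omega> \<omega>'
        using that[of 0] that[of 1] by (simp add: origin_rate_def)
    qed (use that integrable_dev \<mu>.square_integrable_imp_integrable[OF square_integrable_origin_rate] in auto)
    then show ?thesis by (simp add: integral_dev)
  qed
  have "(\<integral>\<omega>. (\<Sum>j\<in>{1 - int m..int m}. dev j \<omega>) * origin_rate \<omega> \<partial>\<mu>) = (\<integral>\<omega>. (\<Sum>j\<in>{1 - int m..int m}. dev j \<omega> * origin_rate \<omega>) \<partial>\<mu>)"
    by (simp only: sum_distrib_right)
  also have "\<dots> = (\<Sum>j\<in>{1 - int m..int m}. \<integral>\<omega>. dev j \<omega> * origin_rate \<omega> \<partial>\<mu>)"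
    by (rule Bochner_Integration.integral_sum) (rule i)
  also have "\<dots> = (\<Sum>j\<in>{0, 1}. \<integral>\<omega>. dev j \<omega> * origin_rate \<omega> \<partial>\<mu>)"
    using m 0 by (intro sum.mono_neutral_right) auto
  also have "\<dots> = (\<integral>\<omega>. dev 0 \<omega> * origin_rate \<omega> + dev 1 \<omega> * origin_rate \<omega> \<partial>\<mu>)"
    using i by simp
  also have "\<dots> = (\<integral>\<omega>. (\<lambda>x. ((of_int (fst x) - \<rho> \<theta>) + (of_int (snd x) - \<rho> \<theta>)) * net_rate x) (\<omega> 0, \<omega> 1) \<partial>\<mu>)"
    by (rule Bochner_Integration.integral_cong[OF refl]) (simp add: dev_def origin_rate_def algebra_simps)
  also have "\<dots> = flux_slope \<theta>"
    unfolding flux_slope_def by (rule integral_iid_pair) simp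
  finally show ?thesis .
qed

text \<open>The initial mass of the block is its mass at time \<open>t\<close>, plus the flow out at
  the right end, minus the flow in at the left end. Splitting the rate into its mean and
  \<open>centred_rate\<close>, the mean multiplies currents with equal expectations and
  cancels.\<close>

lemma window_covariance:
  assumes m: "1 \<le> m"
  shows "(\<integral>x. (\<Sum>j\<in>{1 - int m..int m}. dev j (fst x)) * origin_rate (incr (snd x)) \<partial>joint t)
    = flux_slope \<theta> + (\<integral>x. J (int m) x * centred_rate 0 (incr (snd x)) \<partial>joint t)
        - (\<integral>x. J (- int m) x * centred_rate 0 (incr (snd x)) \<partial>joint t)"
proof -
  interpret P: prob_space "joint t" by (rule prob_space_joint[OF u(2)])
  define S where "S \<omega> = (\<Sum>j\<in>{1 - int m..int m}. dev j \<omega>)" for \<omega>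
  define c where "c = (\<integral>\<omega>. origin_rate \<omega> \<partial>\<mu>)"
  have Sq: "square_integrable \<mu> S" unfolding S_def[abs_def]
    by (rule square_integrable_sum[OF square_integrable_dev])
  have Srm: "(\<lambda>\<omega>. S \<omega> * origin_rate \<omega>) \<in> borel_measurable int_seq_space"
    using Sq measurable_origin_rate unfolding square_integrable_def measurable_of_\<mu> by (intro borel_measurable_times) blast+
  have Sri: "integrable (joint t) (\<lambda>x. S (incr (snd x)) * origin_rate (incr (snd x)))"
    by (rule square_integrable_integrable_mult[OF square_integrable_final[OF u(2) Sq] square_integrable_final[OF u(2) square_integrable_origin_rate]])
  have Jr: "integrable (joint t) (\<lambda>x. J k x * centred_rate 0 (incr (snd x)))" for k
    by (rule square_integrable_integrable_mult[OF square_integrable_J square_integrable_final[OF u(2) square_integrable_centred_rate]])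
  have Ji: "integrable (joint t) (J k)" for k
    by (rule P.square_integrable_imp_integrable[OF square_integrable_J])
  have diff: "S (fst x) = S (incr (snd x)) + J (int m) x - J (- int m) x" for x
    using J_telescope[of "- int m" "int m" x] by (simp add: S_def sum_subtractf add.commute)
  have "(\<integral>x. S (fst x) * origin_rate (incr (snd x)) \<partial>joint t)
      = (\<integral>x. S (incr (snd x)) * origin_rate (incr (snd x)) + (J (int m) x * centred_rate 0 (incr (snd x)) + c * J (int m) x)
          - (J (- int m) x * centred_rate 0 (incr (snd x)) + c * J (- int m) x) \<partial>joint t)"
  proof (rule Bochner_Integration.integral_cong[OF refl])
    fix x :: "int_seq \<times> int_seq"
    have "origin_rate (incr (snd x)) = centred_rate 0 (incr (snd x)) + c" unfolding c_def by (rule origin_rate_centred_rate)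
    then show "S (fst x) * origin_rate (incr (snd x))
      = S (incr (snd x)) * origin_rate (incr (snd x)) + (J (int m) x * centred_rate 0 (incr (snd x)) + c * J (int m) x)
          - (J (- int m) x * centred_rate 0 (incr (snd x)) + c * J (- int m) x)"
      unfolding diff[of x] by (simp add: algebra_simps)
  qed
  also have "\<dots> = (\<integral>x. S (incr (snd x)) * origin_rate (incr (snd x)) \<partial>joint t)
      + ((\<integral>x. J (int m) x * centred_rate 0 (incr (snd x)) \<partial>joint t) + c * (\<integral>x. J (int m) x \<partial>joint t))
      - ((\<integral>x. J (- int m) x * centred_rate 0 (incr (snd x)) \<partial>joint t) + c * (\<integral>x. J (- int m) x \<partial>joint t))"
    using Sri Jr Ji by simp
  also have "(\<integral>x. S (incr (snd x)) * origin_rate (incr (snd x)) \<partial>joint t) = flux_slope \<theta>"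
    using integral_final[OF u(2) Srm] integral_dev_origin_rate[OF m] by (simp add: S_def)
  finally show ?thesis
    using J_mean_shift[of "int m"] J_mean_shift[of "- int m"] by (simp add: S_def)
qed

text \<open>Uniform in \<open>k\<close> and in the time up to \<open>u\<close>; this dominates the
  boundary terms when the limit is taken under the time integral.\<close>

lemma J_centred_rate_bound: "\<bar>\<integral>x. J k x * centred_rate 0 (incr (snd x)) \<partial>joint t\<bar> \<le> (height_bound u + (\<integral>\<omega>. (centred_rate 0 \<omega>)\<^sup>2 \<partial>\<mu>)) / 2"
proof -
  have "\<bar>\<integral>x. J k x * centred_rate 0 (incr (snd x)) \<partial>joint t\<bar>
      \<le> ((\<integral>x. (J k x)\<^sup>2 \<partial>joint t) + (\<integral>x. (centred_rate 0 (incr (snd x)))\<^sup>2 \<partial>joint t)) / 2"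
    by (rule square_integrable_mult_bound[OF square_integrable_J square_integrable_final[OF u(2) square_integrable_centred_rate]])
  also have "(\<integral>x. (centred_rate 0 (incr (snd x)))\<^sup>2 \<partial>joint t) = (\<integral>\<omega>. (centred_rate 0 \<omega>)\<^sup>2 \<partial>\<mu>)"
    by (rule integral_final[OF u(2) borel_measurable_power[OF measurable_centred_rate]])
  finally show ?thesis using J_second_moment[of k] by simp
qed

end

lemma sum_height_cov_tendsto:
  assumes t: "0 < t"
  shows "(\<lambda>n. \<Sum>k\<in>{- int (2 * Suc n)..<int (2 * Suc n)}. height_cov t k) \<longlonglongrightarrow> t * flux_slope \<theta>"
proof -
  have t0: "0 \<le> t" using t by simp
  \<comment> \<open>Block ends advance by two, so that the rates paired with them are
    orthogonal.\<close>
  define M where "M n = 2 * Suc n" for n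
  define S where "S n \<omega> = (\<Sum>j\<in>{1 - int (M n)..int (M n)}. dev j \<omega>)" for n \<omega>
  define e where "e k s = (\<integral>x. J k x * centred_rate 0 (incr (snd x)) \<partial>joint s)" for k s
  define B where "B = \<bar>flux_slope \<theta>\<bar> + (height_bound t + (\<integral>\<omega>. (centred_rate 0 \<omega>)\<^sup>2 \<partial>\<mu>))"
  interpret F: finite_measure "window t" by (rule finite_window)
  have Sq: "square_integrable \<mu> (S n)" for n unfolding S_def[abs_def]
    by (rule square_integrable_sum[OF square_integrable_dev])
  have inner: "(\<integral>x. S n (fst x) * origin_rate (incr (snd x)) \<partial>joint s) = flux_slope \<theta> + e (int (M n)) s - e (- int (M n)) s"
    if "0 \<le> s" "s \<le> t" for n s
    unfolding S_def e_def by (rule window_covariance[OF t that]) (simp add: M_def)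
  have "(\<lambda>n. \<integral>s. (\<integral>x. S n (fst x) * origin_rate (incr (snd x)) \<partial>joint s) \<partial>window t) \<longlonglongrightarrow> (\<integral>s. flux_slope \<theta> \<partial>window t)"
  proof (rule integral_dominated_convergence[where w = "\<lambda>_. B"])
    show "(\<lambda>s. \<integral>x. S n (fst x) * origin_rate (incr (snd x)) \<partial>joint s) \<in> borel_measurable (window t)" for n
    proof (rule joint_integral_measurable, rule borel_measurable_times)
      show "(\<lambda>x. S n (fst x)) \<in> borel_measurable pair_space"
        by (rule measurable_compose[OF measurable_fst Sq[of n, unfolded square_integrable_def measurable_of_\<mu>, THEN conjunct1]])
      show "(\<lambda>x. origin_rate (incr (snd x))) \<in> borel_measurable pair_space"
        by (rule measurable_compose[OF measurable_incr_snd measurable_origin_rate])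
    qed
    show "AE s in window t. (\<lambda>n. \<integral>x. S n (fst x) * origin_rate (incr (snd x)) \<partial>joint s) \<longlonglongrightarrow> flux_slope \<theta>"
    proof (rule AE_I2)
      fix s assume "s \<in> space (window t)"
      then have s: "0 \<le> s" "s \<le> t" by simp_all
      have "(\<lambda>n. e (int (M n)) s) \<longlonglongrightarrow> 0"
        unfolding e_def by (rule J_centred_rate_tendsto_0[OF t s]) (auto simp: M_def)
      moreover have "(\<lambda>n. e (- int (M n)) s) \<longlonglongrightarrow> 0"
        unfolding e_def by (rule J_centred_rate_tendsto_0[OF t s]) (auto simp: M_def)
      ultimately have "(\<lambda>n. flux_slope \<theta> + e (int (M n)) s - e (- int (M n)) s) \<longlonglongrightarrow> flux_slope \<theta> + 0 - 0"
        by (intro tendsto_add tendsto_diff tendsto_const)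
      then show "(\<lambda>n. \<integral>x. S n (fst x) * origin_rate (incr (snd x)) \<partial>joint s) \<longlonglongrightarrow> flux_slope \<theta>"
        by (simp add: inner[OF s])
    qed
    show "AE s in window t. norm (\<integral>x. S n (fst x) * origin_rate (incr (snd x)) \<partial>joint s) \<le> B" for n
    proof (rule AE_I2)
      fix s assume "s \<in> space (window t)"
      then have s: "0 \<le> s" "s \<le> t" by simp_all
      have *: "\<bar>c + x - y\<bar> \<le> \<bar>c\<bar> + K" if "\<bar>x\<bar> \<le> K / 2" "\<bar>y\<bar> \<le> K / 2" for c x y K :: real
        using that by linarith
      show "norm (\<integral>x. S n (fst x) * origin_rate (incr (snd x)) \<partial>joint s) \<le> B"
        unfolding inner[OF s] e_def B_def real_norm_def
        by (intro * J_centred_rate_bound[OF t s])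
    qed
  qed simp_all
  also have "(\<integral>s. flux_slope \<theta> \<partial>window t) = t * flux_slope \<theta>" using t0 by (rule integral_window_const)
  finally have lim: "(\<lambda>n. \<integral>s. (\<integral>x. S n (fst x) * origin_rate (incr (snd x)) \<partial>joint s) \<partial>window t) \<longlonglongrightarrow> t * flux_slope \<theta>" .
  have "(\<integral>s. (\<integral>x. S n (fst x) * origin_rate (incr (snd x)) \<partial>joint s) \<partial>window t) = (\<Sum>k\<in>{- int (M n)..<int (M n)}. height_cov t k)" for n
  proof -
    have "(\<integral>s. (\<integral>x. S n (fst x) * origin_rate (incr (snd x)) \<partial>joint s) \<partial>window t) = (\<integral>x. S n (fst x) * J 0 x \<partial>joint t)"
      unfolding J_0 by (rule height_representation[OF t Sq, symmetric])
    also have "\<dots> = (\<integral>x. (\<Sum>j\<in>{1 - int (M n)..int (M n)}. dev j (fst x) * J 0 x) \<partial>joint t)"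
      by (simp only: S_def sum_distrib_right)
    also have "\<dots> = (\<Sum>j\<in>{1 - int (M n)..int (M n)}. \<integral>x. dev j (fst x) * J 0 x \<partial>joint t)"
      by (rule Bochner_Integration.integral_sum) (rule integrable_dev_J[OF t t0 order_refl])
    also have "\<dots> = (\<Sum>j\<in>{1 - int (M n)..int (M n)}. height_cov t (0 - j))"
      by (simp only: covariance_shift[OF t t0 order_refl])
    also have "\<dots> = (\<Sum>k\<in>{- int (M n)..<int (M n)}. height_cov t k)"
      \<comment> \<open>Site \<open>j\<close> contributes the covariance at \<open>- j\<close>; the
        block from \<open>1 - M n\<close> to \<open>M n\<close> therefore becomes the half-open
        range from \<open>- M n\<close> to \<open>M n\<close>.\<close>
      by (rule sum.reindex_bij_witness[where i = uminus and j = uminus]) auto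
    finally show ?thesis .
  qed
  with lim show ?thesis by (simp only: M_def)
qed

end

section \<open>The second class particle\<close>

text \<open>The Markov property at time \<open>0\<close>, with the whole space as past event,
  determines the law at time \<open>t\<close>. The theorem uses nothing else about the
  paths.\<close>

lemma distr_markov_process:
  assumes mp: "markov_process M S P X" and t: "0 \<le> t" and P: "P t \<in> S \<rightarrow>\<^sub>M prob_algebra S"
  shows "distr M S (X t) = distr M S (X 0) \<bind> P t"
proof -
  interpret prob_space M using mp by (simp add: markov_process_def)
  have X: "X u \<in> M \<rightarrow>\<^sub>M S" if "0 \<le> u" for u using mp that by (simp add: markov_process_def)
  have PS: "P t \<in> S \<rightarrow>\<^sub>M subprob_algebra S" using P by (rule measurable_prob_algebraD)
  have ne: "space (distr M S (X 0)) \<noteq> {}"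
    using measurable_space[OF X[of 0]] not_empty by auto
  have PS': "P t \<in> distr M S (X 0) \<rightarrow>\<^sub>M subprob_algebra S"
    unfolding measurable_cong_sets[OF sets_distr refl] by (rule PS)
  have setsB: "sets (distr M S (X 0) \<bind> P t) = sets S"
    by (rule sets_bind_measurable[OF PS' ne])
  show ?thesis
  proof (rule measure_eqI)
    show "sets (distr M S (X t)) = sets (distr M S (X 0) \<bind> P t)" by (simp add: setsB)
    fix B assume "B \<in> sets (distr M S (X t))"
    then have B: "B \<in> sets S" by simp
    have Bm: "(\<lambda>x. measure (P t x) B) \<in> borel_measurable S"
      by (rule measurable_compose[OF PS measurable_measure_subprob_algebra[OF B]])
    have pP: "prob_space (P t (X 0 x))" if "x \<in> space M" for x
      using measurable_space[OF P measurable_space[OF X[of 0] that]] by (simp add: space_prob_algebra)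
    have m: "(\<lambda>x. measure (P t (X 0 x)) B) \<in> borel_measurable M"
      by (rule measurable_compose[OF X[of 0] Bm]) simp
    have i: "integrable M (\<lambda>x. measure (P t (X 0 x)) B)"
      by (rule integrable_const_bound[where B = 1, OF AE_I2 m])
         (use pP in \<open>auto intro: prob_space.prob_le_1\<close>)
    have "space M \<in> past_events M S X 0" unfolding past_events_def by (rule sigma_sets_top)
    then have "measure M (space M \<inter> (X (0 + t) -` B \<inter> space M)) = (LINT x:space M|M. measure (P t (X 0 x)) B)"
      using mp t B unfolding markov_process_def by blast
    then have *: "measure M (X t -` B \<inter> space M) = (\<integral>x. measure (P t (X 0 x)) B \<partial>M)"
      by (simp add: set_integral_space[OF i] Int_absorb1)
    have "emeasure (distr M S (X t)) B = ennreal (measure M (X t -` B \<inter> space M))"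
      by (simp add: emeasure_distr[OF X[OF t] B] emeasure_eq_measure)
    also have "\<dots> = (\<integral>\<^sup>+x. ennreal (measure (P t (X 0 x)) B) \<partial>M)"
      unfolding * by (rule nn_integral_eq_integral[OF i, symmetric]) simp
    also have "\<dots> = (\<integral>\<^sup>+x. emeasure (P t (X 0 x)) B \<partial>M)"
      by (rule nn_integral_cong)
         (simp add: finite_measure.emeasure_eq_measure[OF prob_space.finite_measure[OF pP]])
    also have "\<dots> = (\<integral>\<^sup>+x. emeasure (P t x) B \<partial>distr M S (X 0))"
      by (rule nn_integral_distr[OF X[of 0], symmetric])
         (simp_all add: measurable_compose[OF PS measurable_emeasure_subprob_algebra[OF B]])
    also have "\<dots> = emeasure (distr M S (X 0) \<bind> P t) B"
      by (rule emeasure_bind[OF ne PS' B, symmetric])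
    finally show "emeasure (distr M S (X t)) B = emeasure (distr M S (X 0) \<bind> P t) B" .
  qed
qed

section \<open>Locating the single discrepancy\<close>

definition at_site :: "int \<Rightarrow> (int_seq \<times> int_seq) set" where
  "at_site n = {(g, h). \<forall>i. incr h i = incr g i + delta_conf n i}"

lemma at_site_unique: "y \<in> at_site m \<Longrightarrow> y \<in> at_site n \<Longrightarrow> m = n"
  by (auto simp: at_site_def delta_conf_def split: if_splits dest!: spec[of _ m])

lemma second_class_position_at_site:
  assumes "y \<in> at_site n"
  shows "second_class_position y = n"
proof -
  obtain g h where y: "y = (g, h)" by (cases y)
  have "(THE n. \<forall>i. incr h i = incr g i + delta_conf n i) = n"
    using assms at_site_unique[of y _ n] by (intro the_equality) (auto simp: at_site_def y)
  then show ?thesis by (simp add: second_class_position_def y)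
qed

text \<open>Off all the sets \<open>at_site n\<close> the description ranges over an empty
  predicate, so the position is one fixed unspecified integer. Such pairs have probability zero, but
  measurability has to account for them.\<close>

lemma second_class_position_no_site:
  assumes "\<And>n. y \<notin> at_site n"
  shows "second_class_position y = (THE n. False)"
proof -
  obtain g h where y: "y = (g, h)" by (cases y)
  have "(\<forall>i. incr h i = incr g i + delta_conf n i) = False" for n
    using assms[of n] by (simp add: at_site_def y)
  then show ?thesis unfolding second_class_position_def y split_conv by (simp only:)
qed

lemma measurable_incr_pair:
  "(\<lambda>y. incr (fst y) i) \<in> pair_space \<rightarrow>\<^sub>M count_space UNIV"
  "(\<lambda>y. incr (snd y) i) \<in> pair_space \<rightarrow>\<^sub>M count_space UNIV"
  by (rule measurable_compose[OF measurable_fst measurable_compose[OF measurable_incr measurable_coordinate]]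
      measurable_compose[OF measurable_snd measurable_compose[OF measurable_incr measurable_coordinate]])+

lemma space_pair_space: "space pair_space = UNIV"
  by (simp add: space_pair_measure)

lemma at_site_sets: "at_site n \<in> sets pair_space"
proof -
  have 1: "{y. incr (snd y) i = incr (fst y) i + delta_conf n i} \<in> sets pair_space" for i
  proof -
    have "(\<lambda>y. incr (snd y) i = incr (fst y) i + delta_conf n i) \<in> pair_space \<rightarrow>\<^sub>M (count_space UNIV :: bool measure)"
      by (rule measurable_int2[OF measurable_incr_pair(2) measurable_incr_pair(1), where F = "\<lambda>u v. u = v + delta_conf n i"]) simp
    from measurable_sets[OF this, of "{True}"] show ?thesis
      by (simp add: vimage_def space_pair_space)
  qed
  have "(\<Inter>i\<in>UNIV. {y. incr (snd y) i = incr (fst y) i + delta_conf n i}) \<in> sets pair_space"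
    by (rule sets.countable_INT'') (use 1 space_pair_space sets.top[of pair_space] in auto)
  moreover have "at_site n = (\<Inter>i\<in>UNIV. {y. incr (snd y) i = incr (fst y) i + delta_conf n i})"
    by (auto simp: at_site_def)
  ultimately show ?thesis by simp
qed

lemma measurable_second_class_position: "second_class_position \<in> pair_space \<rightarrow>\<^sub>M count_space UNIV"
proof -
  have G: "(\<Union>n. at_site n) \<in> sets pair_space"
    by (rule sets.countable_UN) (use at_site_sets in auto)
  have "second_class_position -` {k} \<inter> space pair_space \<in> sets pair_space" for k
  proof -
    \<comment> \<open>The level set of the default value also contains every pair that does not
      differ by exactly one particle.\<close>
    have eq: "second_class_position -` {k} \<inter> space pair_space
        = at_site k \<union> (if k = (THE n. False) then space pair_space - (\<Union>n. at_site n) else {})"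
    proof (rule set_eqI)
      fix y
      show "y \<in> second_class_position -` {k} \<inter> space pair_space
        \<longleftrightarrow> y \<in> at_site k \<union> (if k = (THE n. False) then space pair_space - (\<Union>n. at_site n) else {})"
      proof (cases "\<exists>n. y \<in> at_site n")
        case True
        then obtain n where n: "y \<in> at_site n" by blast
        then show ?thesis
          using second_class_position_at_site[OF n] at_site_unique[OF n, of k] by (auto simp: space_pair_space)
      next
        case False
        then show ?thesis using second_class_position_no_site[of y] by (auto simp: space_pair_space)
      qed
    qed
    show ?thesis unfolding eq using at_site_sets[of k] sets.compl_sets[OF G] by (cases "k = (THE n. False)") auto
  qed
  then show ?thesis
    unfolding measurable_count_space_eq_countable[OF countableI_type] by (intro conjI ballI Pi_I UNIV_I)
qed

text \<open>For an ordered pair each differing site contributes at least one to the total, so a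
  total of one leaves a single site with difference one.\<close>

lemma at_site_of_discrepancy:
  assumes le: "incr g \<le> incr h" and fin: "finite_discrepancy (g, h)" and one: "total_discrepancy (g, h) = 1"
  shows "\<exists>n. (g, h) \<in> at_site n"
proof -
  define D where "D = {i. incr g i \<noteq> incr h i}"
  have D: "finite D" using fin by (simp add: finite_discrepancy_def D_def)
  have ge: "1 \<le> incr h i - incr g i" if "i \<in> D" for i
    using that le_funD[OF le, of i] by (auto simp: D_def)
  have sum: "(\<Sum>i\<in>D. incr h i - incr g i) = 1" using one by (simp add: total_discrepancy_def D_def)
  then obtain n where n: "n \<in> D" by (metis ex_in_conv sum.empty zero_neq_one)
  have split: "(\<Sum>i\<in>D. incr h i - incr g i) = (incr h n - incr g n) + (\<Sum>i\<in>D - {n}. incr h i - incr g i)"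
    by (rule sum.remove[OF D n])
  have "int (card (D - {n})) \<le> (\<Sum>i\<in>D - {n}. incr h i - incr g i)"
    using sum_bounded_below[of "D - {n}" 1 "\<lambda>i. incr h i - incr g i"] ge by simp
  then have "card (D - {n}) = 0" "incr h n - incr g n = 1"
    using split sum ge[OF n] by linarith+
  from this(1) have "D - {n} = {}" by (rule card_0_eq[OF finite_Diff[OF D], THEN iffD1])
  then have "i \<notin> D" if "i \<noteq> n" for i using that by blast
  then have off: "incr h i = incr g i" if "i \<noteq> n" for i
    using that by (simp add: D_def)
  have "incr h i = incr g i + delta_conf n i" for i
    using off[of i] \<open>incr h n - incr g n = 1\<close> by (cases "i = n") (simp_all add: delta_conf_def)
  then have "(g, h) \<in> at_site n" by (simp add: at_site_def)
  then show ?thesis ..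
qed

text \<open>The layer-cake formula on the integers: \<open>z\<close> is the number of nonnegative
  levels below it minus the number of negative levels at or above it, and clamping keeps the levels
  from \<open>- m\<close> to \<open>m - 1\<close>. Integrated, it turns means into sums of tail
  probabilities.\<close>

lemma clamp_int_layers:
  "clamp_int m z = (\<Sum>k\<in>{0..<int m}. if k < z then 1 else 0) - (\<Sum>k\<in>{- int m..<0}. if z \<le> k then 1 else 0)"
  "\<bar>clamp_int m z\<bar> = (\<Sum>k\<in>{0..<int m}. if k < z then 1 else 0) + (\<Sum>k\<in>{- int m..<0}. if z \<le> k then 1 else 0)"
proof -
  have 1: "(\<Sum>k\<in>{0..<int m}. if k < z then 1 else 0) = real (card {0..<min (int m) z})"
  proof -
    have "{k \<in> {0..<int m}. k < z} = {0..<min (int m) z}" by auto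
    then show ?thesis by (simp add: sum.inter_filter[symmetric])
  qed
  have 2: "(\<Sum>k\<in>{- int m..<0}. if z \<le> k then 1 else 0) = real (card {max (- int m) z..<0})"
  proof -
    have "{k \<in> {- int m..<0}. z \<le> k} = {max (- int m) z..<0}" by auto
    then show ?thesis by (simp add: sum.inter_filter[symmetric])
  qed
  show "clamp_int m z = (\<Sum>k\<in>{0..<int m}. if k < z then 1 else 0) - (\<Sum>k\<in>{- int m..<0}. if z \<le> k then 1 else 0)"
    "\<bar>clamp_int m z\<bar> = (\<Sum>k\<in>{0..<int m}. if k < z then 1 else 0) + (\<Sum>k\<in>{- int m..<0}. if z \<le> k then 1 else 0)"
    unfolding 1 2 by (auto simp: clamp_int_def min_def max_def)
qed

text \<open>\<open>c\<close> lists the upper tails at nonnegative levels and minus the lower tails at negative levels.\<close>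

lemma mean_from_tails:
  fixes D :: "int measure" and c :: "int \<Rightarrow> real"
  assumes D: "prob_space D" and sets: "sets D = UNIV"
    and pos: "\<And>k. 0 \<le> k \<Longrightarrow> measure D {k<..} = c k" and neg: "\<And>k. k < 0 \<Longrightarrow> measure D {..k} = - c k"
    and bound: "\<And>m. (\<Sum>k\<in>{0..<int m}. c k) - (\<Sum>k\<in>{- int m..<0}. c k) \<le> B"
    and lim: "(\<lambda>n. \<Sum>k\<in>{- int (M n)..<int (M n)}. c k) \<longlonglongrightarrow> L" and M: "strict_mono M"
  shows "integrable D (\<lambda>z. of_int z :: real)" and "(\<integral>z. of_int z \<partial>D) = L"
proof -
  interpret D: prob_space D by (rule D)
  have meas: "F \<in> borel_measurable D" for F :: "int \<Rightarrow> real"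
    using sets by (auto intro!: measurableI)
  have sp: "space D = UNIV" using sets sets_eq_imp_space_eq[of D "count_space UNIV"] by simp
  have ind: "integrable D (\<lambda>z. if z \<in> A then 1 else 0 :: real)" "(\<integral>z. (if z \<in> A then 1 else 0) \<partial>D) = measure D A" for A
  proof -
    have eq: "(\<lambda>z. if z \<in> A then 1 else 0 :: real) = indicator A" by (auto simp: indicator_def)
    show "integrable D (\<lambda>z. if z \<in> A then 1 else 0 :: real)" "(\<integral>z. (if z \<in> A then 1 else 0) \<partial>D) = measure D A"
      unfolding eq using sets sp by (auto simp: less_top[symmetric])
  qed
  note up = ind[of "{k<..}" for k, simplified] and lo = ind[of "{..k}" for k, simplified]
  have ci: "integrable D (clamp_int m)" for m
    by (rule D.integrable_const_bound[where B = "real m"]) (auto intro!: AE_I2 abs_clamp_int_le meas)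
  have cI: "(\<integral>z. clamp_int m z \<partial>D) = (\<Sum>k\<in>{0..<int m}. measure D {k<..}) - (\<Sum>k\<in>{- int m..<0}. measure D {..k})" for m
    unfolding clamp_int_layers(1) using up lo by simp
  have cA: "(\<integral>z. \<bar>clamp_int m z\<bar> \<partial>D) = (\<Sum>k\<in>{0..<int m}. measure D {k<..}) + (\<Sum>k\<in>{- int m..<0}. measure D {..k})" for m
    unfolding clamp_int_layers(2) using up lo by simp
  have cA': "(\<integral>z. \<bar>clamp_int m z\<bar> \<partial>D) \<le> B" for m
  proof -
    have "(\<integral>z. \<bar>clamp_int m z\<bar> \<partial>D) = (\<Sum>k\<in>{0..<int m}. c k) - (\<Sum>k\<in>{- int m..<0}. c k)"
      unfolding cA using pos neg by (simp add: sum_negf)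
    then show ?thesis using bound[of m] by simp
  qed
  have cI': "(\<integral>z. clamp_int m z \<partial>D) = (\<Sum>k\<in>{- int m..<int m}. c k)" for m
  proof -
    have "{- int m..<int m} = {- int m..<0} \<union> {0..<int m}" by auto
    then have "(\<Sum>k\<in>{- int m..<int m}. c k) = (\<Sum>k\<in>{- int m..<0}. c k) + (\<Sum>k\<in>{0..<int m}. c k)"
      by (simp only:) (rule sum.union_disjoint; auto)
    then show ?thesis unfolding cI using pos neg by (simp add: sum_negf)
  qed
  have inc: "incseq (\<lambda>m. \<integral>z. \<bar>clamp_int m z\<bar> \<partial>D)"
    using clamp_int_mono by (intro incseq_SucI integral_mono integrable_abs ci) auto
  obtain l where l: "(\<lambda>m. \<integral>z. \<bar>clamp_int m z\<bar> \<partial>D) \<longlonglongrightarrow> l"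
    using incseq_convergent[OF inc, of B] cA' by blast
  have "integrable D (\<lambda>z. \<bar>of_int z :: real\<bar>)"
  proof (rule integrable_monotone_convergence[OF integrable_abs[OF ci] _ _ l meas])
    show "AE z in D. mono (\<lambda>m. \<bar>clamp_int m z\<bar>)" using clamp_int_mono by (intro AE_I2 monoI)
    show "AE z in D. (\<lambda>m. \<bar>clamp_int m z\<bar>) \<longlonglongrightarrow> \<bar>of_int z\<bar>"
      by (intro AE_I2 tendsto_rabs clamp_int_tendsto)
  qed
  then show int: "integrable D (\<lambda>z. of_int z :: real)"
    by (rule integrable_abs_cancel[OF _ meas])
  \<comment> \<open>Absolute integrability, obtained from the bound on the sums of tails, gives
    convergence along all \<open>m\<close>. The limit may then be identified along the subsequence
    \<open>M\<close>, for which alone the symmetric sums are known to converge.\<close>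
  have "(\<lambda>m. \<integral>z. clamp_int m z \<partial>D) \<longlonglongrightarrow> (\<integral>z. of_int z \<partial>D)"
    by (rule integral_dominated_convergence[where w = "\<lambda>z. \<bar>of_int z\<bar>", OF meas meas integrable_abs[OF int]])
       (auto intro!: AE_I2 clamp_int_tendsto abs_clamp_int_le_abs)
  then have "(\<lambda>n. \<integral>z. clamp_int (M n) z \<partial>D) \<longlonglongrightarrow> (\<integral>z. of_int z \<partial>D)"
    using M by (rule LIMSEQ_subseq_LIMSEQ[unfolded comp_def])
  then show "(\<integral>z. of_int z \<partial>D) = L"
    using LIMSEQ_unique[OF _ lim] unfolding cI' by blast
qed

section \<open>Law and mean of the second class particle\<close>

context equilibrium
begin

abbreviation \<mu>hat :: "int_seq measure" where "\<mu>hat \<equiv> iid_except (hat_pmf \<theta>) site"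

definition start :: "int_seq \<Rightarrow> int_seq \<times> int_seq" where
  "start \<omega> = (height_of \<omega>, height_of (\<lambda>i. \<omega> i + delta_conf 0 i))"

definition particle_law :: "real \<Rightarrow> (int_seq \<times> int_seq) measure" where
  "particle_law t = \<mu>hat \<bind> (\<lambda>\<omega>. K t (start \<omega>))"

sublocale \<mu>hat: prob_space \<mu>hat
  by (rule prob_space_iid_except)

lemma space_\<mu>hat: "space \<mu>hat = UNIV"
  using sets_eq_imp_space_eq[OF sets_iid_except] by simp

lemma measurable_start: "start \<in> \<mu>hat \<rightarrow>\<^sub>M pair_space"
  unfolding measurable_cong_sets[OF sets_iid_except refl] start_def[abs_def]
  by (rule measurable_Pair[OF measurable_height_of measurable_compose[OF measurable_plus_delta measurable_height_of]])

lemma K_kernel: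
  assumes t: "0 \<le> t"
  shows "K t \<in> pair_space \<rightarrow>\<^sub>M prob_algebra pair_space"
proof -
  have K: "(\<lambda>(t, x). K t x) \<in> times \<Otimes>\<^sub>M pair_space \<rightarrow>\<^sub>M prob_algebra pair_space"
    using coupled_semigroup by (simp add: markov_semigroup_def)
  have "Pair t \<in> pair_space \<rightarrow>\<^sub>M times \<Otimes>\<^sub>M pair_space"
    by (rule measurable_Pair1') (use t in \<open>simp add: space_restrict_space\<close>)
  from measurable_compose[OF this K] show ?thesis by simp
qed

lemma K_start_kernel: "0 \<le> t \<Longrightarrow> (\<lambda>\<omega>. K t (start \<omega>)) \<in> \<mu>hat \<rightarrow>\<^sub>M prob_algebra pair_space"
  by (rule measurable_compose[OF measurable_start K_kernel])

lemma distr_process_particle_law: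
  assumes t: "0 \<le> t" and mp: "markov_process M pair_space K X"
    and X0: "distr M pair_space (X 0) = second_class_start wmin wmax f \<theta>"
  shows "distr M pair_space (X t) = particle_law t"
proof -
  have "distr M pair_space (X t) = distr \<mu>hat pair_space start \<bind> K t"
    unfolding distr_markov_process[OF mp t K_kernel[OF t]] X0 second_class_start_def hat_measure_eq[OF \<theta>]
      start_def[abs_def] ..
  also have "\<dots> = particle_law t"
    unfolding particle_law_def
    by (rule bind_distr[OF measurable_start measurable_prob_algebraD[OF K_kernel[OF t]]]) (simp add: space_\<mu>hat)
  finally show ?thesis .
qed

lemma prob_space_particle_law: "0 \<le> t \<Longrightarrow> prob_space (particle_law t)"
  and sets_particle_law: "0 \<le> t \<Longrightarrow> sets (particle_law t) = sets pair_space"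
proof -
  assume t: "0 \<le> t"
  have "\<mu>hat \<in> space (prob_algebra \<mu>hat)" by (simp add: space_prob_algebra \<mu>hat.prob_space_axioms)
  from prob_space_bind'[OF this K_start_kernel[OF t]] show "prob_space (particle_law t)"
    unfolding particle_law_def .
  show "sets (particle_law t) = sets pair_space" unfolding particle_law_def
    by (rule sets_bind_measurable[OF measurable_prob_algebraD[OF K_start_kernel[OF t]]]) (simp add: space_\<mu>hat)
qed

lemma start_regular: "AE \<omega> in \<mu>hat. start \<omega> \<in> regular_pairs T"
  using AE_hat_measure[OF \<theta> T_sets AE_T]
proof eventually_elim
  case (elim \<omega>)
  have "incr (height_of \<omega>) \<le> incr (height_of (\<lambda>i. \<omega> i + delta_conf 0 i))"
    by (simp add: incr_height_of le_fun_def delta_conf_def)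
  then show ?case using elim by (simp add: start_def regular_pairs_def incr_height_of)
qed

lemma start_discrepancy: "finite_discrepancy (start \<omega>)" "total_discrepancy (start \<omega>) = 1"
proof -
  have "{i. incr (height_of \<omega>) i \<noteq> incr (height_of (\<lambda>i. \<omega> i + delta_conf 0 i)) i} = {0}"
    by (auto simp: incr_height_of delta_conf_def)
  then show "finite_discrepancy (start \<omega>)" "total_discrepancy (start \<omega>) = 1"
    by (simp_all add: start_def finite_discrepancy_def total_discrepancy_def incr_height_of delta_conf_def)
qed

text \<open>The coupled process stays ordered and keeps its total discrepancy, initially one at the
  origin. Hence at time \<open>t\<close> the position is almost surely determined by a true
  discrepancy and not by the default value.\<close>

lemma AE_particle_law_at_site:
  assumes t: "0 \<le> t"
  shows "AE y in particle_law t. \<exists>n. y \<in> at_site n"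
proof -
  have G: "{y. \<exists>n. y \<in> at_site n} \<in> sets pair_space"
  proof -
    have "(\<Union>n. at_site n) \<in> sets pair_space" by (rule sets.countable_UN) (use at_site_sets in auto)
    moreover have "{y. \<exists>n. y \<in> at_site n} = (\<Union>n. at_site n)" by auto
    ultimately show ?thesis by simp
  qed
  have P: "Measurable.pred pair_space (\<lambda>y. \<exists>n. y \<in> at_site n)"
    using G by (simp add: pred_def space_pair_space)
  have "AE \<omega> in \<mu>hat. AE y in K t (start \<omega>). \<exists>n. y \<in> at_site n"
    using start_regular
  proof eventually_elim
    case (elim \<omega>)
    have "AE y in K t (start \<omega>). y \<in> regular_pairs T"
      using coupled_semigroup elim t by (simp add: markov_semigroup_def)
    moreover have "AE y in K t (start \<omega>). finite_discrepancy y \<and> total_discrepancy y = 1"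
      using coupled_discrepancy[OF t elim start_discrepancy(1)] by (simp add: start_discrepancy(2))
    ultimately show ?case
    proof eventually_elim
      case (elim y)
      then show ?case using at_site_of_discrepancy[of "fst y" "snd y"]
        by (cases y) (auto simp: regular_pairs_def)
    qed
  qed
  then show ?thesis
    unfolding particle_law_def AE_bind[OF measurable_prob_algebraD[OF K_start_kernel[OF t]] P] .
qed

text \<open>Apply the summation by parts identity for \<open>\<mu>hat\<close> to \<open>\<omega> \<mapsto> E\<^sup>\<omega> (\<omega>\<^sub>n(t))\<close>, clamped to be bounded;
  the coupling turns the difference into the expected discrepancy at site \<open>n\<close>.\<close>

lemma particle_law_at_site:
  assumes t: "0 < t"
  shows "measure (particle_law t) (at_site n) = two_point t n / V \<theta>"
proof -
  have t0: "0 \<le> t" using t by simp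
  interpret L: prob_space "particle_law t" by (rule prob_space_particle_law[OF t0])
  interpret Jt: prob_space "joint t" by (rule prob_space_joint[OF t0])
  define C where "C N h = clamp_int N (incr h n)" for N and h :: int_seq
  define D where "D N y = C N (snd y) - C N (fst y)" for N and y :: "int_seq \<times> int_seq"
  define F where "F N \<omega> = (\<integral>h. C N h \<partial>P t (height_of \<omega>))" for N \<omega>
  have Cm: "C N \<in> borel_measurable int_seq_space" for N
    unfolding C_def[abs_def]
    by (rule measurable_compose[OF measurable_compose[OF measurable_incr measurable_coordinate]]) simp
  have Cb: "\<bar>C N h\<bar> \<le> real N" for N h unfolding C_def by (rule abs_clamp_int_le)
  have Dm: "D N \<in> borel_measurable pair_space" for N
    unfolding D_def[abs_def]
    by (rule borel_measurable_diff[OF measurable_compose[OF measurable_snd Cm] measurable_compose[OF measurable_fst Cm]])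
  have Fm: "F N \<in> borel_measurable int_seq_space" for N
    unfolding F_def[abs_def]
    by (rule measurable_compose[OF measurable_prob_algebraD[OF at_time[OF t0 kernel_height]] integral_measurable_subprob_algebra[OF Cm]])
  have Ci: "integrable Q (C N)" if "prob_space Q" "sets Q = sets int_seq_space" for Q N
  proof -
    interpret prob_space Q by fact
    have "C N \<in> borel_measurable Q"
      unfolding measurable_cong_sets[OF that(2) refl] by (rule Cm)
    then show ?thesis
      by (rule integrable_const_bound[where B = "real N", rotated]) (simp add: Cb)
  qed
  have Fb: "\<bar>F N \<omega>\<bar> \<le> real N" for N \<omega>
  proof -
    interpret Q: prob_space "P t (height_of \<omega>)" by (rule prob_space_P[OF t0])
    have "\<bar>F N \<omega>\<bar> \<le> (\<integral>h. \<bar>C N h\<bar> \<partial>P t (height_of \<omega>))" unfolding F_def by (rule integral_abs_bound)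
    also have "\<dots> \<le> (\<integral>h. real N \<partial>P t (height_of \<omega>))"
      by (intro integral_mono integrable_abs Ci Q.prob_space_axioms sets_P[OF t0] Cb) simp
    also have "\<dots> = real N" by (simp add: Q.prob_space)
    finally show ?thesis .
  qed
  have coupled: "F N (\<lambda>i. \<omega> i + delta_conf 0 i) - F N \<omega> = (\<integral>y. D N y \<partial>K t (start \<omega>))"
    if reg: "start \<omega> \<in> regular_pairs T" for N \<omega>
  proof -
    have Ks: "prob_space (K t (start \<omega>))" "sets (K t (start \<omega>)) = sets pair_space"
      using measurable_space[OF K_kernel[OF t0], of "start \<omega>"] by (simp_all add: space_pair_space space_prob_algebra)
    have mK: "fst \<in> K t (start \<omega>) \<rightarrow>\<^sub>M int_seq_space" "snd \<in> K t (start \<omega>) \<rightarrow>\<^sub>M int_seq_space"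
      unfolding measurable_cong_sets[OF Ks(2) refl] by (rule measurable_fst, rule measurable_snd)
    note marg = coupled_marginals[OF t0 reg[unfolded start_def]]
    have d: "distr (K t (start \<omega>)) int_seq_space fst = P t (height_of \<omega>)"
      "distr (K t (start \<omega>)) int_seq_space snd = P t (height_of (\<lambda>i. \<omega> i + delta_conf 0 i))"
      using marg unfolding start_def by simp_all
    have e: "F N \<omega> = (\<integral>y. C N (fst y) \<partial>K t (start \<omega>))" "F N (\<lambda>i. \<omega> i + delta_conf 0 i) = (\<integral>y. C N (snd y) \<partial>K t (start \<omega>))"
      unfolding F_def d[symmetric] by (rule integral_distr[OF mK(1) Cm], rule integral_distr[OF mK(2) Cm])
    have i: "integrable (K t (start \<omega>)) (\<lambda>y. C N (fst y))" "integrable (K t (start \<omega>)) (\<lambda>y. C N (snd y))"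
      using Ci[OF prob_space_P[OF t0] sets_P[OF t0]]
        integrable_distr_eq[OF mK(1) Cm] integrable_distr_eq[OF mK(2) Cm] unfolding d by blast+
    show ?thesis unfolding e D_def using i by simp
  qed
  have eq: "(\<integral>y. D N y \<partial>particle_law t) = (\<integral>x. dev 0 (fst x) * C N (snd x) \<partial>joint t) / V \<theta>" for N
  proof -
    have Di: "integrable (particle_law t) (D N)"
    proof (rule L.integrable_const_bound[where B = "2 * real N"])
      show "AE y in particle_law t. norm (D N y) \<le> 2 * real N"
      proof (rule AE_I2)
        show "norm (D N y) \<le> 2 * real N" for y
          using Cb[of N "fst y"] Cb[of N "snd y"] unfolding D_def real_norm_def by linarith
      qed
      show "D N \<in> borel_measurable (particle_law t)"
        unfolding measurable_cong_sets[OF sets_particle_law[OF t0] refl] by (rule Dm)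
    qed
    have "(\<integral>y. D N y \<partial>particle_law t) = (\<integral>\<omega>. (\<integral>y. D N y \<partial>K t (start \<omega>)) \<partial>\<mu>hat)"
      using integral_bind_kernel[OF K_start_kernel[OF t0] Di[unfolded particle_law_def] Dm]
      by (simp add: particle_law_def space_\<mu>hat)
    also have "\<dots> = (\<integral>\<omega>. F N (\<lambda>i. \<omega> i + delta_conf 0 i) - F N \<omega> \<partial>\<mu>hat)"
    proof (rule integral_cong_AE)
      show "(\<lambda>\<omega>. \<integral>y. D N y \<partial>K t (start \<omega>)) \<in> borel_measurable \<mu>hat"
        by (rule measurable_compose[OF measurable_prob_algebraD[OF K_start_kernel[OF t0]] integral_measurable_subprob_algebra[OF Dm]])
      show "(\<lambda>\<omega>. F N (\<lambda>i. \<omega> i + delta_conf 0 i) - F N \<omega>) \<in> borel_measurable \<mu>hat"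
        unfolding measurable_cong_sets[OF sets_iid_except refl]
        by (rule borel_measurable_diff[OF measurable_compose[OF measurable_plus_delta Fm] Fm])
      show "AE \<omega> in \<mu>hat. (\<integral>y. D N y \<partial>K t (start \<omega>)) = F N (\<lambda>i. \<omega> i + delta_conf 0 i) - F N \<omega>"
        using start_regular by eventually_elim (simp add: coupled)
    qed
    also have "\<dots> = (\<integral>\<omega>. dev 0 \<omega> * F N \<omega> \<partial>\<mu>) / V \<theta>"
      unfolding dev_def by (rule hat_measure_difference[OF \<theta> Fm Fb])
    also have "(\<integral>\<omega>. dev 0 \<omega> * F N \<omega> \<partial>\<mu>) = (\<integral>x. dev 0 (fst x) * C N (snd x) \<partial>joint t)"
    proof -
      have m: "(\<lambda>x. dev 0 (fst x) * C N (snd x)) \<in> borel_measurable pair_space"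
        by (rule borel_measurable_times[OF measurable_compose[OF measurable_fst measurable_dev] measurable_compose[OF measurable_snd Cm]])
      have i: "integrable (joint t) (\<lambda>x. dev 0 (fst x) * C N (snd x))"
        by (rule square_integrable_integrable_mult[OF square_integrable_initial[OF t0 square_integrable_dev]
            Jt.square_integrable_bounded[OF measurable_joint[OF t0 measurable_compose[OF measurable_snd Cm]] Cb]])
      show ?thesis unfolding integral_joint[OF t0 m i] integral_\<kappa>[OF t0 m] F_def by simp
    qed
    finally show ?thesis .
  qed
  \<comment> \<open>The two configurations differ by zero or one at site \<open>n\<close>, and
    clamping does not enlarge a unit step, so the constant one dominates.\<close>
  have lhs: "(\<lambda>N. \<integral>y. D N y \<partial>particle_law t) \<longlonglongrightarrow> (\<integral>y. indicator (at_site n) y \<partial>particle_law t)"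
  proof (rule integral_dominated_convergence[where w = "\<lambda>_. 1"])
    show "indicator (at_site n) \<in> borel_measurable (particle_law t)"
      by (rule borel_measurable_indicator) (simp add: sets_particle_law[OF t0] at_site_sets)
    show "D N \<in> borel_measurable (particle_law t)" for N
      unfolding measurable_cong_sets[OF sets_particle_law[OF t0] refl] by (rule Dm)
    have site: "incr (snd y) n = incr (fst y) n + (if k = n then 1 else 0)" if "y \<in> at_site k" for y k
      using that by (cases y) (auto simp: at_site_def delta_conf_def)
    show "AE y in particle_law t. (\<lambda>N. D N y) \<longlonglongrightarrow> indicator (at_site n) y"
      using AE_particle_law_at_site[OF t0]
    proof eventually_elim
      case (elim y)
      then obtain k where k: "y \<in> at_site k" by blast
      have "(\<lambda>N. D N y) \<longlonglongrightarrow> of_int (incr (snd y) n) - of_int (incr (fst y) n)"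
        unfolding D_def C_def by (intro tendsto_diff clamp_int_tendsto)
      moreover have "of_int (incr (snd y) n) - of_int (incr (fst y) n) = (indicator (at_site n) y :: real)"
        using site[OF k] at_site_unique[OF k, of n] k by (auto simp: indicator_def)
      ultimately show ?case by simp
    qed
    show "AE y in particle_law t. norm (D N y) \<le> 1" for N
      using AE_particle_law_at_site[OF t0]
    proof eventually_elim
      case (elim y)
      then obtain k where k: "y \<in> at_site k" by blast
      show ?case using site[OF k] clamp_int_step[of N "incr (fst y) n"] by (simp add: D_def C_def)
    qed
  qed simp
  have cm: "(\<lambda>x. clamp_int N (incr (snd x) n)) \<in> borel_measurable (joint t)" for N
    using measurable_joint[OF t0 measurable_compose[OF measurable_snd Cm[of N]]] by (simp only: C_def)
  have om: "(\<lambda>x. of_int (incr (snd x) n) :: real) \<in> borel_measurable (joint t)"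
    by (rule measurable_joint[OF t0 measurable_compose[OF measurable_incr_pair(2)]]) simp
  have sqn: "square_integrable (joint t) (\<lambda>x. of_int (incr (snd x) n))"
    using square_integrable_add[OF square_integrable_final[OF t0 square_integrable_dev[of n]] Jt.square_integrable_const[of "\<rho> \<theta>"]]
    by (simp only: dev_def diff_add_cancel)
  have d0m: "(\<lambda>x. dev 0 (fst x)) \<in> borel_measurable (joint t)"
    by (rule measurable_joint[OF t0 measurable_compose[OF measurable_fst measurable_dev]])
  have rhs: "(\<lambda>N. \<integral>x. dev 0 (fst x) * C N (snd x) \<partial>joint t) \<longlonglongrightarrow> (\<integral>x. dev 0 (fst x) * of_int (incr (snd x) n) \<partial>joint t)"
    unfolding C_def
  proof (rule integral_dominated_convergence[where w = "\<lambda>x. \<bar>dev 0 (fst x) * of_int (incr (snd x) n)\<bar>"])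
    show "integrable (joint t) (\<lambda>x. \<bar>dev 0 (fst x) * of_int (incr (snd x) n)\<bar>)"
      by (rule integrable_abs[OF square_integrable_integrable_mult[OF square_integrable_initial[OF t0 square_integrable_dev] sqn]])
    show "AE x in joint t. (\<lambda>N. dev 0 (fst x) * clamp_int N (incr (snd x) n)) \<longlonglongrightarrow> dev 0 (fst x) * of_int (incr (snd x) n)"
      by (intro AE_I2 tendsto_mult_left clamp_int_tendsto)
    show "AE x in joint t. norm (dev 0 (fst x) * clamp_int N (incr (snd x) n)) \<le> \<bar>dev 0 (fst x) * of_int (incr (snd x) n)\<bar>" for N
      using abs_clamp_int_le_abs by (intro AE_I2) (simp add: abs_mult mult_left_mono)
  qed (rule borel_measurable_times[OF d0m om] borel_measurable_times[OF d0m cm])+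
  \<comment> \<open>Centring the increment at time \<open>t\<close> changes nothing, since
    \<open>dev 0\<close> has mean zero.\<close>
  have "(\<integral>x. dev 0 (fst x) * of_int (incr (snd x) n) \<partial>joint t)
      = (\<integral>x. dev 0 (fst x) * dev n (incr (snd x)) + \<rho> \<theta> * dev 0 (fst x) \<partial>joint t)"
    by (rule Bochner_Integration.integral_cong[OF refl]) (simp add: dev_def algebra_simps)
  also have "\<dots> = two_point t n + \<rho> \<theta> * (\<integral>x. dev 0 (fst x) \<partial>joint t)"
    using square_integrable_integrable_mult[OF square_integrable_initial[OF t0 square_integrable_dev[of 0]] square_integrable_final[OF t0 square_integrable_dev[of n]]]
      Jt.square_integrable_imp_integrable[OF square_integrable_initial[OF t0 square_integrable_dev[of 0]]]
    by (simp add: two_point_def)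
  also have "\<dots> = two_point t n" using integral_initial[OF t0 measurable_dev[of 0]] integral_dev[of 0] by simp
  finally have "(\<lambda>N. (\<integral>x. dev 0 (fst x) * C N (snd x) \<partial>joint t) / V \<theta>) \<longlonglongrightarrow> two_point t n / V \<theta>"
    using tendsto_divide[OF rhs tendsto_const, of "V \<theta>"] V_pos[OF \<theta>] by simp
  from LIMSEQ_unique[OF lhs[unfolded eq] this]
  show ?thesis by (simp add: sets_particle_law[OF t0] at_site_sets)
qed

lemma
  assumes t: "0 < t"
  shows integrable_second_class: "integrable (particle_law t) (\<lambda>y. of_int (second_class_position y) :: real)"
    and mean_second_class: "(\<integral>y. of_int (second_class_position y) \<partial>particle_law t) = t * (flux_slope \<theta> / V \<theta>)"
proof -
  have t0: "0 \<le> t" using t by simp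
  note tt = t t0 order_refl[of t]
  interpret L: prob_space "particle_law t" by (rule prob_space_particle_law[OF t0])
  let ?Q = "second_class_position"
  define D where "D = distr (particle_law t) (count_space UNIV) ?Q"
  have Qm: "?Q \<in> particle_law t \<rightarrow>\<^sub>M count_space UNIV"
    unfolding measurable_cong_sets[OF sets_particle_law[OF t0] refl] by (rule measurable_second_class_position)
  interpret D: prob_space D unfolding D_def by (rule L.prob_space_distr[OF Qm])
  have setsD: "sets D = UNIV" by (simp add: D_def)
  have single: "measure D {n} = two_point t n / V \<theta>" for n
  proof -
    have "measure D {n} = measure (particle_law t) (?Q -` {n} \<inter> space (particle_law t))"
      unfolding D_def by (rule measure_distr[OF Qm]) simp
    also have "\<dots> = measure (particle_law t) (at_site n)"
    proof (rule L.finite_measure_eq_AE)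
      show "AE y in particle_law t. (y \<in> ?Q -` {n} \<inter> space (particle_law t)) \<longleftrightarrow> (y \<in> at_site n)"
        using AE_particle_law_at_site[OF t0] AE_space
      proof eventually_elim
        case (elim y)
        then obtain k where k: "y \<in> at_site k" by blast
        then show ?case using elim second_class_position_at_site[OF k] at_site_unique[OF k, of n] by auto
      qed
      show "?Q -` {n} \<inter> space (particle_law t) \<in> sets (particle_law t)" by (rule measurable_sets[OF Qm]) simp
      show "at_site n \<in> sets (particle_law t)" unfolding sets_particle_law[OF t0] by (rule at_site_sets)
    qed
    finally show ?thesis by (simp add: particle_law_at_site[OF t])
  qed
  have V0: "V \<theta> \<noteq> 0" using V_pos[OF \<theta>] by simp
  have fin: "measure D A = (\<Sum>j\<in>A. two_point t j) / V \<theta>" if "finite A" for A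
    using D.finite_measure_eq_sum_singleton[OF that] setsD by (simp add: single sum_divide_distrib)
  \<comment> \<open>The sum telescopes by \<open>height_cov_step\<close>; the subtracted variance
    records the initial correlation of the origin with itself.\<close>
  have inc: "(\<Sum>j\<in>{k + 1..k + int m}. two_point t j - (if j = 0 then V \<theta> else 0)) = height_cov t k - height_cov t (k + int m)" for k m
  proof (induction m)
    case (Suc m)
    have "{k + 1..k + int (Suc m)} = insert (k + int (Suc m)) {k + 1..k + int m}" by auto
    then show ?case using Suc height_cov_step[OF tt, of "k + int (Suc m)"] by simp
  qed simp
  \<comment> \<open>For \<open>k \<ge> 0\<close> the levels above \<open>k\<close> miss the origin,
    so the variance term is absent, and the covariance at the far end vanishes in the limit.\<close>
  have up: "measure D {k<..} = height_cov t k / V \<theta>" if k: "0 \<le> k" for k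
  proof -
    have "(\<lambda>m. measure D {k + 1..k + int m}) \<longlonglongrightarrow> measure D (\<Union>m. {k + 1..k + int m})"
      by (rule D.finite_Lim_measure_incseq) (use setsD in \<open>auto simp: incseq_def\<close>)
    moreover have "(\<Union>m. {k + 1..k + int m}) = {k<..}"
    proof (intro equalityI subsetI)
      fix z assume "z \<in> {k<..}"
      then have "z \<in> {k + 1..k + int (nat (z - k))}" by simp
      then show "z \<in> (\<Union>m. {k + 1..k + int m})" by blast
    qed auto
    moreover have "measure D {k + 1..k + int m} = (height_cov t k - height_cov t (k + int m)) / V \<theta>" for m
    proof -
      have "(\<Sum>j\<in>{k + 1..k + int m}. two_point t j) = (\<Sum>j\<in>{k + 1..k + int m}. two_point t j - (if j = 0 then V \<theta> else 0))"
        using k by (intro sum.cong refl) auto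
      then show ?thesis using fin[of "{k + 1..k + int m}"] inc[of k m] by simp
    qed
    moreover have "(\<lambda>m. (height_cov t k - height_cov t (k + int m)) / V \<theta>) \<longlonglongrightarrow> (height_cov t k - 0) / V \<theta>"
      by (intro tendsto_divide tendsto_diff tendsto_const height_cov_tendsto_0[OF tt] V0) (simp add: inj_def)
    ultimately show ?thesis using LIMSEQ_unique by fastforce
  qed
  \<comment> \<open>For negative \<open>k\<close> the levels up to \<open>k\<close> miss the origin
    as well. Now the left end is the far one, which produces the minus sign.\<close>
  have lo: "measure D {..k} = - (height_cov t k / V \<theta>)" if k: "k < 0" for k
  proof -
    have "(\<lambda>m. measure D {k - int m + 1..k}) \<longlonglongrightarrow> measure D (\<Union>m. {k - int m + 1..k})"
      by (rule D.finite_Lim_measure_incseq) (use setsD in \<open>auto simp: incseq_def\<close>)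
    moreover have "(\<Union>m. {k - int m + 1..k}) = {..k}"
    proof (intro equalityI subsetI)
      fix z assume "z \<in> {..k}"
      then have "z \<in> {k - int (nat (k - z + 1)) + 1..k}" by simp
      then show "z \<in> (\<Union>m. {k - int m + 1..k})" by blast
    qed auto
    moreover have "measure D {k - int m + 1..k} = (height_cov t (k - int m) - height_cov t k) / V \<theta>" for m
    proof -
      have "(\<Sum>j\<in>{k - int m + 1..k}. two_point t j) = (\<Sum>j\<in>{k - int m + 1..k}. two_point t j - (if j = 0 then V \<theta> else 0))"
        using k by (intro sum.cong refl) auto
      then show ?thesis using fin[of "{k - int m + 1..k}"] inc[of "k - int m" m] by simp
    qed
    moreover have "(\<lambda>m. (height_cov t (k - int m) - height_cov t k) / V \<theta>) \<longlonglongrightarrow> (0 - height_cov t k) / V \<theta>"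
      by (intro tendsto_divide tendsto_diff tendsto_const height_cov_tendsto_0[OF tt] V0) (simp add: inj_def)
    ultimately show ?thesis using LIMSEQ_unique by fastforce
  qed
  \<comment> \<open>The block from \<open>1 - m\<close> to \<open>0\<close>, paired with the current
    at its right end \<open>0\<close>, yields the indices from \<open>0\<close> to
    \<open>m - 1\<close>; paired with the current at \<open>- m\<close>, it yields those from
    \<open>- m\<close> to \<open>-1\<close>. The difference of the two sums is thus the sum of the
    upper and lower tails, up to the variance.\<close>
  have bound: "(\<Sum>k\<in>{0..<int m}. height_cov t k / V \<theta>) - (\<Sum>k\<in>{- int m..<0}. height_cov t k / V \<theta>) \<le> 2 * height_bound t / V \<theta>" for m
  proof -
    have 1: "(\<Sum>i\<in>{1 - int m..0}. height_cov t (- i)) = (\<Sum>k\<in>{0..<int m}. height_cov t k)"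
      by (rule sum.reindex_bij_witness[where i = uminus and j = uminus]) auto
    have 2: "(\<Sum>i\<in>{1 - int m..0}. height_cov t (- int m - i)) = (\<Sum>k\<in>{- int m..<0}. height_cov t k)"
      by (rule sum.reindex_bij_witness[where i = "\<lambda>k. - int m - k" and j = "\<lambda>i. - int m - i"]) auto
    have "(\<Sum>k\<in>{0..<int m}. height_cov t k) - (\<Sum>k\<in>{- int m..<0}. height_cov t k) \<le> 2 * height_bound t"
      using height_cov_difference_bound[OF tt, of m] unfolding sum_subtractf 1 2 .
    from divide_right_mono[OF this less_imp_le[OF V_pos[OF \<theta>]]] show ?thesis
      by (simp add: diff_divide_distrib sum_divide_distrib)
  qed
  have lim: "(\<lambda>n. \<Sum>k\<in>{- int (2 * Suc n)..<int (2 * Suc n)}. height_cov t k / V \<theta>) \<longlonglongrightarrow> t * flux_slope \<theta> / V \<theta>"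
    using tendsto_divide[OF sum_height_cov_tendsto[OF t] tendsto_const V0] by (simp only: sum_divide_distrib)
  have "strict_mono (\<lambda>n. 2 * Suc n)" by (simp add: strict_mono_def)
  note mean = mean_from_tails[OF D.prob_space_axioms setsD up lo bound lim this]
  show "integrable (particle_law t) (\<lambda>y. of_int (?Q y) :: real)"
    using mean(1) unfolding D_def by (simp add: integrable_distr_eq[OF Qm])
  show "(\<integral>y. of_int (?Q y) \<partial>particle_law t) = t * (flux_slope \<theta> / V \<theta>)"
    using mean(2) unfolding D_def by (simp add: integral_distr[OF Qm])
qed

end

theorem corollary2p5:
  fixes wmin wmax :: "int extended"
    and p q sp sq :: "int \<Rightarrow> int \<Rightarrow> real"
    and f :: "int \<Rightarrow> real"
    and T :: "int_seq set"
    and P :: "real \<Rightarrow> int_seq \<Rightarrow> int_seq measure"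
    and K :: "real \<Rightarrow> int_seq \<times> int_seq \<Rightarrow> (int_seq \<times> int_seq) measure"
    and M :: "'w measure"
    and X :: "real \<Rightarrow> 'w \<Rightarrow> int_seq \<times> int_seq"
    and \<theta> t :: real
  assumes "deposition_dynamics wmin wmax p q sp sq f T P K"
    and "\<theta> \<in> theta_range wmin wmax f"
    and "t > 0"
    and "markov_process M pair_space K X"
    and "distr M pair_space (X 0) = second_class_start wmin wmax f \<theta>"
  shows "flux wmin wmax p q f differentiable at (density_at wmin wmax f \<theta>)
    \<and> integrable M (\<lambda>x. real_of_int (second_class_position (X t x)))
    \<and> (\<integral>x. real_of_int (second_class_position (X t x)) \<partial>M)
        = t * deriv (flux wmin wmax p q f) (density_at wmin wmax f \<theta>)"
proof -
  interpret deposition_dynamics wmin wmax p q sp sq f T P K by fact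
  interpret equilibrium wmin wmax p q sp sq f T P K \<theta>
    by unfold_locales (rule assms(2))
  have t0: "0 \<le> t" using assms(3) by simp
  note flux = has_derivative_flux[OF assms(2), folded density_at_eq[OF assms(2)]]
  have X: "X t \<in> M \<rightarrow>\<^sub>M pair_space" using assms(4) t0 by (simp add: markov_process_def)
  have Q: "(\<lambda>y. real_of_int (second_class_position y)) \<in> borel_measurable pair_space"
    by (rule measurable_compose[OF measurable_second_class_position]) simp
  \<comment> \<open>The given process enters only through this law, to which both the integrability
    and the mean are transported.\<close>
  note law = distr_process_particle_law[OF t0 assms(4,5)]
  have "integrable M (\<lambda>x. real_of_int (second_class_position (X t x)))"
    using integrable_second_class[OF assms(3)] integrable_distr_eq[OF X Q] unfolding law by simp
  moreover have "(\<integral>x. real_of_int (second_class_position (X t x)) \<partial>M) = t * (flux_slope \<theta> / V \<theta>)"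
    using mean_second_class[OF assms(3)] integral_distr[OF X Q] unfolding law by simp
  ultimately show ?thesis
    using flux DERIV_imp_deriv[OF flux] by (auto simp: real_differentiable_def)
qed

end
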